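(* If $n\ge 3$, then the group $\mathrm{SL}_n(\mathbb{Z})$ is first order rigid.
   Context: Two groups are elementarily equivalent if every first order sentence in the language of groups that holds in one also holds in the other. A finitely generated group $\Gamma$ is first order rigid if every finitely generated group that is elementarily equivalent to $\Gamma$ is isomorphic to $\Gamma$. *)

theory Defs
  imports "HOL-Algebra.Generated_Groups" "Jordan_Normal_Form.Determinant"
begin

datatype group_term =
    Var nat
  | One
  | Mult group_term group_term
  | Inv group_term

datatype group_formula =
    Eq group_term group_term
  | Neg group_formula
  | Conj group_formula group_formula
  | Disj group_formula group_formula
  | Impl group_formula group_formula
  | All nat group_formula
  | Exi nat group_formula

primrec term_vars :: "group_term \<Rightarrow> nat set" where
  "term_vars (Var x) = {x}"
| "term_vars One = {}"
| "term_vars (Mult s t) = term_vars s \<union> term_vars t"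
| "term_vars (Inv t) = term_vars t"

primrec free_vars :: "group_formula \<Rightarrow> nat set" where
  "free_vars (Eq s t) = term_vars s \<union> term_vars t"
| "free_vars (Neg \<phi>) = free_vars \<phi>"
| "free_vars (Conj \<phi> \<psi>) = free_vars \<phi> \<union> free_vars \<psi>"
| "free_vars (Disj \<phi> \<psi>) = free_vars \<phi> \<union> free_vars \<psi>"
| "free_vars (Impl \<phi> \<psi>) = free_vars \<phi> \<union> free_vars \<psi>"
| "free_vars (All x \<phi>) = free_vars \<phi> - {x}"
| "free_vars (Exi x \<phi>) = free_vars \<phi> - {x}"

definition sentence :: "group_formula \<Rightarrow> bool" where
  "sentence \<phi> \<longleftrightarrow> free_vars \<phi> = {}"

primrec term_val :: "('a, 'm) monoid_scheme \<Rightarrow> (nat \<Rightarrow> 'a) \<Rightarrow> group_term \<Rightarrow> 'a" where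
  "term_val G e (Var x) = e x"
| "term_val G e One = \<one>\<^bsub>G\<^esub>"
| "term_val G e (Mult s t) = term_val G e s \<otimes>\<^bsub>G\<^esub> term_val G e t"
| "term_val G e (Inv t) = inv\<^bsub>G\<^esub> (term_val G e t)"

primrec sat :: "('a, 'm) monoid_scheme \<Rightarrow> (nat \<Rightarrow> 'a) \<Rightarrow> group_formula \<Rightarrow> bool" where
  "sat G e (Eq s t) \<longleftrightarrow> term_val G e s = term_val G e t"
| "sat G e (Neg \<phi>) \<longleftrightarrow> \<not> sat G e \<phi>"
| "sat G e (Conj \<phi> \<psi>) \<longleftrightarrow> sat G e \<phi> \<and> sat G e \<psi>"
| "sat G e (Disj \<phi> \<psi>) \<longleftrightarrow> sat G e \<phi> \<or> sat G e \<psi>"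
| "sat G e (Impl \<phi> \<psi>) \<longleftrightarrow> (sat G e \<phi> \<longrightarrow> sat G e \<psi>)"
| "sat G e (All x \<phi>) \<longleftrightarrow> (\<forall>a\<in>carrier G. sat G (e(x := a)) \<phi>)"
| "sat G e (Exi x \<phi>) \<longleftrightarrow> (\<exists>a\<in>carrier G. sat G (e(x := a)) \<phi>)"

text \<open>The truth of a sentence does not depend on the assignment, so ranging over all
  assignments into the (nonempty) carrier gives truth in the group.\<close>

definition holds_in :: "('a, 'm) monoid_scheme \<Rightarrow> group_formula \<Rightarrow> bool" where
  "holds_in G \<phi> \<longleftrightarrow> (\<forall>e. range e \<subseteq> carrier G \<longrightarrow> sat G e \<phi>)"

definition elementarily_equivalent ::
    "('a, 'm) monoid_scheme \<Rightarrow> ('b, 'k) monoid_scheme \<Rightarrow> bool" where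
  "elementarily_equivalent G H \<longleftrightarrow>
     (\<forall>\<phi>. sentence \<phi> \<longrightarrow> (holds_in G \<phi> \<longleftrightarrow> holds_in H \<phi>))"

definition finitely_generated :: "('a, 'm) monoid_scheme \<Rightarrow> bool" where
  "finitely_generated G \<longleftrightarrow>
     (\<exists>S. finite S \<and> S \<subseteq> carrier G \<and> generate G S = carrier G)"

text \<open>HOL cannot quantify over types inside a formula, so the type of the elements of the
  competing groups \<open>H\<close> is a parameter. A theorem about \<open>first_order_rigid TYPE('b) G\<close>
  with \<open>'b\<close> a type variable covers the groups over every type.\<close>

definition first_order_rigid :: "'b itself \<Rightarrow> ('a, 'm) monoid_scheme \<Rightarrow> bool" where
  "first_order_rigid (_ :: 'b itself) G \<longleftrightarrow>
     group G \<and> finitely_generated G \<and>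
     (\<forall>H :: 'b monoid. group H \<longrightarrow> finitely_generated H \<longrightarrow>
        elementarily_equivalent H G \<longrightarrow> H \<cong> G)"

definition SL_int :: "nat \<Rightarrow> int mat monoid" where
  "SL_int n =
     \<lparr>carrier = {A \<in> carrier_mat n n. det A = 1}, monoid.mult = (*), one = 1\<^sub>m n\<rparr>"

end

theory Submission
  imports Defs
begin

text \<open>Mark the elementary matrices \<open>s (i, j) = e_ij(1)\<close>. The integers are coded by the root subgroup of the
  \<open>e_02(a)\<close>; arithmetic on the codes is definable by commutators and the entries of a matrix are definable,
  up to a global sign, by double cosets. One formula \<open>model s\<close>, true in the special linear group, records
  the order and multiplication of the codes, the effect of column operations on entries, and a function that
  grows faster than every geometric progression. Let \<open>s'\<close> satisfy it in a finitely generated group \<open>H\<close> that is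
  elementarily equivalent to the special linear group. Entries of a product of generators of \<open>H\<close> are bounded by
  a geometric progression in the length of the product, whereas a nonstandard code would produce a code above
  the whole progression; so every code is a power of \<open>s' (0, 2)\<close>. Column reduction of integer matrices then
  shows that \<open>s'\<close> generates \<open>H\<close>.

  A word that is trivial in the special linear group gives a central element of \<open>H\<close>. Finitely many identities
  write this element as a product of squares of elements of the intersection of the definable subgroups of
  bounded index. In the special linear group such a product is congruent to 1 modulo 3, hence equal to 1
  if it is central. For each length of the product the latter is a sentence, so it transfers to \<open>H\<close>, and the
  word is trivial in \<open>H\<close>. Thus \<open>s' (i, j) \<mapsto> s (i, j)\<close> extends to an isomorphism.\<close>

section \<open>First-order definability in two groups\<close>

text \<open>Two obstacles shape the proof. First, the double coset that reads off an entry contains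
  both e_02(c) and e_02(-c), because diag(-1, -1, 1, ..., 1) lies in both stabilisers. So a matrix
  is definable only up to sign, and a word that is trivial for matrices is at first only known to be
  central in \<open>H\<close>. Level 3 repairs this: being diagonal modulo 3 is independent of the
  sign, units modulo 3 have square 1, and -1 is not congruent to 1. Second, the number of squares
  grows with the word, so removing the sign takes infinitely many sentences, while only one formula
  about the marked tuple can be transferred with a common witness \<open>s'\<close>. These sentences
  must therefore be free of parameters, which is the reason for intersecting over all parameters. A
  finitely generated group has finitely many subgroups with at most \<open>J\<close> cosets, so the
  intersection has finite index, and so has the subgroup generated by its squares. Finite index
  turns the identities for all words into one finite transition table, which fits into
  \<open>model\<close>.\<close>

lemma term_val_cong: "(\<And>x. x \<in> term_vars t \<Longrightarrow> e x = e' x) \<Longrightarrow> term_val G e t = term_val G e' t"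
  by (induction t) auto

lemma sat_cong: "(\<And>x. x \<in> free_vars \<phi> \<Longrightarrow> e x = e' x) \<Longrightarrow> sat G e \<phi> \<longleftrightarrow> sat G e' \<phi>"
proof (induction \<phi> arbitrary: e e')
  case (Eq s t)
  have "term_val G e s = term_val G e' s" "term_val G e t = term_val G e' t"
    using Eq by (auto intro: term_val_cong)
  then show ?case by simp
next
  case (Neg \<phi>)
  then show ?case by (metis free_vars.simps(2) sat.simps(2))
next
  case (Conj \<phi> \<psi>)
  have "sat G e \<phi> \<longleftrightarrow> sat G e' \<phi>" "sat G e \<psi> \<longleftrightarrow> sat G e' \<psi>"
    using Conj.prems by (auto intro!: Conj.IH)
  then show ?case by simp
next
  case (Disj \<phi> \<psi>)
  have "sat G e \<phi> \<longleftrightarrow> sat G e' \<phi>" "sat G e \<psi> \<longleftrightarrow> sat G e' \<psi>"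
    using Disj.prems by (auto intro!: Disj.IH)
  then show ?case by simp
next
  case (Impl \<phi> \<psi>)
  have "sat G e \<phi> \<longleftrightarrow> sat G e' \<phi>" "sat G e \<psi> \<longleftrightarrow> sat G e' \<psi>"
    using Impl.prems by (auto intro!: Impl.IH)
  then show ?case by simp
next
  case (All x \<phi>)
  have "sat G (e(x := a)) \<phi> \<longleftrightarrow> sat G (e'(x := a)) \<phi>" for a
    using All.prems by (intro All.IH) auto
  then show ?case by simp
next
  case (Exi x \<phi>)
  have "sat G (e(x := a)) \<phi> \<longleftrightarrow> sat G (e'(x := a)) \<phi>" for a
    using Exi.prems by (intro Exi.IH) auto
  then show ?case by simp
qed

fun exi_block :: "nat \<Rightarrow> nat \<Rightarrow> group_formula \<Rightarrow> group_formula" where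
  "exi_block k 0 \<phi> = \<phi>"
| "exi_block k (Suc m) \<phi> = Exi k (exi_block (Suc k) m \<phi>)"

lemma free_vars_exi_block: "free_vars (exi_block k m \<phi>) = free_vars \<phi> - {k..<k + m}"
  by (induction m arbitrary: k) auto

lemma sat_exi_block:
  "sat G e (exi_block k m \<phi>) \<longleftrightarrow>
     (\<exists>xs. length xs = m \<and> set xs \<subseteq> carrier G \<and>
       sat G (\<lambda>i. if k \<le> i \<and> i < k + m then xs ! (i - k) else e i) \<phi>)"
proof (induction m arbitrary: k e)
  case 0
  have "(\<lambda>i. if k \<le> i \<and> i < k + 0 then [] ! (i - k) else e i) = e" by (rule ext) (metis add.right_neutral leD)
  then show ?case by simp
next
  case (Suc m)
  have env: "(\<lambda>i. if Suc k \<le> i \<and> i < Suc k + m then xs ! (i - Suc k) else (e(k := a)) i)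
    = (\<lambda>i. if k \<le> i \<and> i < k + Suc m then (a # xs) ! (i - k) else e i)" for a xs
  proof
    fix i
    consider "i < k" | "i = k" | "Suc k \<le> i" by linarith
    then show "(if Suc k \<le> i \<and> i < Suc k + m then xs ! (i - Suc k) else (e(k := a)) i)
      = (if k \<le> i \<and> i < k + Suc m then (a # xs) ! (i - k) else e i)"
    proof cases
      case 3
      then obtain d where "i = Suc (k + d)" by (metis Suc_le_eq less_iff_Suc_add)
      then show ?thesis by simp
    qed simp_all
  qed
  have "sat G e (exi_block k (Suc m) \<phi>) \<longleftrightarrow> (\<exists>a\<in>carrier G. \<exists>xs. length xs = m \<and> set xs \<subseteq> carrier G \<and>
       sat G (\<lambda>i. if k \<le> i \<and> i < k + Suc m then (a # xs) ! (i - k) else e i) \<phi>)"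
    by (simp only: exi_block.simps sat.simps Suc env)
  also have "\<dots> \<longleftrightarrow> (\<exists>xs. length xs = Suc m \<and> set xs \<subseteq> carrier G \<and>
       sat G (\<lambda>i. if k \<le> i \<and> i < k + Suc m then xs ! (i - k) else e i) \<phi>)" (is "?L \<longleftrightarrow> ?R")
  proof
    assume ?L
    then obtain a xs where "a \<in> carrier G" "length xs = m" "set xs \<subseteq> carrier G"
      "sat G (\<lambda>i. if k \<le> i \<and> i < k + Suc m then (a # xs) ! (i - k) else e i) \<phi>" by blast
    then show ?R by (intro exI[of _ "a # xs"]) simp
  next
    assume ?R
    then obtain xs where xs: "length xs = Suc m" "set xs \<subseteq> carrier G"
      "sat G (\<lambda>i. if k \<le> i \<and> i < k + Suc m then xs ! (i - k) else e i) \<phi>" by blast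
    then obtain a ys where ys: "xs = a # ys" by (cases xs) auto
    show ?L using xs unfolding ys by (intro bexI[of _ a] exI[of _ ys]) simp_all
  qed
  finally show ?case .
qed

section \<open>Contexts of variables as lists of projections, for two groups at once\<close>

type_synonym ('e, 'a, 'f, 'b) projs = "(('e \<Rightarrow> 'a) \<times> ('f \<Rightarrow> 'b)) list"

text \<open>A list of projections from an abstract environment plays the role of a context of variables;
  binding a variable extends the environment by a component, so no freshness side conditions
  arise.\<close>

definition env :: "('a, 'm) monoid_scheme \<Rightarrow> ('e \<Rightarrow> 'a) list \<Rightarrow> 'e \<Rightarrow> nat \<Rightarrow> 'a" where
  "env G X e i = (if i < length X then (X ! i) e else \<one>\<^bsub>G\<^esub>)"

definition valid :: "('a, 'm) monoid_scheme \<Rightarrow> ('e \<Rightarrow> 'a) list \<Rightarrow> 'e \<Rightarrow> bool" where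
  "valid G X e \<longleftrightarrow> (\<forall>t\<in>set X. t e \<in> carrier G)"

text \<open>\<open>\<pi>\<close> recovers the old environment and \<open>y\<close> supplies the
  values of the new variables. These go to the end of the list, so the old variables keep their
  numbers and terms are reused without renaming.\<close>

definition ext :: "'i list \<Rightarrow> ('p \<Rightarrow> 'i \<Rightarrow> 'a) \<Rightarrow> ('p \<Rightarrow> 'e) \<Rightarrow> ('e \<Rightarrow> 'a) list \<Rightarrow> ('p \<Rightarrow> 'a) list" where
  "ext I y \<pi> X = map (\<lambda>t p. t (\<pi> p)) X @ map (\<lambda>i p. y p i) I"

definition lift :: "('e, 'a, 'f, 'b) projs \<Rightarrow> ('e \<times> 'a, 'a, 'f \<times> 'b, 'b) projs" where
  "lift X = map (\<lambda>(t, u). (\<lambda>p. t (fst p), \<lambda>q. u (fst q))) X @ [(snd, snd)]"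

definition liftf ::
    "'i list \<Rightarrow> ('e, 'a, 'f, 'b) projs \<Rightarrow> ('e \<times> ('i \<Rightarrow> 'a), 'a, 'f \<times> ('i \<Rightarrow> 'b), 'b) projs" where
  "liftf I X = map (\<lambda>(t, u). (\<lambda>p. t (fst p), \<lambda>q. u (fst q))) X
     @ map (\<lambda>i. (\<lambda>p. snd p i, \<lambda>q. snd q i)) I"

lemma length_ext [simp]: "length (ext I y \<pi> X) = length X + length I"
  by (simp add: ext_def)

lemma valid_ext: "valid G (ext I y \<pi> X) p \<longleftrightarrow> valid G X (\<pi> p) \<and> (\<forall>i\<in>set I. y p i \<in> carrier G)"
  by (simp add: valid_def ext_def ball_Un)

lemma env_ext:
  "env G (ext I y \<pi> X) p i = (if i < length X then env G X (\<pi> p) i else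
     if i < length X + length I then y p (I ! (i - length X)) else \<one>\<^bsub>G\<^esub>)"
  by (auto simp: env_def ext_def nth_append)

lemma map_lift:
  "map fst (lift X) = ext [()] (\<lambda>p _. snd p) fst (map fst X)"
  "map snd (lift X) = ext [()] (\<lambda>p _. snd p) fst (map snd X)"
  by (simp_all add: lift_def ext_def case_prod_beta fun_eq_iff)

lemma map_liftf:
  "map fst (liftf I X) = ext I snd fst (map fst X)"
  "map snd (liftf I X) = ext I snd fst (map snd X)"
  by (simp_all add: liftf_def ext_def case_prod_beta)

text \<open>The bound on the variables makes the value independent of the padding in
  \<open>env\<close>, which is what permits weakening in \<open>tdef_ext\<close>.\<close>

definition tdef :: "('a, 'm) monoid_scheme \<Rightarrow> ('e \<Rightarrow> 'a) list \<Rightarrow> group_term \<Rightarrow> ('e \<Rightarrow> 'a) \<Rightarrow> bool" where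
  "tdef G X \<tau> t \<longleftrightarrow> term_vars \<tau> \<subseteq> {..<length X} \<and> (\<forall>e. valid G X e \<longrightarrow> term_val G (env G X e) \<tau> = t e)"

definition fdef :: "('a, 'm) monoid_scheme \<Rightarrow> ('e \<Rightarrow> 'a) list \<Rightarrow> group_formula \<Rightarrow> ('e \<Rightarrow> bool) \<Rightarrow> bool" where
  "fdef G X \<phi> P \<longleftrightarrow> free_vars \<phi> \<subseteq> {..<length X} \<and> (\<forall>e. valid G X e \<longrightarrow> sat G (env G X e) \<phi> = P e)"

lemma tdef_nth: "i < length X \<Longrightarrow> tdef G X (Var i) (X ! i)"
  by (simp add: tdef_def env_def)

lemma tdef_ext:
  assumes "tdef G X \<tau> t"
  shows "tdef G (ext I y \<pi> X) \<tau> (\<lambda>p. t (\<pi> p))"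
proof -
  have "term_val G (env G (ext I y \<pi> X) p) \<tau> = term_val G (env G X (\<pi> p)) \<tau>" for p
    using assms by (intro term_val_cong) (auto simp: tdef_def env_ext)
  then show ?thesis using assms by (auto simp: tdef_def valid_ext)
qed

text \<open>The bound variable receives the number \<open>length X\<close>, the first one outside
  the context. Updating the assignment there amounts to extending the environment, so no capture can
  occur.\<close>

lemma fdef_Exi:
  assumes "fdef G (ext [()] (\<lambda>p _. snd p) fst X) \<phi> (\<lambda>p. P (fst p) (snd p))"
  shows "fdef G X (Exi (length X) \<phi>) (\<lambda>e. \<exists>x\<in>carrier G. P e x)"
proof -
  have "sat G ((env G X e)(length X := a)) \<phi> \<longleftrightarrow> P e a" if "valid G X e" "a \<in> carrier G" for e a
  proof -
    have "sat G ((env G X e)(length X := a)) \<phi> \<longleftrightarrow> sat G (env G (ext [()] (\<lambda>p _. snd p) fst X) (e, a)) \<phi>"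
      using assms by (intro sat_cong) (auto simp: fdef_def env_ext)
    then show ?thesis using that assms by (auto simp: fdef_def valid_ext)
  qed
  then show ?thesis using assms by (auto simp: fdef_def)
qed

lemma fdef_exi_block:
  assumes \<phi>: "fdef G (ext J snd fst X) \<phi> (\<lambda>p. P (fst p) (snd p))" and J: "distinct J"
  shows "fdef G X (exi_block (length X) (length J) \<phi>) (\<lambda>e. \<exists>x. (\<forall>i\<in>set J. x i \<in> carrier G) \<and> P e x)"
proof -
  let ?k = "length X" and ?m = "length J"
  have "sat G (env G X e) (exi_block ?k ?m \<phi>) \<longleftrightarrow> (\<exists>x. (\<forall>i\<in>set J. x i \<in> carrier G) \<and> P e x)"
    if e: "valid G X e" for e
  proof -
    have *: "sat G (\<lambda>i. if ?k \<le> i \<and> i < ?k + ?m then map x J ! (i - ?k) else env G X e i) \<phi> \<longleftrightarrow> P e x"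
      if "\<forall>i\<in>set J. x i \<in> carrier G" for x
    proof -
      have "sat G (\<lambda>i. if ?k \<le> i \<and> i < ?k + ?m then map x J ! (i - ?k) else env G X e i) \<phi>
          \<longleftrightarrow> sat G (env G (ext J snd fst X) (e, x)) \<phi>"
        using \<phi> by (intro sat_cong) (auto simp: fdef_def env_ext)
      then show ?thesis using that e \<phi> by (auto simp: fdef_def valid_ext)
    qed
    \<comment> \<open>A list of values is read as a tuple indexed by \<open>J\<close>; this is where
      \<open>J\<close> has to be free of repetitions.\<close>
    have ex: "\<exists>x. xs = map x J" if "length xs = ?m" for xs :: "'a list"
      by (rule exI[of _ "\<lambda>i. the (map_of (zip J xs) i)"])
        (use that J in \<open>auto intro!: nth_equalityI simp: map_of_zip_nth\<close>)
    show ?thesis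
    proof
      assume "sat G (env G X e) (exi_block ?k ?m \<phi>)"
      then obtain xs where xs: "length xs = ?m" "set xs \<subseteq> carrier G"
        "sat G (\<lambda>i. if ?k \<le> i \<and> i < ?k + ?m then xs ! (i - ?k) else env G X e i) \<phi>"
        unfolding sat_exi_block by blast
      obtain x where x: "xs = map x J" using ex xs(1) by blast
      have "\<forall>i\<in>set J. x i \<in> carrier G" using xs(2) x by auto
      then show "\<exists>x. (\<forall>i\<in>set J. x i \<in> carrier G) \<and> P e x" using * xs(3) x by blast
    next
      assume "\<exists>x. (\<forall>i\<in>set J. x i \<in> carrier G) \<and> P e x"
      then obtain x where x: "\<forall>i\<in>set J. x i \<in> carrier G" "P e x" by blast
      then show "sat G (env G X e) (exi_block ?k ?m \<phi>)"
        unfolding sat_exi_block using * by (intro exI[of _ "map x J"]) auto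
    qed
  qed
  then show ?thesis using \<phi> by (auto simp: fdef_def free_vars_exi_block)
qed

lemma fdef_holds_in:
  assumes "fdef G ([] :: (unit \<Rightarrow> 'a) list) \<phi> (\<lambda>_. P)" "\<one>\<^bsub>G\<^esub> \<in> carrier G"
  shows "holds_in G \<phi> \<longleftrightarrow> P"
proof -
  let ?e = "env G ([] :: (unit \<Rightarrow> 'a) list) ()"
  have "free_vars \<phi> = {}" "sat G ?e \<phi> = P" using assms(1) by (auto simp: fdef_def valid_def)
  moreover from this have "sat G e \<phi> = P" for e using sat_cong[of \<phi> e ?e G] by simp
  moreover have "range ?e \<subseteq> carrier G" using assms(2) by (auto simp: env_def)
  ultimately show ?thesis unfolding holds_in_def by blast
qed

section \<open>Simultaneous definability in two groups\<close>

locale two_groups = G: group G + H: group H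
  for G :: "('a, 'm) monoid_scheme" and H :: "('b, 'k) monoid_scheme"
begin

text \<open>A single syntactic term has to serve both groups. The closure rules below build both
  interpretations in parallel, so the formulas of the next section never have to be written out as
  syntax.\<close>

definition dft :: "('e, 'a, 'f, 'b) projs \<Rightarrow> ('e \<Rightarrow> 'a) \<Rightarrow> ('f \<Rightarrow> 'b) \<Rightarrow> bool" where
  "dft X t u \<longleftrightarrow> (\<exists>\<tau>. tdef G (map fst X) \<tau> t \<and> tdef H (map snd X) \<tau> u)"

definition dfb :: "('e, 'a, 'f, 'b) projs \<Rightarrow> ('e \<Rightarrow> bool) \<Rightarrow> ('f \<Rightarrow> bool) \<Rightarrow> bool" where
  "dfb X P Q \<longleftrightarrow> (\<exists>\<phi>. fdef G (map fst X) \<phi> P \<and> fdef H (map snd X) \<phi> Q)"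

lemma dft_nth: "i < length X \<Longrightarrow> dft X (fst (X ! i)) (snd (X ! i))"
  unfolding dft_def using tdef_nth[of i "map fst X"] tdef_nth[of i "map snd X"] by auto

lemma dft_one: "dft X (\<lambda>e. \<one>\<^bsub>G\<^esub>) (\<lambda>f. \<one>\<^bsub>H\<^esub>)"
  unfolding dft_def by (rule exI[of _ One]) (simp add: tdef_def)

lemma dft_mult:
  assumes "dft X t u" "dft X t' u'"
  shows "dft X (\<lambda>e. t e \<otimes>\<^bsub>G\<^esub> t' e) (\<lambda>f. u f \<otimes>\<^bsub>H\<^esub> u' f)"
proof -
  obtain \<tau> \<tau>' where "tdef G (map fst X) \<tau> t" "tdef H (map snd X) \<tau> u"
    "tdef G (map fst X) \<tau>' t'" "tdef H (map snd X) \<tau>' u'" using assms unfolding dft_def by blast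
  then show ?thesis unfolding dft_def by (intro exI[of _ "Mult \<tau> \<tau>'"]) (simp add: tdef_def)
qed

lemma dft_inv:
  assumes "dft X t u"
  shows "dft X (\<lambda>e. inv\<^bsub>G\<^esub> (t e)) (\<lambda>f. inv\<^bsub>H\<^esub> (u f))"
proof -
  obtain \<tau> where "tdef G (map fst X) \<tau> t" "tdef H (map snd X) \<tau> u" using assms unfolding dft_def by blast
  then show ?thesis unfolding dft_def by (intro exI[of _ "Inv \<tau>"]) (simp add: tdef_def)
qed

lemma dft_if: "dft X t u \<Longrightarrow> dft X t' u' \<Longrightarrow>
  dft X (\<lambda>e. if b then t e else t' e) (\<lambda>f. if b then u f else u' f)"
  by (cases b) auto

lemma dft_lift: "dft X t u \<Longrightarrow> dft (lift X) (\<lambda>p. t (fst p)) (\<lambda>q. u (fst q))"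
  unfolding dft_def map_lift by (elim exE conjE) (intro exI conjI tdef_ext)

lemma dft_liftf: "dft X t u \<Longrightarrow> dft (liftf I X) (\<lambda>p. t (fst p)) (\<lambda>q. u (fst q))"
  unfolding dft_def map_liftf by (elim exE conjE) (intro exI conjI tdef_ext)

lemma dft_last: "dft (lift X) (\<lambda>p. snd p) (\<lambda>q. snd q)"
  using dft_nth[of "length X" "lift X"] by (simp add: lift_def nth_append)

lemma dft_lastf: "i \<in> set I \<Longrightarrow> dft (liftf I X) (\<lambda>p. snd p i) (\<lambda>q. snd q i)"
proof -
  assume "i \<in> set I"
  then obtain k where "k < length I" "i = I ! k" by (metis in_set_conv_nth)
  then show ?thesis
    using dft_nth[of "length X + k" "liftf I X"] by (simp add: liftf_def nth_append)
qed

lemma dfb_eq: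
  assumes "dft X t u" "dft X t' u'"
  shows "dfb X (\<lambda>e. t e = t' e) (\<lambda>f. u f = u' f)"
proof -
  obtain \<tau> \<tau>' where "tdef G (map fst X) \<tau> t" "tdef H (map snd X) \<tau> u"
    "tdef G (map fst X) \<tau>' t'" "tdef H (map snd X) \<tau>' u'" using assms unfolding dft_def by blast
  then show ?thesis unfolding dfb_def by (intro exI[of _ "Eq \<tau> \<tau>'"]) (simp add: tdef_def fdef_def)
qed

lemma dfb_not: "dfb X P Q \<Longrightarrow> dfb X (\<lambda>e. \<not> P e) (\<lambda>f. \<not> Q f)"
proof -
  assume "dfb X P Q"
  then obtain \<phi> where "fdef G (map fst X) \<phi> P" "fdef H (map snd X) \<phi> Q" unfolding dfb_def by blast
  then show ?thesis unfolding dfb_def by (intro exI[of _ "Neg \<phi>"]) (simp add: fdef_def)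
qed

lemma dfb_conj:
  assumes "dfb X P Q" "dfb X P' Q'"
  shows "dfb X (\<lambda>e. P e \<and> P' e) (\<lambda>f. Q f \<and> Q' f)"
proof -
  obtain \<phi> \<psi> where "fdef G (map fst X) \<phi> P" "fdef H (map snd X) \<phi> Q"
    "fdef G (map fst X) \<psi> P'" "fdef H (map snd X) \<psi> Q'" using assms unfolding dfb_def by blast
  then show ?thesis unfolding dfb_def by (intro exI[of _ "Conj \<phi> \<psi>"]) (simp add: fdef_def)
qed

lemma dfb_disj:
  assumes "dfb X P Q" "dfb X P' Q'"
  shows "dfb X (\<lambda>e. P e \<or> P' e) (\<lambda>f. Q f \<or> Q' f)"
  using dfb_not[OF dfb_conj[OF dfb_not[OF assms(1)] dfb_not[OF assms(2)]]] by simp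

lemma dfb_imp:
  assumes "dfb X P Q" "dfb X P' Q'"
  shows "dfb X (\<lambda>e. P e \<longrightarrow> P' e) (\<lambda>f. Q f \<longrightarrow> Q' f)"
  using dfb_disj[OF dfb_not[OF assms(1)] assms(2)] by (simp only: imp_conv_disj)

lemma dfb_const: "dfb X (\<lambda>e. b) (\<lambda>f. b)"
  unfolding dfb_def by (rule exI[of _ "if b then Eq One One else Neg (Eq One One)"]) (simp add: fdef_def)

text \<open>The index set is finite and fixed outside the language, so this quantifier unfolds to a
  finite conjunction.\<close>

lemma dfb_ball:
  assumes "finite I" "\<And>i. i \<in> I \<Longrightarrow> dfb X (P i) (Q i)"
  shows "dfb X (\<lambda>e. \<forall>i\<in>I. P i e) (\<lambda>f. \<forall>i\<in>I. Q i f)"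
  using assms
proof (induction I rule: finite_induct)
  case empty
  then show ?case using dfb_const[of X True] by simp
next
  case (insert i I)
  then show ?case using dfb_conj[of X "P i" "Q i"] by simp
qed

lemma dfb_bex:
  assumes "finite I" "\<And>i. i \<in> I \<Longrightarrow> dfb X (P i) (Q i)"
  shows "dfb X (\<lambda>e. \<exists>i\<in>I. P i e) (\<lambda>f. \<exists>i\<in>I. Q i f)"
  using dfb_not[OF dfb_ball[OF assms(1), of X "\<lambda>i e. \<not> P i e" "\<lambda>i f. \<not> Q i f"]]
    dfb_not[OF assms(2)] by simp

lemma dfb_ex:
  assumes "dfb (lift X) (\<lambda>p. P (fst p) (snd p)) (\<lambda>q. Q (fst q) (snd q))"
  shows "dfb X (\<lambda>e. \<exists>x\<in>carrier G. P e x) (\<lambda>f. \<exists>y\<in>carrier H. Q f y)"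
  using assms fdef_Exi[of _ "map fst X"] fdef_Exi[of _ "map snd X"]
  unfolding dfb_def map_lift length_map by blast

lemma dfb_all:
  assumes "dfb (lift X) (\<lambda>p. P (fst p) (snd p)) (\<lambda>q. Q (fst q) (snd q))"
  shows "dfb X (\<lambda>e. \<forall>x\<in>carrier G. P e x) (\<lambda>f. \<forall>y\<in>carrier H. Q f y)"
  using dfb_not[OF dfb_ex[OF dfb_not[OF assms]]] by simp

text \<open>Quantification over a finite tuple of group elements. The enumeration of the index set
  is arbitrary, so definability of the body is asked for every enumeration.\<close>

lemma dfb_exf:
  assumes "finite I" and
    "\<And>J. set J = I \<Longrightarrow> dfb (liftf J X) (\<lambda>p. P (fst p) (snd p)) (\<lambda>q. Q (fst q) (snd q))"
  shows "dfb X (\<lambda>e. \<exists>x. (\<forall>i\<in>I. x i \<in> carrier G) \<and> P e x) (\<lambda>f. \<exists>y. (\<forall>i\<in>I. y i \<in> carrier H) \<and> Q f y)"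
proof -
  obtain J where J: "set J = I" "distinct J" using assms(1) finite_distinct_list by blast
  show ?thesis
    using assms(2)[OF J(1)] fdef_exi_block[OF _ J(2), of _ "map fst X"] fdef_exi_block[OF _ J(2), of _ "map snd X"]
    unfolding dfb_def map_liftf length_map J(1) by blast
qed

lemma dfb_allf:
  assumes "finite I" and
    "\<And>J. set J = I \<Longrightarrow> dfb (liftf J X) (\<lambda>p. P (fst p) (snd p)) (\<lambda>q. Q (fst q) (snd q))"
  shows "dfb X (\<lambda>e. \<forall>x. (\<forall>i\<in>I. x i \<in> carrier G) \<longrightarrow> P e x) (\<lambda>f. \<forall>y. (\<forall>i\<in>I. y i \<in> carrier H) \<longrightarrow> Q f y)"
proof -
  have "dfb X (\<lambda>e. \<not> (\<exists>x. (\<forall>i\<in>I. x i \<in> carrier G) \<and> \<not> P e x))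
     (\<lambda>f. \<not> (\<exists>y. (\<forall>i\<in>I. y i \<in> carrier H) \<and> \<not> Q f y))"
    by (rule dfb_not[OF dfb_exf[OF assms(1)]]) (rule dfb_not, rule assms(2))
  then show ?thesis by (simp only: not_ex de_Morgan_conj not_not imp_conv_disj)
qed

text \<open>In the empty context the defining formula is a sentence; this is the one place where
  elementary equivalence enters.\<close>

lemma dfb_transfer:
  fixes P Q :: bool
  assumes "dfb ([] :: (unit, 'a, unit, 'b) projs) (\<lambda>_. P) (\<lambda>_. Q)" "elementarily_equivalent H G"
  shows "P \<longleftrightarrow> Q"
proof -
  obtain \<phi> where "fdef G ([] :: (unit \<Rightarrow> 'a) list) \<phi> (\<lambda>_. P)" "fdef H ([] :: (unit \<Rightarrow> 'b) list) \<phi> (\<lambda>_. Q)"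
    using assms(1) unfolding dfb_def by auto
  then show ?thesis
    using fdef_holds_in[of G] fdef_holds_in[of H] assms(2) G.one_closed H.one_closed
    unfolding elementarily_equivalent_def sentence_def by (auto simp: fdef_def)
qed

end

section \<open>Formulas for arithmetic and matrix entries\<close>

definition cm :: "('a, 'm) monoid_scheme \<Rightarrow> 'a \<Rightarrow> 'a \<Rightarrow> bool" where
  "cm K x y \<longleftrightarrow> x \<otimes>\<^bsub>K\<^esub> y = y \<otimes>\<^bsub>K\<^esub> x"

definition com :: "('a, 'm) monoid_scheme \<Rightarrow> 'a \<Rightarrow> 'a \<Rightarrow> 'a" where
  "com K x y = x \<otimes>\<^bsub>K\<^esub> y \<otimes>\<^bsub>K\<^esub> inv\<^bsub>K\<^esub> x \<otimes>\<^bsub>K\<^esub> inv\<^bsub>K\<^esub> y"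

definition cen :: "('a, 'm) monoid_scheme \<Rightarrow> 'a \<Rightarrow> bool" where
  "cen K g \<longleftrightarrow> (\<forall>x\<in>carrier K. cm K g x)"

type_synonym 'a tup = "nat \<times> nat \<Rightarrow> 'a"

text \<open>The parameter \<open>s\<close> stands for the elementary matrices: \<open>s (i, j) = e_ij(1)\<close>. In the special linear group
  \<open>cuni i j\<close> then defines the set of all \<open>\<plusminus> e_ij(c)\<close>. Commutators remove the sign, so \<open>num\<close> defines
  the root subgroup of the \<open>e_02(a)\<close>, which code the integers \<open>a\<close>, and \<open>mulr\<close> multiplies codes
  by means of \<open>[e_01(a), e_12(b)] = e_02(ab)\<close>.\<close>

definition cuni :: "('a, 'm) monoid_scheme \<Rightarrow> nat \<Rightarrow> 'a tup \<Rightarrow> nat \<Rightarrow> nat \<Rightarrow> 'a \<Rightarrow> bool" where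
  "cuni K n s i j x \<longleftrightarrow>
     (\<forall>k\<in>{..<n}. \<forall>l\<in>{..<n}. k \<noteq> l \<and> l \<noteq> i \<and> k \<noteq> j \<longrightarrow> cm K x (s (k, l)))"

definition num :: "('a, 'm) monoid_scheme \<Rightarrow> nat \<Rightarrow> 'a tup \<Rightarrow> 'a \<Rightarrow> bool" where
  "num K n s u \<longleftrightarrow> (\<exists>x\<in>carrier K. cuni K n s 0 1 x \<and> u = com K x (s (1, 2)))"

definition mulr :: "('a, 'm) monoid_scheme \<Rightarrow> nat \<Rightarrow> 'a tup \<Rightarrow> 'a \<Rightarrow> 'a \<Rightarrow> 'a \<Rightarrow> bool" where
  "mulr K n s u v w \<longleftrightarrow> (\<exists>x\<in>carrier K. \<exists>y\<in>carrier K. cuni K n s 0 1 x \<and> cuni K n s 1 2 y \<and>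
     u = com K x (s (1, 2)) \<and> v = com K (s (0, 1)) y \<and> w = com K x y)"

definition sq4 :: "('a, 'm) monoid_scheme \<Rightarrow> nat \<Rightarrow> 'a tup \<Rightarrow> 'a \<Rightarrow> bool" where
  "sq4 K n s p \<longleftrightarrow> (\<exists>a\<in>carrier K. \<exists>b\<in>carrier K. \<exists>c\<in>carrier K. \<exists>d\<in>carrier K.
     \<exists>a'\<in>carrier K. \<exists>b'\<in>carrier K. \<exists>c'\<in>carrier K. \<exists>d'\<in>carrier K.
     mulr K n s a a a' \<and> mulr K n s b b b' \<and> mulr K n s c c c' \<and> mulr K n s d d d' \<and>
     p = a' \<otimes>\<^bsub>K\<^esub> b' \<otimes>\<^bsub>K\<^esub> c' \<otimes>\<^bsub>K\<^esub> d')"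

text \<open>An integer \<open>a\<close> is nonnegative iff \<open>p * a = q\<close> for sums of four squares \<open>p \<noteq> 0\<close> and \<open>q\<close>. The quotient form
  makes the descent in Lagrange's theorem unnecessary.\<close>

definition nn :: "('a, 'm) monoid_scheme \<Rightarrow> nat \<Rightarrow> 'a tup \<Rightarrow> 'a \<Rightarrow> bool" where
  "nn K n s u \<longleftrightarrow> (\<exists>p\<in>carrier K. \<exists>q\<in>carrier K.
     sq4 K n s p \<and> p \<noteq> \<one>\<^bsub>K\<^esub> \<and> sq4 K n s q \<and> mulr K n s p u q)"

definition le :: "('a, 'm) monoid_scheme \<Rightarrow> nat \<Rightarrow> 'a tup \<Rightarrow> 'a \<Rightarrow> 'a \<Rightarrow> bool" where
  "le K n s u v \<longleftrightarrow> num K n s u \<and> num K n s v \<and> nn K n s (inv\<^bsub>K\<^esub> u \<otimes>\<^bsub>K\<^esub> v)"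

text \<open>In the special linear group \<open>colst j p\<close> says that column \<open>j\<close> of \<open>p\<close> is plus or minus a unit vector and
  \<open>rowst i q\<close> says the same of row \<open>i\<close> of \<open>q\<close>, so \<open>ent g u\<close> expresses that \<open>u\<close> codes plus or minus the
  entry of \<open>g\<close> at \<open>(0, 2)\<close>.\<close>

definition colst :: "('a, 'm) monoid_scheme \<Rightarrow> nat \<Rightarrow> 'a tup \<Rightarrow> nat \<Rightarrow> 'a \<Rightarrow> bool" where
  "colst K n s j p \<longleftrightarrow> (\<forall>k\<in>{..<n}. \<forall>l\<in>{..<n}. k \<noteq> j \<and> l \<noteq> j \<longrightarrow>
     cm K (p \<otimes>\<^bsub>K\<^esub> s (j, k) \<otimes>\<^bsub>K\<^esub> inv\<^bsub>K\<^esub> p) (s (j, l)))"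

definition rowst :: "('a, 'm) monoid_scheme \<Rightarrow> nat \<Rightarrow> 'a tup \<Rightarrow> nat \<Rightarrow> 'a \<Rightarrow> bool" where
  "rowst K n s i q \<longleftrightarrow> (\<forall>k\<in>{..<n}. \<forall>l\<in>{..<n}. k \<noteq> i \<and> l \<noteq> i \<longrightarrow>
     cm K (inv\<^bsub>K\<^esub> q \<otimes>\<^bsub>K\<^esub> s (k, i) \<otimes>\<^bsub>K\<^esub> q) (s (l, i)))"

definition ent :: "('a, 'm) monoid_scheme \<Rightarrow> nat \<Rightarrow> 'a tup \<Rightarrow> 'a \<Rightarrow> 'a \<Rightarrow> bool" where
  "ent K n s g u \<longleftrightarrow> num K n s u \<and> (\<exists>q\<in>carrier K. \<exists>p\<in>carrier K.
     rowst K n s 0 q \<and> colst K n s 2 p \<and> g = q \<otimes>\<^bsub>K\<^esub> u \<otimes>\<^bsub>K\<^esub> p)"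

text \<open>Row 0 of \<open>rw i\<close> is the unit vector \<open>i\<close> and column 2 of \<open>cw j\<close> is the unit vector \<open>j\<close>. Hence the entry of
  \<open>tst i k j l g\<close> at \<open>(0, 2)\<close> is the sum of the entries of \<open>g\<close> over the rectangle \<open>{i, k} \<times> {j, l}\<close>.
  The absolute values of these sums determine the matrix up to a global sign, so \<open>repr g A\<close> says that \<open>A\<close> codes
  \<open>g\<close> or \<open>- g\<close>.\<close>

definition rw :: "('a, 'm) monoid_scheme \<Rightarrow> 'a tup \<Rightarrow> nat \<Rightarrow> 'a" where
  "rw K s i = (if i = 0 then \<one>\<^bsub>K\<^esub> else s (0, i) \<otimes>\<^bsub>K\<^esub> inv\<^bsub>K\<^esub> (s (i, 0)) \<otimes>\<^bsub>K\<^esub> s (0, i))"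

definition cw :: "('a, 'm) monoid_scheme \<Rightarrow> 'a tup \<Rightarrow> nat \<Rightarrow> 'a" where
  "cw K s j = (if j = 2 then \<one>\<^bsub>K\<^esub> else s (j, 2) \<otimes>\<^bsub>K\<^esub> inv\<^bsub>K\<^esub> (s (2, j)) \<otimes>\<^bsub>K\<^esub> s (j, 2))"

definition tst :: "('a, 'm) monoid_scheme \<Rightarrow> 'a tup \<Rightarrow> nat \<Rightarrow> nat \<Rightarrow> nat \<Rightarrow> nat \<Rightarrow> 'a \<Rightarrow> 'a" where
  "tst K s i k j l g = rw K s i \<otimes>\<^bsub>K\<^esub> (if k = i then \<one>\<^bsub>K\<^esub> else s (i, k)) \<otimes>\<^bsub>K\<^esub> g
     \<otimes>\<^bsub>K\<^esub> (if l = j then \<one>\<^bsub>K\<^esub> else s (l, j)) \<otimes>\<^bsub>K\<^esub> cw K s j"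

definition val :: "('a, 'm) monoid_scheme \<Rightarrow> 'a tup \<Rightarrow> nat \<Rightarrow> nat \<Rightarrow> nat \<Rightarrow> nat \<Rightarrow> 'a" where
  "val K A i k j l = A (i, j) \<otimes>\<^bsub>K\<^esub> (if k = i then \<one>\<^bsub>K\<^esub> else A (k, j))
     \<otimes>\<^bsub>K\<^esub> (if l = j then \<one>\<^bsub>K\<^esub> else A (i, l)) \<otimes>\<^bsub>K\<^esub> (if k = i \<or> l = j then \<one>\<^bsub>K\<^esub> else A (k, l))"

definition repr :: "('a, 'm) monoid_scheme \<Rightarrow> nat \<Rightarrow> 'a tup \<Rightarrow> 'a \<Rightarrow> 'a tup \<Rightarrow> bool" where
  "repr K n s g A \<longleftrightarrow> (\<forall>i\<in>{..<n}. \<forall>k\<in>{..<n}. \<forall>j\<in>{..<n}. \<forall>l\<in>{..<n}.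
     ent K n s (tst K s i k j l g) (val K A i k j l))"

text \<open>The two-sided bound is insensitive to the global sign, so either of the two coded
  matrices of \<open>g\<close> may serve as \<open>A\<close>.\<close>

definition bd :: "('a, 'm) monoid_scheme \<Rightarrow> nat \<Rightarrow> 'a tup \<Rightarrow> 'a \<Rightarrow> 'a \<Rightarrow> bool" where
  "bd K n s g d \<longleftrightarrow> (\<exists>A. (\<forall>p\<in>{..<n} \<times> {..<n}. A p \<in> carrier K) \<and> repr K n s g A \<and>
     (\<forall>i\<in>{..<n}. \<forall>j\<in>{..<n}. le K n s (inv\<^bsub>K\<^esub> d) (A (i, j)) \<and> le K n s (A (i, j)) d))"

text \<open>The numbers \<open>1 + i * N\<close> for \<open>1 \<le> i \<le> k\<close> are pairwise coprime, since each \<open>i\<close> divides \<open>N\<close>; so \<open>big c k x\<close>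
  forces \<open>x\<close> to be at least the \<open>k\<close>-th power of \<open>c\<close> without mentioning powers.\<close>

definition big :: "('a, 'm) monoid_scheme \<Rightarrow> nat \<Rightarrow> 'a tup \<Rightarrow> 'a \<Rightarrow> 'a \<Rightarrow> 'a \<Rightarrow> bool" where
  "big K n s c k x \<longleftrightarrow> (\<exists>N\<in>carrier K. le K n s c N \<and> le K n s (s (0, 2)) x \<and>
     (\<forall>i\<in>carrier K. le K n s (s (0, 2)) i \<and> le K n s i k \<longrightarrow>
        (\<exists>w\<in>carrier K. mulr K n s i w N) \<and>
        (\<exists>v\<in>carrier K. \<exists>w\<in>carrier K. mulr K n s i N v \<and> mulr K n s (s (0, 2) \<otimes>\<^bsub>K\<^esub> v) w x)))"

text \<open>For the elementary matrices \<open>n0\<close> defines the matrices that are diagonal modulo 3. Intersecting over all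
  parameters for which \<open>n0\<close> defines a subgroup with at most \<open>J\<close> cosets makes \<open>core\<close> parameter-free.\<close>

definition n0 :: "('a, 'm) monoid_scheme \<Rightarrow> nat \<Rightarrow> 'a tup \<Rightarrow> 'a \<Rightarrow> bool" where
  "n0 K n s x \<longleftrightarrow> (\<forall>i\<in>{..<n}. \<forall>j\<in>{..<n}. i \<noteq> j \<longrightarrow>
     (\<exists>u\<in>carrier K. num K n s u \<and> ent K n s (tst K s i i j j x) (u \<otimes>\<^bsub>K\<^esub> u \<otimes>\<^bsub>K\<^esub> u)))"

definition good :: "('a, 'm) monoid_scheme \<Rightarrow> nat \<Rightarrow> nat \<Rightarrow> 'a tup \<Rightarrow> bool" where
  "good K n J s \<longleftrightarrow> n0 K n s \<one>\<^bsub>K\<^esub> \<and>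
     (\<forall>x\<in>carrier K. n0 K n s x \<longrightarrow> n0 K n s (inv\<^bsub>K\<^esub> x)) \<and>
     (\<forall>x\<in>carrier K. \<forall>y\<in>carrier K. n0 K n s x \<and> n0 K n s y \<longrightarrow> n0 K n s (x \<otimes>\<^bsub>K\<^esub> y)) \<and>
     (\<exists>r. (\<forall>i\<in>{..<J}. r i \<in> carrier K) \<and>
       (\<forall>g\<in>carrier K. \<exists>i\<in>{..<J}. n0 K n s (g \<otimes>\<^bsub>K\<^esub> inv\<^bsub>K\<^esub> (r i))))"

definition core :: "('a, 'm) monoid_scheme \<Rightarrow> nat \<Rightarrow> nat \<Rightarrow> 'a \<Rightarrow> bool" where
  "core K n J x \<longleftrightarrow>
     (\<forall>s. (\<forall>p\<in>{..<n} \<times> {..<n}. s p \<in> carrier K) \<longrightarrow> (good K n J s \<longrightarrow> n0 K n s x))"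

primrec sqs :: "('a, 'm) monoid_scheme \<Rightarrow> (nat \<Rightarrow> 'a) \<Rightarrow> nat \<Rightarrow> 'a" where
  "sqs K x 0 = \<one>\<^bsub>K\<^esub>"
| "sqs K x (Suc k) = sqs K x k \<otimes>\<^bsub>K\<^esub> (x k \<otimes>\<^bsub>K\<^esub> x k)"

section \<open>Words in the marked elements and the axioms on the marking\<close>

type_synonym letter = "nat \<times> nat \<times> bool"

definition letters :: "nat \<Rightarrow> letter set" where
  "letters n = {(i, j, b). i < n \<and> j < n \<and> i \<noteq> j}"

lemma finite_letters [simp]: "finite (letters n)"
  by (rule finite_subset[of _ "{..<n} \<times> {..<n} \<times> UNIV"]) (auto simp: letters_def)

definition ltr :: "('a, 'm) monoid_scheme \<Rightarrow> 'a tup \<Rightarrow> letter \<Rightarrow> 'a" where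
  "ltr K s l = (case l of (i, j, b) \<Rightarrow> if b then s (i, j) else inv\<^bsub>K\<^esub> (s (i, j)))"

text \<open>Letters are appended on the right, where they act as column operations.\<close>

definition ev :: "('a, 'm) monoid_scheme \<Rightarrow> 'a tup \<Rightarrow> letter list \<Rightarrow> 'a" where
  "ev K s w = foldl (\<lambda>g l. g \<otimes>\<^bsub>K\<^esub> ltr K s l) \<one>\<^bsub>K\<^esub> w"

text \<open>The effect on codes of right multiplication by an elementary matrix; adding two integers
  means multiplying their codes.\<close>

definition colop :: "('a, 'm) monoid_scheme \<Rightarrow> 'a tup \<Rightarrow> letter \<Rightarrow> 'a tup" where
  "colop K A l = (case l of (k, l, b) \<Rightarrow> (\<lambda>(i, j). if j = l then
     A (i, l) \<otimes>\<^bsub>K\<^esub> (if b then A (i, k) else inv\<^bsub>K\<^esub> (A (i, k))) else A (i, j)))"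

text \<open>The codes form a discretely ordered abelian group with least positive element
  \<open>s (0, 2)\<close>: the predecessor clause leaves nothing strictly between 0 and 1.
  Antisymmetry follows, for a nonzero number that is nonnegative together with its negative would
  make -1 nonnegative.\<close>

definition ord_ax :: "('a, 'm) monoid_scheme \<Rightarrow> nat \<Rightarrow> 'a tup \<Rightarrow> bool" where
  "ord_ax K n s \<longleftrightarrow> num K n s (s (0, 2)) \<and> nn K n s \<one>\<^bsub>K\<^esub> \<and> nn K n s (s (0, 2)) \<and>
     \<not> nn K n s (inv\<^bsub>K\<^esub> (s (0, 2))) \<and>
     (\<forall>u\<in>carrier K. \<forall>v\<in>carrier K. num K n s u \<and> num K n s v \<longrightarrow>
        num K n s (u \<otimes>\<^bsub>K\<^esub> v) \<and> u \<otimes>\<^bsub>K\<^esub> v = v \<otimes>\<^bsub>K\<^esub> u \<and>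
        (nn K n s u \<and> nn K n s v \<longrightarrow> nn K n s (u \<otimes>\<^bsub>K\<^esub> v))) \<and>
     (\<forall>u\<in>carrier K. num K n s u \<longrightarrow> num K n s (inv\<^bsub>K\<^esub> u) \<and> (nn K n s u \<or> nn K n s (inv\<^bsub>K\<^esub> u)) \<and>
        (nn K n s u \<longrightarrow> u = \<one>\<^bsub>K\<^esub> \<or> nn K n s (u \<otimes>\<^bsub>K\<^esub> inv\<^bsub>K\<^esub> (s (0, 2))))) \<and>
     (\<forall>u\<in>carrier K. \<forall>v\<in>carrier K. \<forall>w\<in>carrier K. le K n s u v \<and> le K n s v w \<longrightarrow> le K n s u w) \<and>
     (\<forall>u\<in>carrier K. \<forall>v\<in>carrier K. num K n s u \<and> num K n s v \<longrightarrow>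
        (\<exists>w\<in>carrier K. le K n s u w \<and> le K n s v w))"

text \<open>Tailored to the progression 1, c, c^2, ... of a code c of size at least 2: products
  exist, multiplication by a nonnegative code is monotone, and multiplication by c strictly
  increases positive codes.\<close>

definition mul_ax :: "('a, 'm) monoid_scheme \<Rightarrow> nat \<Rightarrow> 'a tup \<Rightarrow> bool" where
  "mul_ax K n s \<longleftrightarrow>
     (\<forall>u\<in>carrier K. \<forall>v\<in>carrier K. num K n s u \<and> num K n s v \<longrightarrow>
        (\<exists>w\<in>carrier K. num K n s w \<and> mulr K n s u v w)) \<and>
     (\<forall>c\<in>carrier K. \<forall>a\<in>carrier K. \<forall>b\<in>carrier K. \<forall>x\<in>carrier K. \<forall>y\<in>carrier K.
        nn K n s c \<and> le K n s a b \<and> mulr K n s c a x \<and> mulr K n s c b y \<longrightarrow> le K n s x y) \<and>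
     (\<forall>c\<in>carrier K. \<forall>d\<in>carrier K. \<forall>y\<in>carrier K.
        le K n s (s (0, 2) \<otimes>\<^bsub>K\<^esub> s (0, 2)) c \<and> le K n s (s (0, 2)) d \<and> mulr K n s c d y \<longrightarrow>
        le K n s (s (0, 2)) y \<and> \<not> le K n s y d)"

text \<open>The recursion of an exponential function without powers: a witness for exponent
  \<open>k\<close> is at least \<open>c\<close> times some witness for \<open>k - 1\<close>.
  Existence is asserted with exponent \<open>c\<close> itself, so a nonstandard \<open>c\<close>
  comes with a nonstandard exponent.\<close>

definition big_ax :: "('a, 'm) monoid_scheme \<Rightarrow> nat \<Rightarrow> 'a tup \<Rightarrow> bool" where
  "big_ax K n s \<longleftrightarrow>
     (\<forall>c\<in>carrier K. le K n s (s (0, 2)) c \<longrightarrow> (\<exists>x\<in>carrier K. big K n s c c x)) \<and>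
     (\<forall>c\<in>carrier K. \<forall>k\<in>carrier K. \<forall>x\<in>carrier K.
        le K n s (s (0, 2)) c \<and> le K n s (s (0, 2)) k \<and> big K n s c k x \<longrightarrow>
        (\<exists>x'\<in>carrier K. \<exists>y\<in>carrier K. big K n s c (k \<otimes>\<^bsub>K\<^esub> inv\<^bsub>K\<^esub> (s (0, 2))) x' \<and>
           mulr K n s c x' y \<and> le K n s y x)) \<and>
     (\<forall>c\<in>carrier K. \<forall>k\<in>carrier K. \<forall>x\<in>carrier K. big K n s c k x \<longrightarrow> le K n s (s (0, 2)) x)"

text \<open>Entries of a product are at most n * d * c, hence at most c * (c * d) as soon as c is at
  least n; so each further factor costs two steps in the powers of \<open>c\<close>. The last clause
  holds because a code contains its number as an entry; it turns bounds on group elements into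
  bounds on numbers.\<close>

definition bd_ax :: "('a, 'm) monoid_scheme \<Rightarrow> nat \<Rightarrow> 'a tup \<Rightarrow> bool" where
  "bd_ax K n s \<longleftrightarrow> bd K n s \<one>\<^bsub>K\<^esub> (s (0, 2)) \<and>
     (\<forall>g\<in>carrier K. \<exists>d\<in>carrier K. num K n s d \<and> bd K n s g d) \<and>
     (\<forall>g\<in>carrier K. \<forall>d\<in>carrier K. \<forall>d'\<in>carrier K. bd K n s g d \<and> le K n s d d' \<longrightarrow> bd K n s g d') \<and>
     (\<forall>g\<in>carrier K. \<forall>g'\<in>carrier K. \<forall>c\<in>carrier K. \<forall>d\<in>carrier K. \<forall>x\<in>carrier K. \<forall>y\<in>carrier K.
        bd K n s g d \<and> bd K n s g' c \<and> le K n s (s (0, 2) [^]\<^bsub>K\<^esub> n) c \<and>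
        mulr K n s c d x \<and> mulr K n s c x y \<longrightarrow> bd K n s (g \<otimes>\<^bsub>K\<^esub> g') y) \<and>
     (\<forall>u\<in>carrier K. \<forall>d\<in>carrier K. num K n s u \<and> bd K n s u d \<longrightarrow> le K n s u d)"

definition idm :: "('a, 'm) monoid_scheme \<Rightarrow> 'a tup \<Rightarrow> 'a tup" where
  "idm K s = (\<lambda>p. if fst p = snd p then s (0, 2) else \<one>\<^bsub>K\<^esub>)"

text \<open>The clause on lower triangular codes carries the information det = 1 in the form in
  which column reduction uses it. \<open>D\<close> is to contain words for all diagonal matrices,
  which are finitely many as their entries are +-1. The other clauses say that codes follow column
  operations, determine the element up to the centre, and are determined by it up to a global
  sign.\<close>

definition repr_ax :: "('a, 'm) monoid_scheme \<Rightarrow> nat \<Rightarrow> letter list set \<Rightarrow> 'a tup \<Rightarrow> bool" where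
  "repr_ax K n D s \<longleftrightarrow> repr K n s \<one>\<^bsub>K\<^esub> (idm K s) \<and>
     (\<forall>A. (\<forall>p\<in>{..<n} \<times> {..<n}. A p \<in> carrier K) \<longrightarrow> (\<forall>g\<in>carrier K. repr K n s g A \<longrightarrow>
        (\<forall>l\<in>letters n. repr K n s (g \<otimes>\<^bsub>K\<^esub> ltr K s l) (colop K A l)) \<and>
        (\<forall>h\<in>carrier K. repr K n s h A \<longrightarrow> cen K (g \<otimes>\<^bsub>K\<^esub> inv\<^bsub>K\<^esub> h)) \<and>
        ((\<forall>i\<in>{..<n}. \<forall>j\<in>{..<n}. i < j \<longrightarrow> A (i, j) = \<one>\<^bsub>K\<^esub>) \<longrightarrow>
           (\<forall>i\<in>{..<n}. A (i, i) = s (0, 2) \<or> A (i, i) = inv\<^bsub>K\<^esub> (s (0, 2)))) \<and>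
        ((\<forall>i\<in>{..<n}. \<forall>j\<in>{..<n}. i \<noteq> j \<longrightarrow> A (i, j) = \<one>\<^bsub>K\<^esub>) \<longrightarrow> (\<exists>v\<in>D. g = ev K s v)) \<and>
        (\<forall>B. (\<forall>p\<in>{..<n} \<times> {..<n}. B p \<in> carrier K) \<longrightarrow> (repr K n s g B \<longrightarrow>
           (\<forall>p\<in>{..<n} \<times> {..<n}. B p = A p) \<or> (\<forall>p\<in>{..<n} \<times> {..<n}. B p = inv\<^bsub>K\<^esub> (A p)))))) \<and>
     (\<forall>g\<in>carrier K. \<exists>A. (\<forall>p\<in>{..<n} \<times> {..<n}. A p \<in> carrier K) \<and> repr K n s g A)"

text \<open>A finite automaton: \<open>Y\<close> is the set of states, \<open>\<delta>\<close> the
  transition function, and each transition is certified by an identity with exactly \<open>L\<close>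
  squares of core elements. Composing certificates handles words of every length.\<close>

definition cert_ax :: "('a, 'm) monoid_scheme \<Rightarrow> nat \<Rightarrow> nat \<Rightarrow> nat \<Rightarrow> letter list set \<Rightarrow>
    (letter list \<Rightarrow> letter \<Rightarrow> letter list) \<Rightarrow> 'a tup \<Rightarrow> bool" where
  "cert_ax K n J L Y \<delta> s \<longleftrightarrow> (\<forall>y\<in>Y. \<forall>l\<in>letters n. \<exists>x. (\<forall>i\<in>{..<L}. x i \<in> carrier K) \<and>
     (\<forall>i\<in>{..<L}. core K n J (x i)) \<and>
     ev K s y \<otimes>\<^bsub>K\<^esub> ltr K s l = sqs K x L \<otimes>\<^bsub>K\<^esub> ev K s (\<delta> y l))"

text \<open>One sentence for each \<open>k\<close>, without reference to \<open>s\<close>. The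
  family is infinite and is therefore kept outside \<open>model\<close>.\<close>

definition sign_ax :: "('a, 'm) monoid_scheme \<Rightarrow> nat \<Rightarrow> nat \<Rightarrow> nat \<Rightarrow> bool" where
  "sign_ax K n J k \<longleftrightarrow> (\<forall>x. (\<forall>i\<in>{..<k}. x i \<in> carrier K) \<longrightarrow>
     (\<forall>i\<in>{..<k}. core K n J (x i)) \<and> cen K (sqs K x k) \<longrightarrow> sqs K x k = \<one>\<^bsub>K\<^esub>)"

text \<open>\<open>Z\<close> is meant to hold a word for -1 if -1 lies in the group; keeping its
  value nontrivial prevents the sign from collapsing in another group.\<close>

definition model :: "('a, 'm) monoid_scheme \<Rightarrow> nat \<Rightarrow> nat \<Rightarrow> nat \<Rightarrow> letter list set \<Rightarrow>
    (letter list \<Rightarrow> letter \<Rightarrow> letter list) \<Rightarrow> letter list set \<Rightarrow> letter list set \<Rightarrow> 'a tup \<Rightarrow> bool" where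
  "model K n J L Y \<delta> D Z s \<longleftrightarrow> ord_ax K n s \<and> mul_ax K n s \<and> big_ax K n s \<and> bd_ax K n s \<and>
     repr_ax K n D s \<and> cert_ax K n J L Y \<delta> s \<and> (\<forall>w\<in>Z. ev K s w \<noteq> \<one>\<^bsub>K\<^esub>)"

section \<open>The formulas above are definable in both groups at once\<close>

locale definability = two_groups G H
  for G :: "('a, 'm) monoid_scheme" and H :: "('b, 'k) monoid_scheme" +
  fixes n :: nat
  assumes n3: "3 \<le> n"
begin

definition dfs :: "('e, 'a, 'f, 'b) projs \<Rightarrow> ('e \<Rightarrow> 'a tup) \<Rightarrow> ('f \<Rightarrow> 'b tup) \<Rightarrow> bool" where
  "dfs X s s' \<longleftrightarrow> (\<forall>i<n. \<forall>j<n. dft X (\<lambda>e. s e (i, j)) (\<lambda>f. s' f (i, j)))"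

lemma dfsD: "dfs X s s' \<Longrightarrow> i < n \<Longrightarrow> j < n \<Longrightarrow> dft X (\<lambda>e. s e (i, j)) (\<lambda>f. s' f (i, j))"
  by (simp add: dfs_def)

lemma dfs_lift: "dfs X s s' \<Longrightarrow> dfs (lift X) (\<lambda>p. s (fst p)) (\<lambda>q. s' (fst q))"
  unfolding dfs_def by (intro allI impI dft_lift) simp

lemma dfs_liftf: "dfs X s s' \<Longrightarrow> dfs (liftf I X) (\<lambda>p. s (fst p)) (\<lambda>q. s' (fst q))"
  unfolding dfs_def by (intro allI impI dft_liftf) simp

lemma dfs_lastf: "set I = {..<n} \<times> {..<n} \<Longrightarrow> dfs (liftf I X) (\<lambda>p. snd p) (\<lambda>q. snd q)"
  unfolding dfs_def by (intro allI impI dft_lastf) simp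

text \<open>Conditions on indices are decided outside the language.\<close>

lemma dfb_cimp: "(b \<Longrightarrow> dfb X P Q) \<Longrightarrow> dfb X (\<lambda>e. b \<longrightarrow> P e) (\<lambda>f. b \<longrightarrow> Q f)"
  using dfb_const[of X True] by (cases b) auto

lemma dft_pow: "dft X t u \<Longrightarrow> dft X (\<lambda>e. t e [^]\<^bsub>G\<^esub> (m::nat)) (\<lambda>f. u f [^]\<^bsub>H\<^esub> m)"
proof (induction m)
  case 0
  then show ?case using dft_one by simp
next
  case (Suc m)
  then show ?case using dft_mult[of X "\<lambda>e. t e [^]\<^bsub>G\<^esub> m" "\<lambda>f. u f [^]\<^bsub>H\<^esub> m" t u] by simp
qed

lemmas quant_rules = dfb_ex dfb_all dfb_ball dfb_bex dfb_conj dfb_disj dfb_not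
lemmas term_rules = dfb_eq dft_mult dft_inv dft_one dft_if dft_last
lemmas lift_rules = dft_lift dft_liftf dfs_lift dfs_liftf

lemma dfb_cm: "dft X a a' \<Longrightarrow> dft X b b' \<Longrightarrow> dfb X (\<lambda>e. cm G (a e) (b e)) (\<lambda>f. cm H (a' f) (b' f))"
  unfolding cm_def by (intro dfb_eq dft_mult)

lemma dft_com: "dft X a a' \<Longrightarrow> dft X b b' \<Longrightarrow> dft X (\<lambda>e. com G (a e) (b e)) (\<lambda>f. com H (a' f) (b' f))"
  unfolding com_def by (intro dft_mult dft_inv)

lemma dfb_cen: "dft X a a' \<Longrightarrow> dfb X (\<lambda>e. cen G (a e)) (\<lambda>f. cen H (a' f))"
  unfolding cen_def by (intro dfb_all dfb_cm dft_last dft_lift)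

context
  fixes X :: "('e, 'a, 'f, 'b) projs" and s s'
  assumes s: "dfs X s s'"
begin

lemmas sD = dfsD[OF s]

lemma dfb_cuni: "dft X x x' \<Longrightarrow> i < n \<Longrightarrow> j < n \<Longrightarrow>
    dfb X (\<lambda>e. cuni G n (s e) i j (x e)) (\<lambda>f. cuni H n (s' f) i j (x' f))"
  unfolding cuni_def by (rule dfb_ball dfb_cimp dfb_cm sD | assumption | (simp; fail))+

lemma dfb_colst: "dft X x x' \<Longrightarrow> j < n \<Longrightarrow>
    dfb X (\<lambda>e. colst G n (s e) j (x e)) (\<lambda>f. colst H n (s' f) j (x' f))"
  unfolding colst_def by (rule dfb_ball dfb_cimp dfb_cm sD dft_mult dft_inv | assumption | (simp; fail))+

lemma dfb_rowst: "dft X x x' \<Longrightarrow> j < n \<Longrightarrow>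
    dfb X (\<lambda>e. rowst G n (s e) j (x e)) (\<lambda>f. rowst H n (s' f) j (x' f))"
  unfolding rowst_def by (rule dfb_ball dfb_cimp dfb_cm sD dft_mult dft_inv | assumption | (simp; fail))+

lemma dft_rw: "i < n \<Longrightarrow> dft X (\<lambda>e. rw G (s e) i) (\<lambda>f. rw H (s' f) i)"
  using n3 unfolding rw_def by (intro dft_if dft_one dft_mult dft_inv sD) auto

lemma dft_cw: "i < n \<Longrightarrow> dft X (\<lambda>e. cw G (s e) i) (\<lambda>f. cw H (s' f) i)"
  using n3 unfolding cw_def by (intro dft_if dft_one dft_mult dft_inv sD) auto

lemma dft_tst: "dft X x x' \<Longrightarrow> i < n \<Longrightarrow> j < n \<Longrightarrow> k < n \<Longrightarrow> l < n \<Longrightarrow>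
    dft X (\<lambda>e. tst G (s e) i k j l (x e)) (\<lambda>f. tst H (s' f) i k j l (x' f))"
  unfolding tst_def by (intro dft_if dft_one dft_mult dft_rw dft_cw sD)

lemma dft_val: "i < n \<Longrightarrow> j < n \<Longrightarrow> k < n \<Longrightarrow> l < n \<Longrightarrow>
    dft X (\<lambda>e. val G (s e) i k j l) (\<lambda>f. val H (s' f) i k j l)"
  unfolding val_def by (intro dft_if dft_one dft_mult sD)

lemma dft_ltr: "l \<in> letters n \<Longrightarrow> dft X (\<lambda>e. ltr G (s e) l) (\<lambda>f. ltr H (s' f) l)"
  by (cases l) (auto simp: ltr_def letters_def intro!: dft_if dft_inv sD)

lemma dft_ev: "set w \<subseteq> letters n \<Longrightarrow> dft X (\<lambda>e. ev G (s e) w) (\<lambda>f. ev H (s' f) w)"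
proof (induction w rule: rev_induct)
  case Nil
  then show ?case using dft_one by (simp add: ev_def)
next
  case (snoc l w)
  then show ?case using dft_mult[of X "\<lambda>e. ev G (s e) w" "\<lambda>f. ev H (s' f) w"] dft_ltr[of l]
    by (simp add: ev_def)
qed

lemma dfs_colop: "l \<in> letters n \<Longrightarrow> dfs X (\<lambda>e. colop G (s e) l) (\<lambda>f. colop H (s' f) l)"
  unfolding dfs_def
  by (cases l) (auto simp: colop_def letters_def intro!: dft_mult dft_if dft_inv sD)

lemma dfs_idm: "dfs X (\<lambda>e. idm G (s e)) (\<lambda>f. idm H (s' f))"
  using n3 unfolding dfs_def by (auto simp: idm_def intro!: dft_if dft_one sD)

end

lemma dfb_num:
  assumes "dfs X s s'" "dft X u u'"
  shows "dfb X (\<lambda>e. num G n (s e)  (u e)) (\<lambda>f. num H n (s' f)  (u' f))"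
  unfolding num_def
  by (rule quant_rules dfb_cuni dft_com dfb_cimp dfb_imp term_rules dfsD[OF assms(1)] assms | assumption
    | (use n3 in simp; fail) | rule lift_rules)+

lemma dfb_mulr:
  assumes "dfs X s s'" "dft X u u'" "dft X v v'" "dft X w w'"
  shows "dfb X (\<lambda>e. mulr G n (s e)  (u e) (v e) (w e)) (\<lambda>f. mulr H n (s' f)  (u' f) (v' f) (w' f))"
  unfolding mulr_def
  by (rule quant_rules dfb_cuni dft_com dfb_cimp dfb_imp term_rules dfsD[OF assms(1)] assms | assumption
    | (use n3 in simp; fail) | rule lift_rules)+

lemma dfb_sq4:
  assumes "dfs X s s'" "dft X p p'"
  shows "dfb X (\<lambda>e. sq4 G n (s e)  (p e)) (\<lambda>f. sq4 H n (s' f)  (p' f))"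
  unfolding sq4_def
  by (rule quant_rules dfb_mulr dfb_cimp dfb_imp term_rules dfsD[OF assms(1)] assms | assumption
    | (use n3 in simp; fail) | rule lift_rules)+

lemma dfb_nn:
  assumes "dfs X s s'" "dft X u u'"
  shows "dfb X (\<lambda>e. nn G n (s e)  (u e)) (\<lambda>f. nn H n (s' f)  (u' f))"
  unfolding nn_def
  by (rule quant_rules dfb_mulr dfb_sq4 dfb_cimp dfb_imp term_rules dfsD[OF assms(1)] assms | assumption
    | (use n3 in simp; fail) | rule lift_rules)+

lemma dfb_le:
  assumes "dfs X s s'" "dft X u u'" "dft X v v'"
  shows "dfb X (\<lambda>e. le G n (s e)  (u e) (v e)) (\<lambda>f. le H n (s' f)  (u' f) (v' f))"
  unfolding le_def
  by (rule quant_rules dfb_nn dfb_num dfb_cimp dfb_imp term_rules dfsD[OF assms(1)] assms | assumption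
    | (use n3 in simp; fail) | rule lift_rules)+

lemma dfb_ent:
  assumes "dfs X s s'" "dft X g g'" "dft X u u'"
  shows "dfb X (\<lambda>e. ent G n (s e)  (g e) (u e)) (\<lambda>f. ent H n (s' f)  (g' f) (u' f))"
  unfolding ent_def
  by (rule quant_rules dfb_num dfb_rowst dfb_colst dfb_cimp dfb_imp term_rules dfsD[OF assms(1)] assms | assumption
    | (use n3 in simp; fail) | rule lift_rules)+

lemma dfb_n0:
  assumes "dfs X s s'" "dft X x x'"
  shows "dfb X (\<lambda>e. n0 G n (s e)  (x e)) (\<lambda>f. n0 H n (s' f)  (x' f))"
  unfolding n0_def
  by (rule quant_rules dfb_num dfb_ent dft_tst dfb_cimp dfb_imp term_rules dfsD[OF assms(1)] assms | assumption
    | (use n3 in simp; fail) | rule lift_rules)+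

lemma dfb_big:
  assumes "dfs X s s'" "dft X c c'" "dft X k k'" "dft X x x'"
  shows "dfb X (\<lambda>e. big G n (s e)  (c e) (k e) (x e)) (\<lambda>f. big H n (s' f)  (c' f) (k' f) (x' f))"
  unfolding big_def
  by (rule quant_rules dfb_le dfb_mulr dfb_cimp dfb_imp term_rules dfsD[OF assms(1)] assms | assumption
    | (use n3 in simp; fail) | rule lift_rules)+

lemma dfb_repr:
  assumes "dfs X s s'" "dft X g g'" "dfs X A A'"
  shows "dfb X (\<lambda>e. repr G n (s e) (g e) (A e)) (\<lambda>f. repr H n (s' f) (g' f) (A' f))"
  unfolding repr_def
  by (rule quant_rules dfb_ent dft_tst dft_val assms | assumption | (use n3 in simp; fail))+

lemma dfb_bd:
  assumes "dfs X s s'" "dft X g g'" "dft X d d'"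
  shows "dfb X (\<lambda>e. bd G n (s e) (g e) (d e)) (\<lambda>f. bd H n (s' f) (g' f) (d' f))"
  unfolding bd_def
  by (rule dfb_exf quant_rules dfb_repr dfb_le term_rules dfs_lastf dft_lastf assms | assumption
    | (use n3 in simp; fail) | rule lift_rules)+

lemma dfb_good:
  assumes "dfs X s s'"
  shows "dfb X (\<lambda>e. good G n J (s e)) (\<lambda>f. good H n J (s' f))"
  unfolding good_def
  by (rule dfb_exf quant_rules dfb_n0 dfb_imp term_rules dft_lastf assms | assumption
    | (use n3 in simp; fail) | rule lift_rules)+

lemma dfb_core:
  assumes "dft X x x'"
  shows "dfb X (\<lambda>e. core G n J (x e)) (\<lambda>f. core H n J (x' f))"
  unfolding core_def
  by (rule dfb_allf dfb_imp dfb_n0 dfb_good dfs_lastf assms | assumption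
    | (use n3 in simp; fail) | rule lift_rules)+

lemma dft_sqs:
  assumes "\<And>i. i < k \<Longrightarrow> dft X (\<lambda>e. x e i) (\<lambda>f. x' f i)"
  shows "dft X (\<lambda>e. sqs G (x e) k) (\<lambda>f. sqs H (x' f) k)"
  using assms
proof (induction k)
  case 0
  then show ?case using dft_one by simp
next
  case (Suc k)
  then show ?case unfolding sqs.simps by (intro dft_mult) simp_all
qed

lemma dfb_ord_ax:
  assumes "dfs X s s'"
  shows "dfb X (\<lambda>e. ord_ax G n (s e)  ) (\<lambda>f. ord_ax H n (s' f)  )"
  unfolding ord_ax_def
  by (rule quant_rules dfb_num dfb_nn dfb_le dfb_cimp dfb_imp term_rules dfsD[OF assms(1)] assms | assumption
    | (use n3 in simp; fail) | rule lift_rules)+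

lemma dfb_mul_ax:
  assumes "dfs X s s'"
  shows "dfb X (\<lambda>e. mul_ax G n (s e)  ) (\<lambda>f. mul_ax H n (s' f)  )"
  unfolding mul_ax_def
  by (rule quant_rules dfb_num dfb_nn dfb_le dfb_mulr dfb_cimp dfb_imp term_rules dfsD[OF assms(1)] assms | assumption
    | (use n3 in simp; fail) | rule lift_rules)+

lemma dfb_big_ax:
  assumes "dfs X s s'"
  shows "dfb X (\<lambda>e. big_ax G n (s e)  ) (\<lambda>f. big_ax H n (s' f)  )"
  unfolding big_ax_def
  by (rule quant_rules dfb_num dfb_le dfb_mulr dfb_big dfb_cimp dfb_imp term_rules dfsD[OF assms(1)] assms | assumption
    | (use n3 in simp; fail) | rule lift_rules)+

lemma dfb_bd_ax:
  assumes "dfs X s s'"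
  shows "dfb X (\<lambda>e. bd_ax G n (s e)  ) (\<lambda>f. bd_ax H n (s' f)  )"
  unfolding bd_ax_def
  by (rule quant_rules dfb_num dfb_le dfb_mulr dfb_bd dft_pow dfb_cimp dfb_imp term_rules dfsD[OF assms(1)] assms | assumption
    | (use n3 in simp; fail) | rule lift_rules)+

lemma dfb_repr_ax:
  assumes "dfs X s s'" "finite D" "\<And>w. w \<in> D \<Longrightarrow> set w \<subseteq> letters n"
  shows "dfb X (\<lambda>e. repr_ax G n D (s e)) (\<lambda>f. repr_ax H n D (s' f))"
  unfolding repr_ax_def
  by (rule dfb_exf dfb_allf quant_rules dfb_repr dfb_cen dfb_cimp dfb_imp dfs_idm dfs_colop dft_ltr dft_ev
      term_rules dfs_lastf dft_lastf dfsD[OF assms(1)] assms | assumption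
    | (use n3 in simp; fail) | rule lift_rules)+

lemma dfb_cert_ax:
  assumes "dfs X s s'" "finite Y" "\<And>w. w \<in> Y \<Longrightarrow> set w \<subseteq> letters n"
    "\<And>w l. w \<in> Y \<Longrightarrow> l \<in> letters n \<Longrightarrow> set (\<delta> w l) \<subseteq> letters n"
  shows "dfb X (\<lambda>e. cert_ax G n J L Y \<delta> (s e)) (\<lambda>f. cert_ax H n J L Y \<delta> (s' f))"
  unfolding cert_ax_def
  by (rule dfb_exf dfb_allf quant_rules dfb_core dft_ltr dft_ev dft_sqs
      term_rules dft_lastf assms | assumption
    | (use n3 in simp; fail) | rule lift_rules)+

lemma dfb_sign_ax: "dfb X (\<lambda>e. sign_ax G n J k) (\<lambda>f. sign_ax H n J k)"
  unfolding sign_ax_def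
  by (rule dfb_allf quant_rules dfb_imp dfb_core dfb_cen dft_sqs term_rules dft_lastf | assumption
    | (use n3 in simp; fail) | rule lift_rules)+

lemma dfb_model:
  assumes "dfs X s s'" "finite Y" "\<And>w. w \<in> Y \<Longrightarrow> set w \<subseteq> letters n"
    "\<And>w l. w \<in> Y \<Longrightarrow> l \<in> letters n \<Longrightarrow> set (\<delta> w l) \<subseteq> letters n"
    "finite D" "\<And>w. w \<in> D \<Longrightarrow> set w \<subseteq> letters n" "finite Z" "\<And>w. w \<in> Z \<Longrightarrow> set w \<subseteq> letters n"
  shows "dfb X (\<lambda>e. model G n J L Y \<delta> D Z (s e)) (\<lambda>f. model H n J L Y \<delta> D Z (s' f))"
  unfolding model_def
  by (intro dfb_conj dfb_ord_ax dfb_mul_ax dfb_big_ax dfb_bd_ax dfb_repr_ax dfb_cert_ax dfb_ball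
      dfb_not dfb_eq dft_ev dft_one assms)

lemma transfer_sign_ax: "elementarily_equivalent H G \<Longrightarrow> sign_ax G n J k \<longleftrightarrow> sign_ax H n J k"
  by (rule dfb_transfer[OF dfb_sign_ax])

text \<open>A marked tuple itself does not transfer; only the existence of some tuple satisfying
  \<open>model\<close> does.\<close>

lemma transfer_model:
  assumes "elementarily_equivalent H G" "finite Y" "\<And>w. w \<in> Y \<Longrightarrow> set w \<subseteq> letters n"
    "\<And>w l. w \<in> Y \<Longrightarrow> l \<in> letters n \<Longrightarrow> set (\<delta> w l) \<subseteq> letters n"
    "finite D" "\<And>w. w \<in> D \<Longrightarrow> set w \<subseteq> letters n" "finite Z" "\<And>w. w \<in> Z \<Longrightarrow> set w \<subseteq> letters n"
  shows "(\<exists>s. (\<forall>p\<in>{..<n} \<times> {..<n}. s p \<in> carrier G) \<and> model G n J L Y \<delta> D Z s) \<longleftrightarrow>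
    (\<exists>s. (\<forall>p\<in>{..<n} \<times> {..<n}. s p \<in> carrier H) \<and> model H n J L Y \<delta> D Z s)"
proof (rule dfb_transfer[OF _ assms(1)], rule dfb_exf)
  fix I :: "(nat \<times> nat) list"
  assume "set I = {..<n} \<times> {..<n}"
  then show "dfb (liftf I []) (\<lambda>p. model G n J L Y \<delta> D Z (snd p)) (\<lambda>q. model H n J L Y \<delta> D Z (snd q))"
    by (intro dfb_model dfs_lastf assms)
qed simp

end

section \<open>Squares in the intersection of the subgroups of bounded index\<close>

context group
begin

lemma inv_cancel [simp]:
  assumes "x \<in> carrier G" "y \<in> carrier G"
  shows "inv x \<otimes> (x \<otimes> y) = y" "x \<otimes> (inv x \<otimes> y) = y"
  using assms by (simp_all add: m_assoc [symmetric])

text \<open>An induction principle, applied with \<open>t = \<one>\<close>: a set that contains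
  \<open>\<one>\<close> and is stable under right multiplication by generators and their inverses
  contains the generated subgroup.\<close>

lemma generate_right_closed:
  assumes x: "x \<in> generate G S" and S: "S \<subseteq> carrier G" and T: "T \<subseteq> carrier G"
    and closed: "\<And>t s. t \<in> T \<Longrightarrow> s \<in> S \<Longrightarrow> t \<otimes> s \<in> T" "\<And>t s. t \<in> T \<Longrightarrow> s \<in> S \<Longrightarrow> t \<otimes> inv s \<in> T"
    and t: "t \<in> T"
  shows "t \<otimes> x \<in> T"
  using x t
proof (induction arbitrary: t)
  case one
  then show ?case using T by auto
next
  case (incl h)
  then show ?case using closed by auto
next
  case (inv h)
  then show ?case using closed by auto
next
  case (eng h1 h2)
  have "h1 \<in> carrier G" "h2 \<in> carrier G" "t \<in> carrier G"
    using eng.hyps eng.prems generate_in_carrier[OF S] T by auto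
  then show ?case using eng.IH(2)[OF eng.IH(1)[OF eng.prems]] by (simp add: m_assoc)
qed

text \<open>Several representatives may lie in one coset; the least index makes the label a function
  of the coset.\<close>

definition coset_label :: "nat \<Rightarrow> 'a set \<Rightarrow> (nat \<Rightarrow> 'a) \<Rightarrow> 'a \<Rightarrow> nat" where
  "coset_label J T r g = (LEAST i. i < J \<and> g \<otimes> inv (r i) \<in> T)"

lemma coset_label:
  assumes "\<forall>i<J. r i \<in> carrier G" "\<forall>g\<in>carrier G. \<exists>i<J. g \<otimes> inv (r i) \<in> T" "g \<in> carrier G"
  shows "coset_label J T r g < J" "g \<otimes> inv (r (coset_label J T r g)) \<in> T"
proof -
  have "\<exists>i. i < J \<and> g \<otimes> inv (r i) \<in> T" using assms by auto
  then have "coset_label J T r g < J \<and> g \<otimes> inv (r (coset_label J T r g)) \<in> T"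
    unfolding coset_label_def by (rule LeastI_ex)
  then show "coset_label J T r g < J" "g \<otimes> inv (r (coset_label J T r g)) \<in> T" by auto
qed

lemma coset_label_eq_iff:
  assumes T: "subgroup T G" and r: "\<forall>i<J. r i \<in> carrier G" "\<forall>g\<in>carrier G. \<exists>i<J. g \<otimes> inv (r i) \<in> T"
    and gh: "g \<in> carrier G" "h \<in> carrier G"
  shows "coset_label J T r g = coset_label J T r h \<longleftrightarrow> g \<otimes> inv h \<in> T"
proof
  assume eq: "coset_label J T r g = coset_label J T r h"
  let ?r = "r (coset_label J T r g)"
  have rc: "?r \<in> carrier G" using coset_label(1)[OF r gh(1)] r(1) by auto
  have "(g \<otimes> inv ?r) \<otimes> inv (h \<otimes> inv ?r) \<in> T"
    using coset_label(2)[OF r gh(1)] coset_label(2)[OF r gh(2)] eq T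
    by (auto intro: subgroup.m_closed subgroup.m_inv_closed)
  then show "g \<otimes> inv h \<in> T" using rc gh by (simp add: inv_mult_group m_assoc)
next
  assume gT: "g \<otimes> inv h \<in> T"
  have "g \<otimes> inv (r i) \<in> T \<longleftrightarrow> h \<otimes> inv (r i) \<in> T" if "i < J" for i
  proof -
    have ri: "r i \<in> carrier G" using r that by auto
    have "h \<otimes> inv (r i) = inv (g \<otimes> inv h) \<otimes> (g \<otimes> inv (r i))"
      "g \<otimes> inv (r i) = (g \<otimes> inv h) \<otimes> (h \<otimes> inv (r i))"
      using gh ri by (simp_all add: inv_mult_group m_assoc)
    then show ?thesis using gT T subgroup.m_closed subgroup.m_inv_closed by metis
  qed
  then show "coset_label J T r g = coset_label J T r h"
    unfolding coset_label_def by (metis (no_types, lifting))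
qed

text \<open>A subgroup with at most \<open>J\<close> cosets is determined by the action of the generators on the
  coset labels.\<close>

lemma finite_subgroups_of_index:
  fixes J :: nat
  assumes S: "finite S" "S \<subseteq> carrier G" "generate G S = carrier G"
    and \<T>: "\<And>T. T \<in> \<T> \<Longrightarrow> subgroup T G"
    and r: "\<And>T. T \<in> \<T> \<Longrightarrow> \<forall>i<J. r T i \<in> carrier G"
      "\<And>T. T \<in> \<T> \<Longrightarrow> \<forall>g\<in>carrier G. \<exists>i<J. g \<otimes> inv (r T i) \<in> T"
  shows "finite \<T>"
proof -
  define lab where "lab T = coset_label J T (r T)" for T
  have lab: "lab T g < J" "g \<otimes> inv (r T (lab T g)) \<in> T" if "T \<in> \<T>" "g \<in> carrier G" for T g
    using coset_label[of J "r T" T g] r[OF that(1)] that(2) by (auto simp: lab_def)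
  have lab_eq: "lab T g = lab T h \<longleftrightarrow> g \<otimes> inv h \<in> T" if "T \<in> \<T>" "g \<in> carrier G" "h \<in> carrier G" for T g h
    using coset_label_eq_iff[OF \<T>[OF that(1)], of J "r T" g h] r[OF that(1)] that by (auto simp: lab_def)
  have rc: "r T (lab T g) \<in> carrier G" if "T \<in> \<T>" "g \<in> carrier G" for T g
    using lab(1)[OF that] r(1)[OF that(1)] by auto
  have step: "lab T (g \<otimes> s) = lab T (r T (lab T g) \<otimes> s)"
    if "T \<in> \<T>" "g \<in> carrier G" "s \<in> carrier G" for T g s
  proof -
    let ?r = "r T (lab T g)"
    have "(g \<otimes> s) \<otimes> inv (?r \<otimes> s) = g \<otimes> inv ?r"
      using that rc[OF that(1,2)] by (simp add: inv_mult_group m_assoc)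
    then show ?thesis using lab_eq that rc[OF that(1,2)] lab(2)[OF that(1,2)] by auto
  qed
  \<comment> \<open>The table lists how each generator and its inverse move the labels. Together
    with the label of \<open>\<one>\<close> it determines the label of every element, and
    \<open>T\<close> consists of the elements that are labelled like \<open>\<one>\<close>.\<close>
  define code where "code T = (restrict (\<lambda>(s, i). (lab T (r T i \<otimes> s), lab T (r T i \<otimes> inv s))) (S \<times> {..<J}),
    lab T \<one>)" for T
  have "inj_on code \<T>"
  proof (rule inj_onI)
    fix T T' assume TT: "T \<in> \<T>" "T' \<in> \<T>" and eq: "code T = code T'"
    have eq1: "lab T (r T i \<otimes> s) = lab T' (r T' i \<otimes> s)" "lab T (r T i \<otimes> inv s) = lab T' (r T' i \<otimes> inv s)"
      if "s \<in> S" "i < J" for s i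
      using fun_cong[OF arg_cong[OF eq, of fst], of "(s, i)"] that by (auto simp: code_def)
    have eq2: "lab T \<one> = lab T' \<one>" using eq by (simp add: code_def)
    define E where "E = {g \<in> carrier G. lab T g = lab T' g}"
    have "t \<otimes> s \<in> E \<and> t \<otimes> inv s \<in> E" if "t \<in> E" "s \<in> S" for t s
      using that S(2) TT step[of T t s] step[of T' t s] step[of T t "inv s"] step[of T' t "inv s"]
        eq1[of s "lab T t"] lab(1)[of T t]
      by (auto simp: E_def subset_iff)
    then have "\<one> \<otimes> g \<in> E" if "g \<in> carrier G" for g
      using generate_right_closed[of g S E \<one>] that S eq2 by (auto simp: E_def)
    then have all: "lab T g = lab T' g" if "g \<in> carrier G" for g using that by (auto simp: E_def)
    have "g \<in> T \<longleftrightarrow> lab T g = lab T \<one>" if "g \<in> carrier G" "T \<in> \<T>" for g T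
      using lab_eq[of T g \<one>] that by simp
    then have "g \<in> T \<longleftrightarrow> g \<in> T'" if "g \<in> carrier G" for g using that all TT eq2 by auto
    then show "T = T'" using \<T>[OF TT(1)] \<T>[OF TT(2)] subgroup.subset by blast
  qed
  moreover have "code ` \<T> \<subseteq> ((S \<times> {..<J}) \<rightarrow>\<^sub>E {..<J} \<times> {..<J}) \<times> {..<J}"
  proof (rule image_subsetI)
    fix T assume T: "T \<in> \<T>"
    have "lab T (r T i \<otimes> s) < J \<and> lab T (r T i \<otimes> inv s) < J" if "s \<in> S" "i < J" for s i
      using lab(1)[OF T] r(1)[OF T] S(2) that by (simp add: subset_iff)
    then show "code T \<in> ((S \<times> {..<J}) \<rightarrow>\<^sub>E {..<J} \<times> {..<J}) \<times> {..<J}"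
      using lab(1)[OF T] by (auto simp: code_def restrict_PiE_iff)
  qed
  moreover have "finite (((S \<times> {..<J}) \<rightarrow>\<^sub>E {..<J} \<times> {..<J}) \<times> {..<J})"
    using S(1) by (intro finite_cartesian_product finite_PiE) auto
  ultimately show ?thesis using finite_imageD finite_subset by blast
qed

text \<open>Schreier's lemma; \<open>f\<close> labels the right cosets of \<open>N\<close>.\<close>

lemma finite_index_generated:
  assumes S: "finite S" "S \<subseteq> carrier G" "generate G S = carrier G"
    and fin: "finite (f ` carrier G)"
    and f: "\<And>g h. g \<in> carrier G \<Longrightarrow> h \<in> carrier G \<Longrightarrow> f g = f h \<longleftrightarrow> g \<otimes> inv h \<in> N"
    and N: "subgroup N G"
  obtains Y where "finite Y" "Y \<subseteq> N" "N \<subseteq> generate G Y"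
proof -
  \<comment> \<open>The coset of \<open>\<one>\<close> is represented by \<open>\<one>\<close>
    itself, so that the representative disappears for elements of \<open>N\<close> at the
    end.\<close>
  define \<rho> where "\<rho> g = (if f g = f \<one> then \<one> else inv_into (carrier G) f (f g))" for g
  have \<rho>: "\<rho> g \<in> carrier G" "f (\<rho> g) = f g" if "g \<in> carrier G" for g
    using that by (auto simp: \<rho>_def inv_into_into f_inv_into_f)
  have \<rho>_eq: "\<rho> g = \<rho> h" if "f g = f h" for g h using that by (simp add: \<rho>_def)
  define S' where "S' = S \<union> (\<lambda>s. inv s) ` S"
  have S': "finite S'" "S' \<subseteq> carrier G" using S by (auto simp: S'_def)
  define Y where "Y = (\<lambda>(q, s). q \<otimes> s \<otimes> inv (\<rho> (q \<otimes> s))) ` (\<rho> ` carrier G \<times> S')"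
  have "\<rho> ` carrier G \<subseteq> insert \<one> (inv_into (carrier G) f ` f ` carrier G)" by (auto simp: \<rho>_def)
  then have "finite (\<rho> ` carrier G)" using fin finite_subset by blast
  then have Y1: "finite Y" using S' by (auto simp: Y_def)
  have "q \<otimes> inv (\<rho> q) \<in> N" if "q \<in> carrier G" for q using f[of q "\<rho> q"] \<rho>[OF that] that by simp
  then have Y2: "Y \<subseteq> N" using \<rho> S' by (auto simp: Y_def)
  have Y3: "Y \<subseteq> carrier G" using Y2 subgroup.subset[OF N] by blast
  \<comment> \<open>Multiplying \<open>g\<close> by a generator multiplies
    \<open>g \<otimes> inv (\<rho> g)\<close> by one Schreier generator, an element of
    \<open>Y\<close>.\<close>
  define E where "E = {g \<in> carrier G. g \<otimes> inv (\<rho> g) \<in> generate G Y}"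
  have step: "t \<otimes> s \<in> E" if "t \<in> E" "s \<in> S'" for t s
  proof -
    have t: "t \<in> carrier G" "s \<in> carrier G" using that S' by (auto simp: E_def)
    have "f (t \<otimes> s) = f (\<rho> t \<otimes> s)"
    proof -
      have "(t \<otimes> s) \<otimes> inv (\<rho> t \<otimes> s) = t \<otimes> inv (\<rho> t)"
        using t \<rho> by (simp add: inv_mult_group m_assoc)
      then show ?thesis using f[of "t \<otimes> s" "\<rho> t \<otimes> s"] f[of t "\<rho> t"] t \<rho>[OF t(1)] by simp
    qed
    then have eq: "\<rho> (t \<otimes> s) = \<rho> (\<rho> t \<otimes> s)" by (rule \<rho>_eq)
    have "\<rho> t \<otimes> s \<otimes> inv (\<rho> (\<rho> t \<otimes> s)) \<in> generate G Y"
      using t that(2) unfolding Y_def by (intro generate.incl) auto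
    then have "(t \<otimes> inv (\<rho> t)) \<otimes> (\<rho> t \<otimes> s \<otimes> inv (\<rho> (\<rho> t \<otimes> s))) \<in> generate G Y"
      using that(1) by (intro generate.eng[of "t \<otimes> inv (\<rho> t)"]) (auto simp: E_def)
    then show ?thesis using t \<rho>[OF t(1)] \<rho>[of "t \<otimes> s"] by (simp add: E_def eq m_assoc)
  qed
  have one: "\<one> \<in> E" by (simp add: E_def \<rho>_def generate.one)
  have "\<one> \<otimes> x \<in> E" if "x \<in> carrier G" for x
    using generate_right_closed[of x S E \<one>] that S step one by (auto simp: E_def S'_def)
  then have "x \<otimes> inv (\<rho> x) \<in> generate G Y" if "x \<in> carrier G" for x using that by (auto simp: E_def)
  moreover have "\<rho> x = \<one>" if "x \<in> N" for x
    using that f[of x \<one>] subgroup.subset[OF N] by (auto simp: \<rho>_def)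
  ultimately have "x \<in> generate G Y" if "x \<in> N" for x
    using that subgroup.mem_carrier[OF N that] by (metis inv_one r_one)
  then have "N \<subseteq> generate G Y" by blast
  then show thesis using that Y1 Y2 by blast
qed

text \<open>Products of sublists in the order of the list: these are the normal forms modulo
  squares, at most 2^r for a list of length r.\<close>

fun subproducts :: "'a list \<Rightarrow> 'a set" where
  "subproducts [] = {\<one>}"
| "subproducts (y # ys) = subproducts ys \<union> (\<lambda>p. y \<otimes> p) ` subproducts ys"

lemma finite_subproducts: "finite (subproducts ys)"
  by (induction ys) auto

text \<open>Modulo squares a finitely generated group is elementary abelian.\<close>

lemma squares_finite_index:
  assumes N: "subgroup N G" and Y: "finite Y" "Y \<subseteq> N" "N \<subseteq> generate G Y"
  obtains P where "finite P" "P \<subseteq> N" "\<And>x. x \<in> N \<Longrightarrow> \<exists>p\<in>P. x \<otimes> inv p \<in> generate G ((\<lambda>x. x \<otimes> x) ` N)"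
proof -
  let ?Q = "(\<lambda>x. x \<otimes> x) ` N"
  define M where "M = generate G ?Q"
  note Nc = subgroup.mem_carrier[OF N]
  have Q: "?Q \<subseteq> carrier G" using Nc by auto
  have M: "subgroup M G" unfolding M_def by (rule generate_is_subgroup[OF Q])
  note Mc = subgroup.mem_carrier[OF M]
  have sq: "x \<otimes> x \<in> M" if "x \<in> N" for x using that unfolding M_def by (intro generate.incl) auto
  have MN: "M \<subseteq> N" unfolding M_def
    using generate_subgroup_incl[OF _ N, of ?Q] N subgroup.m_closed by fastforce
  \<comment> \<open>Conjugates of squares are squares, so \<open>M\<close> is normal in
    \<open>N\<close>.\<close>
  have conj: "g \<otimes> x \<otimes> inv g \<in> M" if "g \<in> N" "x \<in> M" for g x
    using that(2) unfolding M_def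
  proof (induction rule: generate.induct)
    case one
    then show ?case using Nc[OF that(1)] by (simp add: generate.one)
  next
    case (incl h)
    then obtain y where y: "y \<in> N" "h = y \<otimes> y" by auto
    have "g \<otimes> y \<otimes> inv g \<in> N" using that(1) y N by (simp add: subgroup.m_closed subgroup.m_inv_closed)
    then have "(g \<otimes> y \<otimes> inv g) \<otimes> (g \<otimes> y \<otimes> inv g) \<in> generate G ?Q" using sq by (simp add: M_def)
    then show ?case using y Nc that(1) by (simp add: m_assoc)
  next
    case (inv h)
    then obtain y where y: "y \<in> N" "h = y \<otimes> y" by auto
    have "g \<otimes> inv y \<otimes> inv g \<in> N" using that(1) y N by (simp add: subgroup.m_closed subgroup.m_inv_closed)
    then have "(g \<otimes> inv y \<otimes> inv g) \<otimes> (g \<otimes> inv y \<otimes> inv g) \<in> generate G ?Q" using sq by (simp add: M_def)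
    then show ?case using y Nc that(1) by (simp add: m_assoc inv_mult_group)
  next
    case (eng h1 h2)
    have "h1 \<in> carrier G" "h2 \<in> carrier G" using eng.hyps generate_in_carrier[OF Q] by auto
    moreover have "(g \<otimes> h1 \<otimes> inv g) \<otimes> (g \<otimes> h2 \<otimes> inv g) \<in> generate G ?Q"
      using eng.IH by (rule generate.eng)
    ultimately show ?case using Nc[OF that(1)] by (simp add: m_assoc)
  qed
  define eqv where "eqv a b \<longleftrightarrow> a \<otimes> inv b \<in> M" for a b
  have refl: "eqv a a" if "a \<in> N" for a
    using Nc[OF that] subgroup.one_closed[OF M] by (simp add: eqv_def)
  have trans: "eqv a c" if "eqv a b" "eqv b c" "a \<in> N" "b \<in> N" "c \<in> N" for a b c
  proof -
    have "(a \<otimes> inv b) \<otimes> (b \<otimes> inv c) \<in> M" using that M by (simp add: eqv_def subgroup.m_closed)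
    then show ?thesis using that(3-5) Nc by (simp add: eqv_def m_assoc)
  qed
  have left: "eqv (x \<otimes> a) (x \<otimes> b)" if "eqv a b" "x \<in> N" "a \<in> N" "b \<in> N" for x a b
    using conj[of x "a \<otimes> inv b"] that Nc by (simp add: eqv_def m_assoc inv_mult_group)
  have comm: "eqv (a \<otimes> (b \<otimes> c)) (b \<otimes> (a \<otimes> c))" if abc: "a \<in> N" "b \<in> N" "c \<in> N" for a b c
  proof -
    \<comment> \<open>The identity behind this: a b a^-1 b^-1 = (a b)^2 (b^-1 a^-1 b)^2 b^-2, so
      commutators are products of squares.\<close>
    have "(a \<otimes> b) \<otimes> (a \<otimes> b) \<in> M" "(inv b \<otimes> inv a \<otimes> b) \<otimes> (inv b \<otimes> inv a \<otimes> b) \<in> M" "inv b \<otimes> inv b \<in> M"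
      using abc N by (auto intro!: sq simp: subgroup.m_closed subgroup.m_inv_closed)
    then have "((a \<otimes> b) \<otimes> (a \<otimes> b)) \<otimes> (((inv b \<otimes> inv a \<otimes> b) \<otimes> (inv b \<otimes> inv a \<otimes> b)) \<otimes> (inv b \<otimes> inv b)) \<in> M"
      using M by (simp add: subgroup.m_closed)
    moreover have "((a \<otimes> b) \<otimes> (a \<otimes> b)) \<otimes> (((inv b \<otimes> inv a \<otimes> b) \<otimes> (inv b \<otimes> inv a \<otimes> b)) \<otimes> (inv b \<otimes> inv b))
       = (a \<otimes> (b \<otimes> c)) \<otimes> inv (b \<otimes> (a \<otimes> c))"
      using abc Nc by (simp add: m_assoc inv_mult_group)
    ultimately show ?thesis by (simp add: eqv_def)
  qed
  have sub: "subproducts ys \<subseteq> N" if "set ys \<subseteq> N" for ys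
    using that N by (induction ys) (auto simp: subgroup.one_closed subgroup.m_closed)
  \<comment> \<open>A generator multiplied from the left travels by \<open>comm\<close> to its place
    in the list; if it already occurs in the product, the two copies form a square and
    vanish.\<close>
  have absorb: "\<exists>p'\<in>subproducts ys. eqv (y \<otimes> p) p'"
    if "set ys \<subseteq> N" "y \<in> set ys" "p \<in> subproducts ys" for ys y p
    using that
  proof (induction ys arbitrary: p)
    case Nil
    then show ?case by simp
  next
    case (Cons z ys)
    have ysN: "set ys \<subseteq> N" and zN: "z \<in> N" using Cons.prems by auto
    have yN: "y \<in> N" using Cons.prems by auto
    note subN = sub[OF ysN]
    consider (a) "p \<in> subproducts ys" | (b) p0 where "p0 \<in> subproducts ys" "p = z \<otimes> p0"
      using Cons.prems by auto
    then show ?case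
    proof cases
      case a
      show ?thesis
      proof (cases "y = z")
        case True
        have "y \<otimes> p \<in> N" using a subN yN N by (auto simp: subgroup.m_closed)
        then show ?thesis using a True refl by auto
      next
        case False
        then show ?thesis using Cons.IH[OF ysN _ a] Cons.prems(2) by auto
      qed
    next
      case b
      have p0: "p0 \<in> N" using b subN by auto
      show ?thesis
      proof (cases "y = z")
        case True
        have "y \<otimes> (z \<otimes> p0) \<otimes> inv p0 = y \<otimes> y" using True p0 zN Nc by (simp add: m_assoc)
        then have "eqv (y \<otimes> p) p0" using b sq[OF yN] by (simp add: eqv_def)
        then show ?thesis using b by auto
      next
        case False
        then obtain p' where p': "p' \<in> subproducts ys" "eqv (y \<otimes> p0) p'"
          using Cons.IH[OF ysN _ b(1)] Cons.prems(2) by auto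
        have p'N: "p' \<in> N" using p' subN by auto
        have "eqv (y \<otimes> (z \<otimes> p0)) (z \<otimes> (y \<otimes> p0))" using comm yN zN p0 by simp
        moreover have "eqv (z \<otimes> (y \<otimes> p0)) (z \<otimes> p')"
          using left[OF p'(2) zN] yN p0 p'N N by (simp add: subgroup.m_closed)
        ultimately have "eqv (y \<otimes> (z \<otimes> p0)) (z \<otimes> p')"
          using trans yN zN p0 p'N N by (meson subgroup.m_closed)
        then show ?thesis using b p'(1) by auto
      qed
    qed
  qed
  obtain ys where ys: "set ys = Y" using Y(1) finite_list by blast
  have ysN: "set ys \<subseteq> N" using ys Y by simp
  note subN = sub[OF ysN]
  have gen: "x \<in> N \<and> (\<forall>p\<in>subproducts ys. \<exists>p'\<in>subproducts ys. eqv (x \<otimes> p) p')" if "x \<in> generate G Y" for x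
    using that
  proof (induction rule: generate.induct)
    case one
    have "\<one> \<otimes> p = p" if "p \<in> subproducts ys" for p using that subN Nc by auto
    then show ?case using subN refl N by (auto simp: subgroup.one_closed subset_iff)
  next
    case (incl h)
    then show ?case using absorb[OF ysN] ys ysN by auto
  next
    case (inv h)
    then have hN: "h \<in> N" using ys ysN by auto
    have "\<exists>p'\<in>subproducts ys. eqv (inv h \<otimes> p) p'" if p: "p \<in> subproducts ys" for p
    proof -
      obtain p' where p': "p' \<in> subproducts ys" "eqv (h \<otimes> p) p'" using absorb[OF ysN _ p] inv ys by auto
      have N': "p \<in> N" "p' \<in> N" using p p' subN by auto
      \<comment> \<open>Modulo squares the inverse of \<open>h\<close> is \<open>h\<close>, which
        reduces this case to the preceding one.\<close>
      have "(inv h \<otimes> p) \<otimes> inv (h \<otimes> p) = inv h \<otimes> inv h" using N' hN Nc by (simp add: m_assoc inv_mult_group)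
      moreover have "inv h \<otimes> inv h \<in> M" using sq[of "inv h"] hN N by (simp add: subgroup.m_inv_closed)
      ultimately have "eqv (inv h \<otimes> p) (h \<otimes> p)" by (simp add: eqv_def)
      then show ?thesis using trans[OF _ p'(2)] p'(1) N' hN N by (meson subgroup.m_closed subgroup.m_inv_closed)
    qed
    then show ?case using hN N by (simp add: subgroup.m_inv_closed)
  next
    case (eng h1 h2)
    have h: "h1 \<in> N" "h2 \<in> N" using eng.IH by auto
    have "\<exists>p'\<in>subproducts ys. eqv (h1 \<otimes> h2 \<otimes> p) p'" if p: "p \<in> subproducts ys" for p
    proof -
      obtain p' where p': "p' \<in> subproducts ys" "eqv (h2 \<otimes> p) p'" using eng.IH(2) p by auto
      obtain p'' where p'': "p'' \<in> subproducts ys" "eqv (h1 \<otimes> p') p''" using eng.IH(1) p'(1) by auto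
      have N': "p \<in> N" "p' \<in> N" "p'' \<in> N" using p p' p'' subN by auto
      have "eqv (h1 \<otimes> (h2 \<otimes> p)) (h1 \<otimes> p')"
        using left[OF p'(2) h(1)] N' h N by (simp add: subgroup.m_closed)
      then have "eqv (h1 \<otimes> (h2 \<otimes> p)) p''" using trans[OF _ p''(2)] N' h N by (meson subgroup.m_closed)
      then show ?thesis using p''(1) N' h Nc by (auto simp: m_assoc)
    qed
    then show ?case using h N by (simp add: subgroup.m_closed)
  qed
  have one: "\<one> \<in> subproducts zs" for zs by (induction zs) auto
  have "\<exists>p\<in>subproducts ys. x \<otimes> inv p \<in> M" if "x \<in> N" for x
  proof -
    have "\<exists>p'\<in>subproducts ys. eqv (x \<otimes> \<one>) p'" using gen[of x] one[of ys] that Y(3) by blast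
    then show ?thesis using Nc[OF that] by (simp add: eqv_def)
  qed
  then show thesis using that[of "subproducts ys"] finite_subproducts subN by (auto simp: M_def)
qed

text \<open>Finitely many subgroups of bounded index intersect in a subgroup \<open>N\<close> of
  finite index. It is finitely generated, so the subgroup generated by its squares has finite index
  in \<open>N\<close> and hence in the whole group.\<close>

theorem squares_of_core_finite_index:
  fixes J :: nat
  assumes S: "finite S" "S \<subseteq> carrier G" "generate G S = carrier G"
    and \<T>: "\<And>T. T \<in> \<T> \<Longrightarrow> subgroup T G"
    and r: "\<And>T. T \<in> \<T> \<Longrightarrow> \<exists>r. (\<forall>i<J. r i \<in> carrier G) \<and> (\<forall>g\<in>carrier G. \<exists>i<J. g \<otimes> inv (r i) \<in> T)"
  defines "N \<equiv> {x \<in> carrier G. \<forall>T\<in>\<T>. x \<in> T}"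
  obtains R where "finite R" "R \<subseteq> carrier G"
    "\<And>g. g \<in> carrier G \<Longrightarrow> \<exists>r\<in>R. g \<otimes> inv r \<in> generate G ((\<lambda>x. x \<otimes> x) ` N)"
proof -
  obtain r where r: "\<And>T. T \<in> \<T> \<Longrightarrow> (\<forall>i<J. r T i \<in> carrier G) \<and> (\<forall>g\<in>carrier G. \<exists>i<J. g \<otimes> inv (r T i) \<in> T)"
    using r by metis
  have fin: "finite \<T>" by (rule finite_subgroups_of_index[OF S \<T>, of \<T> J r]) (use r in auto)
  define f where "f g = restrict (\<lambda>T. coset_label J T (r T) g) \<T>" for g
  have f: "f g = f h \<longleftrightarrow> g \<otimes> inv h \<in> N" if "g \<in> carrier G" "h \<in> carrier G" for g h
  proof -
    have "f g = f h \<longleftrightarrow> (\<forall>T\<in>\<T>. coset_label J T (r T) g = coset_label J T (r T) h)"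
      unfolding f_def by (auto simp: fun_eq_iff restrict_def)
    also have "\<dots> \<longleftrightarrow> (\<forall>T\<in>\<T>. g \<otimes> inv h \<in> T)"
      using coset_label_eq_iff[OF \<T>] r that by auto
    finally show ?thesis using that by (simp add: N_def)
  qed
  have "f ` carrier G \<subseteq> \<T> \<rightarrow>\<^sub>E {..<J}"
    using coset_label(1) r by (auto simp: f_def)
  then have finf: "finite (f ` carrier G)" using fin finite_PiE[of \<T> "\<lambda>_. {..<J}"] finite_subset by blast
  have N: "subgroup N G"
  proof (rule subgroupI)
    show "N \<subseteq> carrier G" "N \<noteq> {}" using \<T> subgroup.one_closed by (auto simp: N_def)
  qed (use \<T> in \<open>auto simp: N_def subgroup.m_inv_closed subgroup.m_closed\<close>)
  obtain Y where Y: "finite Y" "Y \<subseteq> N" "N \<subseteq> generate G Y"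
    using finite_index_generated[OF S finf f N] by blast
  obtain P where P: "finite P" "P \<subseteq> N" "\<And>x. x \<in> N \<Longrightarrow> \<exists>p\<in>P. x \<otimes> inv p \<in> generate G ((\<lambda>x. x \<otimes> x) ` N)"
    using squares_finite_index[OF N Y] by blast
  define T where "T = inv_into (carrier G) f ` f ` carrier G"
  have T: "finite T" "T \<subseteq> carrier G" using finf by (auto simp: T_def inv_into_into)
  \<comment> \<open>Representatives modulo squares inside \<open>N\<close>, times representatives
    modulo \<open>N\<close>.\<close>
  define R where "R = (\<lambda>(p, t). p \<otimes> t) ` (P \<times> T)"
  have Pc: "P \<subseteq> carrier G" using P(2) subgroup.subset[OF N] by blast
  show thesis
  proof
    show "finite R" "R \<subseteq> carrier G" using P(1) T Pc by (auto simp: R_def)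
    fix g assume g: "g \<in> carrier G"
    define t where "t = inv_into (carrier G) f (f g)"
    have t: "t \<in> T" "f t = f g" using g by (auto simp: t_def T_def f_inv_into_f)
    then have "g \<otimes> inv t \<in> N" using f[of g t] g T by auto
    then obtain p where p: "p \<in> P" "g \<otimes> inv t \<otimes> inv p \<in> generate G ((\<lambda>x. x \<otimes> x) ` N)" using P(3) by blast
    have "g \<otimes> inv (p \<otimes> t) = g \<otimes> inv t \<otimes> inv p"
      using g t(1) T(2) p(1) Pc by (auto simp: inv_mult_group m_assoc subset_iff)
    then have "g \<otimes> inv (p \<otimes> t) \<in> generate G ((\<lambda>x. x \<otimes> x) ` N)" using p(2) by simp
    then show "\<exists>r\<in>R. g \<otimes> inv r \<in> generate G ((\<lambda>x. x \<otimes> x) ` N)" using p(1) t(1) by (auto simp: R_def)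
  qed
qed

end

section \<open>Sums of four squares\<close>

definition four_sq :: "int \<Rightarrow> bool" where
  "four_sq x \<longleftrightarrow> (\<exists>a b c d. x = a * a + b * b + c * c + d * d)"

text \<open>Euler's identity: the norm of quaternions is multiplicative.\<close>

lemma four_sq_mult:
  assumes "four_sq x" "four_sq y"
  shows "four_sq (x * y)"
proof -
  obtain a b c d where x: "x = a * a + b * b + c * c + d * d" using assms(1) by (auto simp: four_sq_def)
  obtain e f g h where y: "y = e * e + f * f + g * g + h * h" using assms(2) by (auto simp: four_sq_def)
  have "x * y = (a*e + b*f + c*g + d*h) * (a*e + b*f + c*g + d*h)
    + (a*f - b*e + c*h - d*g) * (a*f - b*e + c*h - d*g)
    + (a*g - b*h - c*e + d*f) * (a*g - b*h - c*e + d*f)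
    + (a*h + b*g - c*f - d*e) * (a*h + b*g - c*f - d*e)"
    unfolding x y by (simp add: algebra_simps)
  then show ?thesis unfolding four_sq_def by blast
qed

text \<open>Pigeonhole: for 0 <= a, b <= (p - 1) / 2 the residues of a^2 and those of -1 - b^2
  number p + 1 altogether, so the two sets meet. The range of a and b also gives the bound by
  p^2.\<close>

lemma prime_dvd_sum_two_squares_Suc:
  fixes p :: int
  assumes "prime p" "odd p"
  obtains a b where "p dvd 1 + a * a + b * b" "1 + a * a + b * b < p * p"
proof -
  define m where "m = (p - 1) div 2"
  have p: "p = 2 * m + 1" using assms(2) unfolding m_def by presburger
  have m: "m \<ge> 1" using prime_ge_2_int[OF assms(1)] p by linarith
  have p0: "0 < p" using p m by linarith
  have inj: "a = b" if "0 \<le> a" "a \<le> m" "0 \<le> b" "b \<le> m" "p dvd a * a - b * b" for a b :: int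
  proof (rule ccontr)
    assume ne: "a \<noteq> b"
    have "p dvd (a - b) * (a + b)" using that(5) by (simp add: algebra_simps)
    then consider "p dvd a - b" | "p dvd a + b" using assms(1) prime_dvd_mult_iff by blast
    then show False
    proof cases
      case 1
      then have "\<bar>p\<bar> \<le> \<bar>a - b\<bar>" using ne by (intro dvd_imp_le_int) auto
      then show False using that p by linarith
    next
      case 2
      then have "\<bar>p\<bar> \<le> \<bar>a + b\<bar>" using ne that by (intro dvd_imp_le_int) auto
      then show False using that p by linarith
    qed
  qed
  define f where "f = (\<lambda>a. (a * a) mod p)"
  define g where "g = (\<lambda>b. (- 1 - b * b) mod p)"
  have injf: "inj_on f {0..m}"
    by (rule inj_onI) (auto simp: f_def mod_eq_dvd_iff intro!: inj)
  have injg: "inj_on g {0..m}"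
  proof (rule inj_onI)
    fix a b assume ab: "a \<in> {0..m}" "b \<in> {0..m}" "g a = g b"
    then have "p dvd (- 1 - a * a) - (- 1 - b * b)" by (simp add: g_def mod_eq_dvd_iff)
    then have "p dvd b * b - a * a" by simp
    then show "a = b" using inj[of b a] ab by auto
  qed
  have "f ` {0..m} \<inter> g ` {0..m} \<noteq> {}"
  proof
    assume "f ` {0..m} \<inter> g ` {0..m} = {}"
    then have "card (f ` {0..m} \<union> g ` {0..m}) = card {0..m} + card {0..m}"
      using injf injg by (simp add: card_Un_disjoint card_image)
    moreover have "f ` {0..m} \<union> g ` {0..m} \<subseteq> {0..<p}" using p0 by (auto simp: f_def g_def)
    then have "card (f ` {0..m} \<union> g ` {0..m}) \<le> card {0..<p}" by (intro card_mono) auto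
    ultimately show False using p m by simp
  qed
  then obtain a b where ab: "a \<in> {0..m}" "b \<in> {0..m}" "f a = g b" by blast
  have "p dvd a * a - (- 1 - b * b)" using ab(3) by (simp add: f_def g_def mod_eq_dvd_iff)
  then have "p dvd 1 + a * a + b * b" by (simp add: algebra_simps)
  moreover have "a * a \<le> m * m" "b * b \<le> m * m" using ab by (auto intro: mult_mono)
  moreover have "p * p = 4 * (m * m) + 4 * m + 1" "0 \<le> m * m" unfolding p by (simp_all add: algebra_simps)
  ultimately have "p dvd 1 + a * a + b * b" "1 + a * a + b * b < p * p" using m by linarith+
  then show thesis using that by blast
qed

text \<open>For an odd prime a there is a k with a * k = 1 + x^2 + y^2 and 0 < k < a. By induction k
  = q / p, hence a = p * (1 + x^2 + y^2) / q. Composite numbers follow by multiplicativity.\<close>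

lemma nonneg_ratio_four_sq:
  fixes a :: int
  assumes "0 \<le> a"
  shows "\<exists>p q. four_sq p \<and> p \<noteq> 0 \<and> four_sq q \<and> p * a = q"
  using assms
proof (induction "nat a" arbitrary: a rule: less_induct)
  case less
  have sq1: "four_sq 1" unfolding four_sq_def by (intro exI[of _ 1] exI[of _ 0]) simp
  have sq2: "four_sq 2" unfolding four_sq_def by (rule exI[of _ 1], rule exI[of _ 1], rule exI[of _ 0], rule exI[of _ 0]) simp
  have "a = 0 \<or> a = 1 \<or> a > 1" using less.prems by linarith
  moreover have "odd a" if "prime a" "a \<noteq> 2" using that prime_odd_int[of a] prime_ge_2_int[of a] by auto
  ultimately consider "a = 0" | "a = 1" | "a = 2" | "prime a" "odd a" | "a > 1" "\<not> prime a"
    by blast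
  then show ?case
  proof cases
    case 1
    moreover have "four_sq 0" unfolding four_sq_def by (rule exI[of _ 0])+ simp
    ultimately show ?thesis using sq1 by (intro exI[of _ 1] exI[of _ 0]) simp
  next
    case 2
    then show ?thesis using sq1 by auto
  next
    case 3
    then show ?thesis using sq1 sq2 by auto
  next
    case 4
    obtain x y where xy: "a dvd 1 + x * x + y * y" "1 + x * x + y * y < a * a"
      using prime_dvd_sum_two_squares_Suc[OF 4] by blast
    obtain k where k: "1 + x * x + y * y = a * k" using xy(1) by (auto simp: dvd_def)
    have a0: "a > 0" using 4(1) prime_gt_0_int by blast
    have pos: "1 + x * x + y * y > 0" by (simp add: add_pos_nonneg)
    have k0: "0 < k" using pos k a0 by (metis zero_less_mult_pos)
    have "k < a" using xy(2) k a0 by simp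
    then obtain p q where pq: "four_sq p" "p \<noteq> 0" "four_sq q" "p * k = q"
      using less.hyps[of k] k0 by fastforce
    have s: "four_sq (1 + x * x + y * y)" unfolding four_sq_def
      by (rule exI[of _ 1], rule exI[of _ x], rule exI[of _ y], rule exI[of _ 0]) simp
    have "q * a = p * (1 + x * x + y * y)" using pq(4) k by (simp add: algebra_simps)
    moreover have "q \<noteq> 0" using pq(2,4) k0 by auto
    ultimately show ?thesis using four_sq_mult[OF pq(1) s] pq(3) by auto
  next
    case 5
    obtain b c where bc: "a = b * c" "1 < b" "1 < c"
    proof -
      obtain b where b: "b dvd a" "0 \<le> b" "b \<noteq> 1" "b \<noteq> a" using 5 unfolding prime_int_iff by blast
      obtain c where c: "a = b * c" using b(1) by (auto simp: dvd_def)
      have "b \<noteq> 0" using c 5 by auto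
      then have b1: "1 < b" using b by linarith
      have "0 < b * c" using c 5 by simp
      then have "0 < c" using b1 by (simp add: zero_less_mult_iff)
      moreover have "c \<noteq> 1" using b(4) c by auto
      ultimately show thesis using that b1 c by force
    qed
    then have "b < a" "c < a" by auto
    then have "nat b < nat a" "nat c < nat a" "0 \<le> b" "0 \<le> c" using bc by auto
    then obtain p q p' q' where "four_sq p" "p \<noteq> 0" "four_sq q" "p * b = q"
       "four_sq p'" "p' \<noteq> 0" "four_sq q'" "p' * c = q'"
      using less.hyps[of b] less.hyps[of c] by blast
    moreover have "(p * p') * a = (p * b) * (p' * c)" using bc(1) by (simp add: algebra_simps)
    ultimately show ?thesis using four_sq_mult by (metis mult_eq_0_iff)
  qed
qed

section \<open>Words in elementary matrices\<close>

definition winv :: "letter list \<Rightarrow> letter list" where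
  "winv w = rev (map (\<lambda>(i, j, b). (i, j, \<not> b)) w)"

lemma letters_winv: "set (winv w) \<subseteq> letters n \<longleftrightarrow> set w \<subseteq> letters n"
  by (force simp: winv_def letters_def)

lemma ev_Nil [simp]: "ev K s [] = \<one>\<^bsub>K\<^esub>"
  by (simp add: ev_def)

lemma ev_snoc: "ev K s (w @ [l]) = ev K s w \<otimes>\<^bsub>K\<^esub> ltr K s l"
  by (simp add: ev_def)

context group
begin

context
  fixes n and s :: "'a tup"
  assumes s: "\<And>p. p \<in> {..<n} \<times> {..<n} \<Longrightarrow> s p \<in> carrier G"
begin

lemma ltr_closed: "l \<in> letters n \<Longrightarrow> ltr G s l \<in> carrier G"
  by (cases l) (auto simp: ltr_def letters_def s)

lemma ev_closed: "set w \<subseteq> letters n \<Longrightarrow> ev G s w \<in> carrier G"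
  by (induction w rule: rev_induct) (auto simp: ev_snoc ltr_closed)

lemma ev_append: "set v \<subseteq> letters n \<Longrightarrow> set w \<subseteq> letters n \<Longrightarrow> ev G s (v @ w) = ev G s v \<otimes> ev G s w"
proof (induction w rule: rev_induct)
  case Nil
  then show ?case by (simp add: ev_closed)
next
  case (snoc l w)
  then show ?case
    using ev_snoc[of G s "v @ w" l] by (simp add: ev_snoc m_assoc ev_closed ltr_closed)
qed

lemma ev_Cons: "l \<in> letters n \<Longrightarrow> set w \<subseteq> letters n \<Longrightarrow> ev G s (l # w) = ltr G s l \<otimes> ev G s w"
  using ev_append[of "[l]" w] ev_snoc[of G s "[]" l] by (simp add: ltr_closed)

lemma ev_winv: "set w \<subseteq> letters n \<Longrightarrow> ev G s (winv w) = inv (ev G s w)"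
proof (induction w rule: rev_induct)
  case Nil
  then show ?case by (simp add: winv_def)
next
  case (snoc l w)
  obtain i j b where l: "l = (i, j, b)" by (cases l)
  have l': "(i, j, \<not> b) \<in> letters n" "l \<in> letters n" using snoc.prems l by (auto simp: letters_def)
  have "ltr G s (i, j, \<not> b) = inv (ltr G s l)" using l l' s by (auto simp: ltr_def letters_def)
  moreover have "winv (w @ [l]) = (i, j, \<not> b) # winv w" using l by (simp add: winv_def)
  moreover have "set (winv w) \<subseteq> letters n" using snoc.prems letters_winv by simp
  ultimately show ?case
    using snoc l' by (simp add: ev_snoc ev_Cons inv_mult_group ltr_closed ev_closed)
qed

lemma ev_in_generate:
  assumes "set w \<subseteq> letters n"
  shows "ev G s w \<in> generate G (s ` ({..<n} \<times> {..<n}))"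
  using assms
proof (induction w rule: rev_induct)
  case Nil
  then show ?case by (simp add: generate.one)
next
  case (snoc l w)
  then have "ltr G s l \<in> generate G (s ` ({..<n} \<times> {..<n}))"
    by (cases l) (auto simp: ltr_def letters_def intro: generate.incl generate.inv)
  then show ?case using snoc by (simp add: ev_snoc generate.eng)
qed

end

end

section \<open>Elementary integer matrices and the special linear group\<close>

definition el :: "nat \<Rightarrow> nat \<Rightarrow> nat \<Rightarrow> int \<Rightarrow> int mat" where
  "el n i j c = mat n n (\<lambda>(a, b). (if a = b then 1 else 0) + (if a = i \<and> b = j then c else 0))"

lemma el_carrier [simp]: "el n i j c \<in> carrier_mat n n"
  by (simp add: el_def)

lemma el_dim [simp]: "dim_row (el n i j c) = n" "dim_col (el n i j c) = n"
  by (simp_all add: el_def)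

lemma el_index: "a < n \<Longrightarrow> b < n \<Longrightarrow>
    el n i j c $$ (a, b) = (if a = b then 1 else 0) + (if a = i \<and> b = j then c else 0)"
  by (simp add: el_def)

lemma det_el: "i \<noteq> j \<Longrightarrow> det (el n i j c) = 1"
proof -
  assume "i \<noteq> j"
  moreover have "el n i j c = addrow_mat n c i j"
    by (rule eq_matI) (auto simp: el_def addrow_mat_def)
  ultimately show ?thesis using det_addrow_mat by metis
qed

lemma mult_entry:
  fixes A B :: "int mat"
  assumes "A \<in> carrier_mat n n" "B \<in> carrier_mat n n" "i < n" "j < n"
  shows "(A * B) $$ (i, j) = (\<Sum>k<n. A $$ (i, k) * B $$ (k, j))"
  using assms by (auto simp: scalar_prod_def atLeast0LessThan)

lemma mult_el:
  assumes "A \<in> carrier_mat n n" "i < n" "a < n" "b < n"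
  shows "(A * el n i j c) $$ (a, b) = A $$ (a, b) + (if b = j then A $$ (a, i) * c else 0)"
proof -
  have "(A * el n i j c) $$ (a, b) = (\<Sum>k<n. A $$ (a, k) * el n i j c $$ (k, b))"
    using assms by (intro mult_entry) auto
  also have "\<dots> = (\<Sum>k<n. (if k = b then A $$ (a, k) else 0) + (if k = i then (if b = j then A $$ (a, i) * c else 0) else 0))"
    using assms by (intro sum.cong) (auto simp: el_index algebra_simps)
  finally show ?thesis using assms by (simp add: sum.distrib)
qed

lemma el_mult:
  assumes "A \<in> carrier_mat n n" "j < n" "a < n" "b < n"
  shows "(el n i j c * A) $$ (a, b) = A $$ (a, b) + (if a = i then c * A $$ (j, b) else 0)"
proof -
  have "(el n i j c * A) $$ (a, b) = (\<Sum>k<n. el n i j c $$ (a, k) * A $$ (k, b))"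
    using assms by (intro mult_entry) auto
  also have "\<dots> = (\<Sum>k<n. (if k = a then A $$ (k, b) else 0) + (if k = j then (if a = i then c * A $$ (j, b) else 0) else 0))"
    using assms by (intro sum.cong) (auto simp: el_index algebra_simps)
  finally show ?thesis using assms by (simp add: sum.distrib)
qed

lemma SL_simps [simp]:
  "x \<otimes>\<^bsub>SL_int n\<^esub> y = x * y" "\<one>\<^bsub>SL_int n\<^esub> = 1\<^sub>m n"
  "x \<in> carrier (SL_int n) \<longleftrightarrow> x \<in> carrier_mat n n \<and> det x = 1"
  by (simp_all add: SL_int_def)

lemma one_smult_mat: "(1 :: int) \<cdot>\<^sub>m 1\<^sub>m n = 1\<^sub>m n"
  by (rule eq_matI) auto

lemma group_SL: "group (SL_int n)"
proof (rule groupI)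
  fix x y z
  assume x: "x \<in> carrier (SL_int n)"
  then have xc: "x \<in> carrier_mat n n" "det x = 1" by auto
  show "\<one>\<^bsub>SL_int n\<^esub> \<otimes>\<^bsub>SL_int n\<^esub> x = x" using xc by simp
  \<comment> \<open>The adjugate is the inverse, since the determinant of \<open>x\<close> is
    1.\<close>
  have "det x * det (adj_mat x) = det (1\<^sub>m n)"
    using det_mult[OF xc(1) adj_mat(1)[OF xc(1)]] adj_mat(2)[OF xc(1)] xc(2) by (simp add: one_smult_mat)
  then have "adj_mat x \<in> carrier (SL_int n)" using adj_mat(1)[OF xc(1)] xc by simp
  moreover have "adj_mat x * x = 1\<^sub>m n" using adj_mat(3)[OF xc(1)] xc(2) by (simp add: one_smult_mat)
  ultimately show "\<exists>y\<in>carrier (SL_int n). y \<otimes>\<^bsub>SL_int n\<^esub> x = \<one>\<^bsub>SL_int n\<^esub>" by auto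
  assume y: "y \<in> carrier (SL_int n)"
  then show "x \<otimes>\<^bsub>SL_int n\<^esub> y \<in> carrier (SL_int n)" using xc by (simp add: det_mult[of _ n])
  assume z: "z \<in> carrier (SL_int n)"
  show "x \<otimes>\<^bsub>SL_int n\<^esub> y \<otimes>\<^bsub>SL_int n\<^esub> z = x \<otimes>\<^bsub>SL_int n\<^esub> (y \<otimes>\<^bsub>SL_int n\<^esub> z)"
    using x y z by (simp add: assoc_mult_mat[of _ n n _ n _ n])
qed simp

lemma el_add:
  assumes "i < n" "i \<noteq> j"
  shows "el n i j c * el n i j d = el n i j (c + d)"
  by (rule eq_matI) (use assms in \<open>auto simp: mult_el el_index simp del: index_mult_mat(1)\<close>)

lemma el_zero: "el n i j 0 = 1\<^sub>m n"
  by (rule eq_matI) (auto simp: el_index)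

lemma el_SL [simp]: "i \<noteq> j \<Longrightarrow> el n i j c \<in> carrier (SL_int n)"
  by (simp add: det_el)

lemma inv_el: "i < n \<Longrightarrow> i \<noteq> j \<Longrightarrow> inv\<^bsub>SL_int n\<^esub> (el n i j c) = el n i j (- c)"
  by (rule group.inv_equality[OF group_SL]) (auto simp: el_add el_zero det_el)

text \<open>Diagonal positions hold the identity, so that every component of the tuple lies in the
  group.\<close>

definition gens :: "nat \<Rightarrow> int mat tup" where
  "gens n = (\<lambda>(i, j). if i = j then 1\<^sub>m n else el n i j 1)"

lemma gens_closed: "gens n p \<in> carrier (SL_int n)"
  by (cases p) (auto simp: gens_def det_el)

abbreviation evs :: "nat \<Rightarrow> letter list \<Rightarrow> int mat" where
  "evs n \<equiv> ev (SL_int n) (gens n)"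

lemma ltr_gens: "(i, j, b) \<in> letters n \<Longrightarrow> ltr (SL_int n) (gens n) (i, j, b) = el n i j (if b then 1 else - 1)"
  by (auto simp: ltr_def letters_def gens_def inv_el)

lemma evs_closed: "set w \<subseteq> letters n \<Longrightarrow> evs n w \<in> carrier (SL_int n)"
  using group.ev_closed[OF group_SL, of n "gens n"] gens_closed by blast

lemma evs_append: "set v \<subseteq> letters n \<Longrightarrow> set w \<subseteq> letters n \<Longrightarrow> evs n (v @ w) = evs n v * evs n w"
  using group.ev_append[OF group_SL, of n "gens n"] gens_closed by simp

lemma evs_winv: "set w \<subseteq> letters n \<Longrightarrow> evs n (winv w) = inv\<^bsub>SL_int n\<^esub> (evs n w)"
  using group.ev_winv[OF group_SL, of n "gens n"] gens_closed by blast

lemma evs_carrier: "set w \<subseteq> letters n \<Longrightarrow> evs n w \<in> carrier_mat n n"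
  using evs_closed by simp

lemma evs_snoc_entry:
  assumes "C \<in> carrier_mat n n" "set w \<subseteq> letters n" "(k, l, b) \<in> letters n" "i < n" "j < n"
  shows "(C * evs n (w @ [(k, l, b)])) $$ (i, j) = (C * evs n w) $$ (i, j) +
    (if j = l then (if b then 1 else - 1) * (C * evs n w) $$ (i, k) else 0)"
proof -
  have "C * evs n (w @ [(k, l, b)]) = C * evs n w * el n k l (if b then 1 else - 1)"
    using assms ltr_gens[OF assms(3)]
    by (simp add: ev_snoc assoc_mult_mat[OF assms(1) evs_carrier el_carrier])
  moreover have "C * evs n w \<in> carrier_mat n n" using assms evs_carrier by simp
  moreover have "k < n" using assms(3) by (simp add: letters_def)
  ultimately show ?thesis using assms by (simp add: mult_el del: index_mult_mat(1))
qed

section \<open>Reduction of integer matrices by column operations\<close>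

definition lettersJ :: "nat set \<Rightarrow> letter set" where
  "lettersJ J = {(i, j, b). i \<in> J \<and> j \<in> J \<and> i \<noteq> j}"

lemma lettersJ: "J \<subseteq> {..<n} \<Longrightarrow> lettersJ J \<subseteq> letters n"
  by (auto simp: lettersJ_def letters_def)

lemma evs_outside:
  assumes C: "C \<in> carrier_mat n n" and J: "J \<subseteq> {..<n}" and "set w \<subseteq> lettersJ J" "i < n" "j < n" "j \<notin> J"
  shows "(C * evs n w) $$ (i, j) = C $$ (i, j)"
  using assms(3)
proof (induction w rule: rev_induct)
  case Nil
  then show ?case using C by simp
next
  case (snoc l w)
  obtain k m b where l: "l = (k, m, b)" by (cases l)
  have "m \<in> J" "l \<in> letters n" "set w \<subseteq> letters n" using snoc.prems l lettersJ[OF J] by (auto simp: lettersJ_def)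
  then show ?case using snoc assms evs_snoc_entry[OF C, of w k m b i j] l by auto
qed

text \<open>Common divisors of a row segment survive operations inside the segment. The divisor 0
  expresses that a zero segment stays zero.\<close>

lemma evs_dvd_row:
  assumes C: "C \<in> carrier_mat n n" and J: "J \<subseteq> {..<n}" and "set w \<subseteq> lettersJ J" "i < n"
    and "\<And>j. j \<in> J \<Longrightarrow> d dvd C $$ (i, j)" and "j \<in> J"
  shows "d dvd (C * evs n w) $$ (i, j)"
  using assms(3,6)
proof (induction w arbitrary: j rule: rev_induct)
  case Nil
  then show ?case using C assms by simp
next
  case (snoc l w)
  obtain k m b where l: "l = (k, m, b)" by (cases l)
  have "k \<in> J" "l \<in> letters n" "set w \<subseteq> letters n" "j < n"
    using snoc.prems l lettersJ[OF J] J by (auto simp: lettersJ_def)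
  then show ?case using snoc assms evs_snoc_entry[OF C, of w k m b i j] l by auto
qed

lemma evs_zero_row:
  assumes "C \<in> carrier_mat n n" "J \<subseteq> {..<n}" "set w \<subseteq> lettersJ J" "i < n"
    and "\<And>j. j \<in> J \<Longrightarrow> C $$ (i, j) = 0" and "j \<in> J"
  shows "(C * evs n w) $$ (i, j) = 0"
  using evs_dvd_row[OF assms(1-4), of 0 j] assms(5,6) by simp

lemma mult_evs_append:
  assumes "C \<in> carrier_mat n n" "set v \<subseteq> letters n" "set w \<subseteq> letters n"
  shows "C * evs n v * evs n w = C * evs n (v @ w)"
  using assms by (simp add: evs_append assoc_mult_mat[OF _ evs_carrier evs_carrier])

text \<open>The Euclidean algorithm by single additions and subtractions of columns; the sum of the
  absolute values of row \<open>r\<close> over \<open>J\<close> decreases.\<close>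

lemma row_reduce_one:
  assumes C: "C \<in> carrier_mat n n" and r: "r < n" and J: "J \<subseteq> {..<n}"
  shows "\<exists>w. set w \<subseteq> lettersJ J \<and> (\<forall>j\<in>J. \<forall>k\<in>J. j \<noteq> k \<longrightarrow> (C * evs n w) $$ (r, j) = 0 \<or> (C * evs n w) $$ (r, k) = 0)"
  using C
proof (induction "\<Sum>j\<in>J. nat \<bar>C $$ (r, j)\<bar>" arbitrary: C rule: less_induct)
  case less
  note C = less.prems
  have fin: "finite J" using J finite_subset by blast
  show ?case
  proof (cases "\<forall>j\<in>J. \<forall>k\<in>J. j \<noteq> k \<longrightarrow> C $$ (r, j) = 0 \<or> C $$ (r, k) = 0")
    case True
    then show ?thesis using C by (intro exI[of _ "[]"]) simp
  next
    case False
    then obtain j k where jk: "j \<in> J" "k \<in> J" "j \<noteq> k" "C $$ (r, j) \<noteq> 0" "C $$ (r, k) \<noteq> 0"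
      "\<bar>C $$ (r, j)\<bar> \<le> \<bar>C $$ (r, k)\<bar>"
      by (metis linear)
    \<comment> \<open>The sign is chosen such that the entry in column \<open>k\<close>, the one of
      larger or equal absolute value, shrinks.\<close>
    define b where "b = (C $$ (r, j) > 0 \<longleftrightarrow> C $$ (r, k) < 0)"
    let ?w = "[(j, k, b)]"
    have w: "set ?w \<subseteq> lettersJ J" "set ?w \<subseteq> letters n" using jk lettersJ[OF J] by (auto simp: lettersJ_def)
    let ?D = "C * evs n ?w"
    have D: "?D \<in> carrier_mat n n" using C evs_carrier[OF w(2)] by simp
    have ent: "?D $$ (r, i) = C $$ (r, i) + (if i = k then (if b then 1 else - 1) * C $$ (r, j) else 0)"
      if "i \<in> J" for i
      using evs_snoc_entry[OF C, of "[]" j k b r i] w r that J C by auto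
    have lt: "nat \<bar>?D $$ (r, k)\<bar> < nat \<bar>C $$ (r, k)\<bar>"
      using ent[OF jk(2)] jk(4-6) by (auto simp: b_def)
    have "(\<Sum>i\<in>J. nat \<bar>?D $$ (r, i)\<bar>) < (\<Sum>i\<in>J. nat \<bar>C $$ (r, i)\<bar>)"
    proof (rule sum_strict_mono_ex1[OF fin])
      show "\<forall>i\<in>J. nat \<bar>?D $$ (r, i)\<bar> \<le> nat \<bar>C $$ (r, i)\<bar>"
      proof
        fix i assume "i \<in> J"
        then show "nat \<bar>?D $$ (r, i)\<bar> \<le> nat \<bar>C $$ (r, i)\<bar>" using lt ent[of i] by (cases "i = k") auto
      qed
      show "\<exists>i\<in>J. nat \<bar>?D $$ (r, i)\<bar> < nat \<bar>C $$ (r, i)\<bar>" using lt jk(2) by blast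
    qed
    then obtain v where v: "set v \<subseteq> lettersJ J"
      "\<forall>j\<in>J. \<forall>k\<in>J. j \<noteq> k \<longrightarrow> (?D * evs n v) $$ (r, j) = 0 \<or> (?D * evs n v) $$ (r, k) = 0"
      using less.hyps[OF _ D] by blast
    have "?D * evs n v = C * evs n (?w @ v)"
      using v(1) lettersJ[OF J] by (intro mult_evs_append[OF C w(2)]) auto
    then show ?thesis using v w(1) by (intro exI[of _ "?w @ v"]) auto
  qed
qed

lemma row_reduce:
  assumes C: "C \<in> carrier_mat n n" and r: "r < n" and J: "J \<subseteq> {..<n}" and t: "t \<in> J"
  obtains w where "set w \<subseteq> lettersJ J" "\<And>j. j \<in> J \<Longrightarrow> j \<noteq> t \<Longrightarrow> (C * evs n w) $$ (r, j) = 0"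
proof -
  obtain w where w: "set w \<subseteq> lettersJ J"
    "\<forall>j\<in>J. \<forall>k\<in>J. j \<noteq> k \<longrightarrow> (C * evs n w) $$ (r, j) = 0 \<or> (C * evs n w) $$ (r, k) = 0"
    using row_reduce_one[OF C r J] by blast
  have wl: "set w \<subseteq> letters n" using w(1) lettersJ[OF J] by auto
  show thesis
  proof (cases "\<exists>k\<in>J. k \<noteq> t \<and> (C * evs n w) $$ (r, k) \<noteq> 0")
    case False
    then show thesis using that w(1) by blast
  next
    case True
    then obtain k where k: "k \<in> J" "k \<noteq> t" "(C * evs n w) $$ (r, k) \<noteq> 0" by blast
    have z: "(C * evs n w) $$ (r, j) = 0" if "j \<in> J" "j \<noteq> k" for j using w(2) k that by blast
    \<comment> \<open>The surviving entry x moves from column \<open>k\<close> to column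
      \<open>t\<close>: the pair (x, 0) becomes (x, x) and then (0, x).\<close>
    have l: "(k, t, True) \<in> letters n" "(t, k, False) \<in> letters n" using k t J by (auto simp: letters_def)
    have 1: "(C * evs n (w @ [(k, t, True)])) $$ (r, j) = (C * evs n w) $$ (r, j) + (if j = t then (C * evs n w) $$ (r, k) else 0)"
      if "j \<in> J" for j
      using evs_snoc_entry[OF C wl l(1) r, of j] that J by auto
    have 2: "(C * evs n ((w @ [(k, t, True)]) @ [(t, k, False)])) $$ (r, j) = 0" if "j \<in> J" "j \<noteq> t" for j
      using evs_snoc_entry[OF C _ l(2) r, of "w @ [(k, t, True)]" j] wl l(1) that J 1[of j] 1[of t] t z k
      by auto
    have "set ((w @ [(k, t, True)]) @ [(t, k, False)]) \<subseteq> lettersJ J" using w(1) k t by (auto simp: lettersJ_def)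
    then show thesis using that 2 by blast
  qed
qed

text \<open>Row \<open>m\<close> is reduced within the columns from \<open>m\<close> on. The rows
  above vanish on these columns and are not disturbed.\<close>

lemma lower_triangularize:
  assumes C: "C \<in> carrier_mat n n" and m: "m \<le> n"
  shows "\<exists>w. set w \<subseteq> letters n \<and> (\<forall>i<m. \<forall>j<n. i < j \<longrightarrow> (C * evs n w) $$ (i, j) = 0)"
  using m
proof (induction m)
  case 0
  show ?case by (intro exI[of _ "[]"]) simp
next
  case (Suc m)
  then obtain w where w: "set w \<subseteq> letters n" "\<forall>i<m. \<forall>j<n. i < j \<longrightarrow> (C * evs n w) $$ (i, j) = 0" by auto
  let ?D = "C * evs n w"
  have D: "?D \<in> carrier_mat n n" using C evs_carrier[OF w(1)] by simp
  have J: "{m..<n} \<subseteq> {..<n}" "m \<in> {m..<n}" "m < n" using Suc.prems by auto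
  obtain v where v: "set v \<subseteq> lettersJ {m..<n}" "\<And>j. j \<in> {m..<n} \<Longrightarrow> j \<noteq> m \<Longrightarrow> (?D * evs n v) $$ (m, j) = 0"
    using row_reduce[OF D J(3,1,2)] by blast
  have vl: "set v \<subseteq> letters n" using v(1) lettersJ[OF J(1)] by auto
  have "(?D * evs n v) $$ (i, j) = 0" if "i < Suc m" "j < n" "i < j" for i j
  proof (cases "i = m")
    case True
    then show ?thesis using v(2) that by auto
  next
    case False
    then have i: "i < m" using that by simp
    show ?thesis
    proof (cases "j < m")
      case True
      then show ?thesis using evs_outside[OF D J(1) v(1), of i j] w(2) i that by auto
    next
      case False
      then show ?thesis
        using evs_zero_row[OF D J(1) v(1), of i j] w(2) i that by auto
    qed
  qed
  then show ?case using w(1) vl mult_evs_append[OF C w(1) vl] by (intro exI[of _ "w @ v"]) auto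
qed

lemma evs_replicate:
  assumes C: "C \<in> carrier_mat n n" and "(k, l, b) \<in> letters n" "i < n" "j < n"
  shows "(C * evs n (replicate m (k, l, b))) $$ (i, j) =
    C $$ (i, j) + (if j = l then (if b then int m else - int m) * C $$ (i, k) else 0)"
  using assms(3,4)
proof (induction m arbitrary: i j)
  case 0
  then show ?case using C by simp
next
  case (Suc m)
  have kl: "k < n" "k \<noteq> l" using assms(2) by (auto simp: letters_def)
  have s: "set (replicate m (k, l, b)) \<subseteq> letters n" using assms(2) by auto
  have "replicate (Suc m) (k, l, b) = replicate m (k, l, b) @ [(k, l, b)]"
    by (simp add: replicate_append_same)
  then show ?case
    using Suc kl evs_snoc_entry[OF C s assms(2) Suc.prems] by (auto simp: algebra_simps)
qed

text \<open>Rows are cleared from top to bottom, row \<open>m\<close> from left to right, by adding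
  multiples of column \<open>m\<close> to the columns before it. Column \<open>m\<close> vanishes
  above row \<open>m\<close>, so the rows already cleared stay so.\<close>

lemma diagonalize:
  assumes C: "C \<in> carrier_mat n n" and low: "\<And>i j. i < n \<Longrightarrow> j < n \<Longrightarrow> i < j \<Longrightarrow> C $$ (i, j) = 0"
    and diag: "\<And>i. i < n \<Longrightarrow> \<bar>C $$ (i, i)\<bar> = 1"
    and m: "m \<le> n"
  shows "\<exists>w. set w \<subseteq> letters n \<and> (\<forall>i<n. \<forall>j<n. i < j \<or> i < m \<and> i \<noteq> j \<longrightarrow> (C * evs n w) $$ (i, j) = 0) \<and>
    (\<forall>i<n. (C * evs n w) $$ (i, i) = C $$ (i, i))"
  using m
proof (induction m)
  case 0
  then show ?case using low C by (intro exI[of _ "[]"]) auto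
next
  case (Suc m)
  then have mn: "m < n" by simp
  have "\<exists>w. set w \<subseteq> letters n \<and>
      (\<forall>i<n. \<forall>j<n. i < j \<or> i < m \<and> i \<noteq> j \<or> i = m \<and> j < k \<longrightarrow> (C * evs n w) $$ (i, j) = 0) \<and>
      (\<forall>i<n. (C * evs n w) $$ (i, i) = C $$ (i, i))" if "k \<le> m" for k
    using that
  proof (induction k)
    case 0
    then show ?case using Suc.IH mn by auto
  next
    case (Suc k)
    then obtain w where w: "set w \<subseteq> letters n"
      "\<forall>i<n. \<forall>j<n. i < j \<or> i < m \<and> i \<noteq> j \<or> i = m \<and> j < k \<longrightarrow> (C * evs n w) $$ (i, j) = 0"
      "\<forall>i<n. (C * evs n w) $$ (i, i) = C $$ (i, i)" by auto
    let ?D = "C * evs n w"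
    have D: "?D \<in> carrier_mat n n" using C evs_carrier[OF w(1)] by simp
    \<comment> \<open>The diagonal entry is +-1 and thus its own inverse, so adding \<open>c\<close>
      times column \<open>m\<close> cancels the entry at \<open>(m, k)\<close>.\<close>
    define c where "c = - ?D $$ (m, k) * C $$ (m, m)"
    define v where "v = replicate (nat \<bar>c\<bar>) (m, k, c \<ge> 0)"
    have kn: "k < m" "k < n" using Suc.prems mn by auto
    have l: "(m, k, b) \<in> letters n" for b using kn mn by (simp add: letters_def)
    have vl: "set v \<subseteq> letters n" using l by (auto simp: v_def)
    have ent: "(?D * evs n v) $$ (i, j) = ?D $$ (i, j) + (if j = k then c * ?D $$ (i, m) else 0)"
      if "i < n" "j < n" for i j
      using evs_replicate[OF D l that, of "nat \<bar>c\<bar>" "c \<ge> 0"] by (auto simp: v_def)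
    have "C $$ (m, m) * C $$ (m, m) = 1" using diag[OF mn] by (auto simp: abs_if split: if_splits) 
    then have "(?D * evs n v) $$ (m, k) = 0"
      using ent[OF mn kn(2)] w(3) mn by (simp add: c_def mult.assoc)
    moreover have "(?D * evs n v) $$ (i, j) = 0"
      if "i < n" "j < n" "i < j \<or> i < m \<and> i \<noteq> j \<or> i = m \<and> j < k" for i j
      using ent[OF that(1,2)] w(2) that kn mn by auto
    ultimately have "(?D * evs n v) $$ (i, j) = 0"
      if "i < n" "j < n" "i < j \<or> i < m \<and> i \<noteq> j \<or> i = m \<and> j < Suc k" for i j
      using that less_Suc_eq by blast
    moreover have "(?D * evs n v) $$ (i, i) = C $$ (i, i)" if "i < n" for i
      using ent[OF that that] w(2,3) that kn mn by auto
    ultimately show ?case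
      using w(1) vl mult_evs_append[OF C w(1) vl] by (intro exI[of _ "w @ v"]) auto
  qed
  from this[of m] show ?case
    by (metis less_Suc_eq linorder_neqE_nat order_refl)
qed

text \<open>The square of e_kl(1) e_lk(-1) e_kl(1), a quarter turn in the plane of \<open>k\<close>
  and \<open>l\<close>; it equals the diagonal matrix with -1 at \<open>k\<close> and
  \<open>l\<close>.\<close>

definition negw :: "nat \<Rightarrow> nat \<Rightarrow> letter list" where
  "negw k l = [(k, l, True), (l, k, False), (k, l, True), (k, l, True), (l, k, False), (k, l, True)]"

lemma negw_letters: "k < n \<Longrightarrow> l < n \<Longrightarrow> k \<noteq> l \<Longrightarrow> set (negw k l) \<subseteq> letters n"
  by (auto simp: negw_def letters_def)

lemma evs_negw:
  assumes C: "C \<in> carrier_mat n n" and kl: "k < n" "l < n" "k \<noteq> l" and ij: "i < n" "j < n"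
  shows "(C * evs n (negw k l)) $$ (i, j) = (if j = k \<or> j = l then - C $$ (i, j) else C $$ (i, j))"
proof -
  let ?a = "(k, l, True)" and ?b = "(l, k, False)"
  have ab: "?a \<in> letters n" "?b \<in> letters n" using kl by (auto simp: letters_def)
  note step = evs_snoc_entry[OF C _ _ ij(1)]
  have 0: "(C * evs n []) $$ (i, j) = C $$ (i, j)" if "j < n" for j using C by simp
  have 1: "(C * evs n [?a]) $$ (i, j) = (if j = l then C $$ (i, l) + C $$ (i, k) else C $$ (i, j))"
    if "j < n" for j using step[of "[]" k l True j] ab that kl 0 by auto
  have 2: "(C * evs n [?a, ?b]) $$ (i, j) = (if j = l then C $$ (i, l) + C $$ (i, k) else if j = k then - C $$ (i, l) else C $$ (i, j))"
    if "j < n" for j using step[of "[?a]" l k False j] ab that kl 1 by auto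
  have 3: "(C * evs n [?a, ?b, ?a]) $$ (i, j) = (if j = l then C $$ (i, k) else if j = k then - C $$ (i, l) else C $$ (i, j))"
    if "j < n" for j using step[of "[?a, ?b]" k l True j] ab that kl 2 by auto
  have 4: "(C * evs n [?a, ?b, ?a, ?a]) $$ (i, j) = (if j = l then C $$ (i, k) - C $$ (i, l) else if j = k then - C $$ (i, l) else C $$ (i, j))"
    if "j < n" for j using step[of "[?a, ?b, ?a]" k l True j] ab that kl 3 by auto
  have 5: "(C * evs n [?a, ?b, ?a, ?a, ?b]) $$ (i, j) = (if j = l then C $$ (i, k) - C $$ (i, l) else if j = k then - C $$ (i, k) else C $$ (i, j))"
    if "j < n" for j using step[of "[?a, ?b, ?a, ?a]" l k False j] ab that kl 4 by auto
  have 6: "(C * evs n [?a, ?b, ?a, ?a, ?b, ?a]) $$ (i, j) = (if j = l then - C $$ (i, l) else if j = k then - C $$ (i, k) else C $$ (i, j))"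
    if "j < n" for j using step[of "[?a, ?b, ?a, ?a, ?b]" k l True j] ab that kl 5 by auto
  show ?thesis using 6[OF ij(2)] by (auto simp: negw_def)
qed

text \<open>Each -1 is pushed on to the next diagonal position; the sign of the last one is left to
  the determinant.\<close>

lemma diagonal_signs:
  assumes C: "C \<in> carrier_mat n n" and off: "\<And>i j. i < n \<Longrightarrow> j < n \<Longrightarrow> i \<noteq> j \<Longrightarrow> C $$ (i, j) = 0"
    and diag: "\<And>i. i < n \<Longrightarrow> \<bar>C $$ (i, i)\<bar> = 1" and m: "Suc m \<le> n"
  shows "\<exists>w. set w \<subseteq> letters n \<and> (\<forall>i<n. \<forall>j<n. i \<noteq> j \<longrightarrow> (C * evs n w) $$ (i, j) = 0) \<and>
    (\<forall>i<n. \<bar>(C * evs n w) $$ (i, i)\<bar> = 1) \<and> (\<forall>i<m. (C * evs n w) $$ (i, i) = 1)"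
  using m
proof (induction m)
  case 0
  then show ?case using off diag C by (intro exI[of _ "[]"]) auto
next
  case (Suc m)
  then obtain w where w: "set w \<subseteq> letters n" "\<forall>i<n. \<forall>j<n. i \<noteq> j \<longrightarrow> (C * evs n w) $$ (i, j) = 0"
    "\<forall>i<n. \<bar>(C * evs n w) $$ (i, i)\<bar> = 1" "\<forall>i<m. (C * evs n w) $$ (i, i) = 1" by auto
  let ?D = "C * evs n w"
  have D: "?D \<in> carrier_mat n n" using C evs_carrier[OF w(1)] by simp
  have mn: "m < n" "Suc m < n" "m \<noteq> Suc m" using Suc.prems by auto
  show ?case
  proof (cases "?D $$ (m, m) = 1")
    case True
    then show ?thesis using w by (intro exI[of _ w]) (auto simp: less_Suc_eq)
  next
    case False
    then have m1: "?D $$ (m, m) = - 1" using w(3) mn by (metis abs_eq_iff abs_one)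
    have v: "set (negw m (Suc m)) \<subseteq> letters n" using negw_letters mn by blast
    have eq: "C * evs n (w @ negw m (Suc m)) = ?D * evs n (negw m (Suc m))"
      using mult_evs_append[OF C w(1) v] by simp
    note ent = evs_negw[OF D mn]
    show ?thesis
    proof (intro exI[of _ "w @ negw m (Suc m)"] conjI allI impI)
      show "set (w @ negw m (Suc m)) \<subseteq> letters n" using w(1) v by simp
    next
      fix i j assume "i < n" "j < n" "i \<noteq> j"
      then show "(C * evs n (w @ negw m (Suc m))) $$ (i, j) = 0" unfolding eq using w(2) ent by auto
    next
      fix i assume "i < n"
      then show "\<bar>(C * evs n (w @ negw m (Suc m))) $$ (i, i)\<bar> = 1" unfolding eq using w(3) ent by auto
    next
      fix i assume "i < Suc m"
      then show "(C * evs n (w @ negw m (Suc m))) $$ (i, i) = 1"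
        unfolding eq using w(4) ent[of i i] mn m1 by (auto simp: less_Suc_eq)
    qed
  qed
qed

lemma det_diagonal_signs:
  assumes C: "C \<in> carrier_mat n n" and low: "\<And>i j. i < n \<Longrightarrow> j < n \<Longrightarrow> i < j \<Longrightarrow> C $$ (i, j) = 0"
  shows "det (C :: int mat) = (\<Prod>i<n. C $$ (i, i))"
proof -
  have "det C = prod_list (diag_mat C)" by (rule det_lower_triangular[OF _ C]) (use low in auto)
  also have "\<dots> = (\<Prod>i<n. C $$ (i, i))" using C by (simp add: prod_list_diag_prod atLeast0LessThan)
  finally show ?thesis .
qed

lemma abs_prod_one:
  fixes f :: "nat \<Rightarrow> int"
  assumes "(\<Prod>i<n. f i) = 1" "i < n"
  shows "\<bar>f i\<bar> = 1"
proof -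
  have "f i dvd (\<Prod>i<n. f i)" using assms(2) by (intro dvd_prodI) auto
  then show ?thesis using assms(1) by simp
qed

theorem SL_word:
  assumes A: "A \<in> carrier (SL_int n)"
  obtains w where "set w \<subseteq> letters n" "A = evs n w"
proof (cases "n = 0")
  case True
  then have "A = evs n []" using A by (intro eq_matI) auto
  then show thesis using that[of "[]"] by simp
next
  case False
  have Ac: "A \<in> carrier_mat n n" using A by simp
  have det: "det (A * evs n w) = 1" if "set w \<subseteq> letters n" for w
    using A evs_closed[OF that] by (simp add: det_mult[of _ n])
  obtain u where u: "set u \<subseteq> letters n" "\<forall>i<n. \<forall>j<n. i < j \<longrightarrow> (A * evs n u) $$ (i, j) = 0"
    using lower_triangularize[OF Ac order_refl] by blast
  let ?L = "A * evs n u"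
  have L: "?L \<in> carrier_mat n n" using Ac evs_carrier[OF u(1)] by simp
  have "(\<Prod>i<n. ?L $$ (i, i)) = 1" using det_diagonal_signs[OF L] u(2) det[OF u(1)] by simp
  then have diag: "\<bar>?L $$ (i, i)\<bar> = 1" if "i < n" for i
    using abs_prod_one[of "\<lambda>i. ?L $$ (i, i)"] that by blast
  obtain v where v: "set v \<subseteq> letters n" "\<forall>i<n. \<forall>j<n. i < j \<or> i < n \<and> i \<noteq> j \<longrightarrow> (?L * evs n v) $$ (i, j) = 0"
    "\<forall>i<n. (?L * evs n v) $$ (i, i) = ?L $$ (i, i)"
    using diagonalize[OF L _ diag order_refl] u(2) by blast
  let ?D = "?L * evs n v"
  have D: "?D \<in> carrier_mat n n" using L evs_carrier[OF v(1)] by simp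
  obtain x where x: "set x \<subseteq> letters n" "\<forall>i<n. \<forall>j<n. i \<noteq> j \<longrightarrow> (?D * evs n x) $$ (i, j) = 0"
    "\<forall>i<n. \<bar>(?D * evs n x) $$ (i, i)\<bar> = 1" "\<forall>i<n - 1. (?D * evs n x) $$ (i, i) = 1"
    using diagonal_signs[OF D _ _, of "n - 1"] v(2,3) diag False by auto
  let ?w = "u @ v @ x"
  have w: "set ?w \<subseteq> letters n" using u v x by auto
  have eq: "?D * evs n x = A * evs n ?w"
    using mult_evs_append[OF L v(1) x(1)] mult_evs_append[OF Ac u(1), of "v @ x"] v(1) x(1) by simp
  let ?E = "?D * evs n x"
  have E: "?E \<in> carrier_mat n n" using D evs_carrier[OF x(1)] by simp
  have "(\<Prod>i<n. ?E $$ (i, i)) = 1" using det_diagonal_signs[OF E] x(2) det[OF w] eq by simp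
  moreover have "{..<n} = insert (n - 1) {..<n - 1}" using False by auto
  ultimately have "?E $$ (n - 1, n - 1) * (\<Prod>i<n - 1. ?E $$ (i, i)) = 1" by simp
  then have "?E $$ (n - 1, n - 1) = 1" using x(4) by simp
  then have "?E $$ (i, i) = 1" if "i < n" for i using x(4) that by (cases "i = n - 1") auto
  then have "?E = 1\<^sub>m n" using x(2) E by (intro eq_matI) auto
  then have "A * evs n ?w = 1\<^sub>m n" using eq by simp
  then have "A = inv\<^bsub>SL_int n\<^esub> (evs n ?w)"
    using group.inv_equality[OF group_SL[of n], of A "evs n ?w"] A evs_closed[OF w] by simp
  then have "A = evs n (winv ?w)" using evs_winv[OF w] by simp
  then show thesis using that[of "winv ?w"] w letters_winv by blast
qed

lemma finitely_generated_SL: "finitely_generated (SL_int n)"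
  unfolding finitely_generated_def
proof (intro exI conjI)
  let ?S = "gens n ` ({..<n} \<times> {..<n})"
  show "finite ?S" by simp
  show S: "?S \<subseteq> carrier (SL_int n)" using gens_closed by blast
  show "generate (SL_int n) ?S = carrier (SL_int n)"
  proof
    show "generate (SL_int n) ?S \<subseteq> carrier (SL_int n)"
      using group.generate_in_carrier[OF group_SL S] by blast
    show "carrier (SL_int n) \<subseteq> generate (SL_int n) ?S"
    proof
      fix A assume "A \<in> carrier (SL_int n)"
      then obtain w where "set w \<subseteq> letters n" "A = evs n w" by (rule SL_word)
      then show "A \<in> generate (SL_int n) ?S"
        using group.ev_in_generate[OF group_SL, of n "gens n"] gens_closed by blast
    qed
  qed
qed

section \<open>Arithmetic in the special linear group\<close>

text \<open>A commutator equation without inverses can be checked entry by entry.\<close>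

lemma (in group) com_eq_iff:
  assumes "x \<in> carrier G" "y \<in> carrier G" "w \<in> carrier G"
  shows "w = com G x y \<longleftrightarrow> x \<otimes> y = w \<otimes> (y \<otimes> x)"
proof -
  have "com G x y = (x \<otimes> y) \<otimes> inv (y \<otimes> x)"
    using assms by (simp add: com_def inv_mult_group m_assoc)
  then show ?thesis using inv_solve_right[of w "x \<otimes> y" "y \<otimes> x"] assms by simp
qed

lemma mat_eq_iff_entries:
  "A \<in> carrier_mat n n \<Longrightarrow> B \<in> carrier_mat n n \<Longrightarrow> A = B \<longleftrightarrow> (\<forall>a<n. \<forall>b<n. A $$ (a, b) = B $$ (a, b))"
  by (auto intro: eq_matI)

lemma inv_SL:
  assumes "x \<in> carrier (SL_int n)"
  shows "inv\<^bsub>SL_int n\<^esub> x \<in> carrier_mat n n" "x * inv\<^bsub>SL_int n\<^esub> x = 1\<^sub>m n" "inv\<^bsub>SL_int n\<^esub> x * x = 1\<^sub>m n"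
  using group.inv_closed[OF group_SL assms] group.r_inv[OF group_SL assms] group.l_inv[OF group_SL assms] by auto

lemma row_mult:
  fixes A :: "int mat"
  assumes "A \<in> carrier_mat n n" "B \<in> carrier_mat n n" "i < n" "j < n" "k < n"
    and "\<And>l. l < n \<Longrightarrow> l \<noteq> k \<Longrightarrow> A $$ (i, l) = 0"
  shows "(A * B) $$ (i, j) = A $$ (i, k) * B $$ (k, j)"
proof -
  have "(A * B) $$ (i, j) = (\<Sum>l<n. A $$ (i, l) * B $$ (l, j))" using assms by (intro mult_entry)
  also have "\<dots> = (\<Sum>l<n. if l = k then A $$ (i, k) * B $$ (k, j) else 0)"
    using assms by (intro sum.cong) auto
  finally show ?thesis using assms by simp
qed

lemma col_mult:
  fixes A :: "int mat"
  assumes "A \<in> carrier_mat n n" "B \<in> carrier_mat n n" "i < n" "j < n" "k < n"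
    and "\<And>l. l < n \<Longrightarrow> l \<noteq> k \<Longrightarrow> B $$ (l, j) = 0"
  shows "(A * B) $$ (i, j) = A $$ (i, k) * B $$ (k, j)"
proof -
  have "(A * B) $$ (i, j) = (\<Sum>l<n. A $$ (i, l) * B $$ (l, j))" using assms by (intro mult_entry)
  also have "\<dots> = (\<Sum>l<n. if l = k then A $$ (i, k) * B $$ (k, j) else 0)"
    using assms by (intro sum.cong) auto
  finally show ?thesis using assms by simp
qed

lemma abs_one_if_mult: "(a::int) * b = 1 \<Longrightarrow> \<bar>a\<bar> = 1 \<and> \<bar>b\<bar> = 1"
  by (metis abs_1 dvd_def mult.commute zdvd1_eq)

lemma gens_el: "i \<noteq> j \<Longrightarrow> gens n (i, j) = el n i j 1"
  by (simp add: gens_def)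

text \<open>Commuting with 1 + E_kl is commuting with the matrix unit E_kl: the product x E_kl
  carries column k of x in column l, and E_kl x carries row l of x in row k.\<close>

lemma cm_gens:
  assumes "x \<in> carrier_mat n n" "k < n" "l < n" "k \<noteq> l"
  shows "cm (SL_int n) x (gens n (k, l)) \<longleftrightarrow>
    (\<forall>a<n. \<forall>b<n. (if b = l then x $$ (a, k) else 0) = (if a = k then x $$ (l, b) else 0))"
proof -
  have "cm (SL_int n) x (gens n (k, l)) \<longleftrightarrow>
    (\<forall>a<n. \<forall>b<n. (x * el n k l 1) $$ (a, b) = (el n k l 1 * x) $$ (a, b))"
  proof -
    have "x * el n k l 1 \<in> carrier_mat n n" "el n k l 1 * x \<in> carrier_mat n n"
      using assms by (auto intro!: mult_carrier_mat[of _ n n])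
    then show ?thesis using assms(4) mat_eq_iff_entries unfolding cm_def by (simp add: gens_el)
  qed
  also have "\<dots> \<longleftrightarrow> (\<forall>a<n. \<forall>b<n. (if b = l then x $$ (a, k) else 0) = (if a = k then x $$ (l, b) else 0))"
    using assms by (simp add: mult_el el_mult del: index_mult_mat(1))
  finally show ?thesis .
qed

lemma el_inject: "i < n \<Longrightarrow> j < n \<Longrightarrow> el n i j c = el n i j d \<longleftrightarrow> c = d"
proof
  assume "i < n" "j < n" "el n i j c = el n i j d"
  then have "el n i j c $$ (i, j) = el n i j d $$ (i, j)" by simp
  then show "c = d" using \<open>i < n\<close> \<open>j < n\<close> by (simp add: el_index)
qed simp

text \<open>The tested e_kl are those that commute with e_ij. The e_kj make column k vanish off the
  diagonal, the e_il do the same to row l and equate the diagonal entries. A scalar remains, and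
  invertibility makes it +-1.\<close>

lemma cuni_SL_iff:
  assumes x: "x \<in> carrier (SL_int n)" and ij: "i < n" "j < n" "i \<noteq> j" and n: "3 \<le> n"
  shows "cuni (SL_int n) n (gens n) i j x \<longleftrightarrow> (\<exists>\<epsilon> c. \<bar>\<epsilon>\<bar> = 1 \<and> x = \<epsilon> \<cdot>\<^sub>m el n i j c)"
proof
  assume cu: "cuni (SL_int n) n (gens n) i j x"
  have xc: "x \<in> carrier_mat n n" using x by simp
  have ent: "(if b = l then x $$ (a, k) else 0) = (if a = k then x $$ (l, b) else 0)"
    if "k < n" "l < n" "k \<noteq> l" "l \<noteq> i" "k \<noteq> j" "a < n" "b < n" for k l a b
    using cu that cm_gens[OF xc that(1-3)] by (auto simp: cuni_def)
  have col: "x $$ (a, k) = 0" if "k < n" "k \<noteq> j" "a < n" "a \<noteq> k" for a k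
    using ent[of k j a j] that ij by auto
  have row: "x $$ (l, b) = 0" if "l < n" "l \<noteq> i" "b < n" "b \<noteq> l" for l b
    using ent[of i l i b] that ij by auto
  have diag: "x $$ (l, l) = x $$ (i, i)" if "l < n" for l
    using ent[of i l i l] that ij by (cases "l = i") auto
  define \<epsilon> where "\<epsilon> = x $$ (i, i)"
  let ?y = "inv\<^bsub>SL_int n\<^esub> x"
  \<comment> \<open>Row \<open>j\<close> of \<open>x\<close> has only its diagonal entry, which is
    therefore a unit.\<close>
  have "(x * ?y) $$ (j, j) = x $$ (j, j) * ?y $$ (j, j)"
    using row[of j] ij by (intro row_mult[OF xc inv_SL(1)[OF x]]) auto
  then have "\<epsilon> * ?y $$ (j, j) = 1" using inv_SL(2)[OF x] ij diag[of j] by (simp add: \<epsilon>_def)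
  then have e: "\<bar>\<epsilon>\<bar> = 1" using abs_one_if_mult by blast
  then have ee: "\<epsilon> * \<epsilon> = 1" by (auto simp: abs_if split: if_splits)
  have "x = \<epsilon> \<cdot>\<^sub>m el n i j (\<epsilon> * x $$ (i, j))"
  proof (rule eq_matI)
    fix a b assume "a < dim_row (\<epsilon> \<cdot>\<^sub>m el n i j (\<epsilon> * x $$ (i, j)))" "b < dim_col (\<epsilon> \<cdot>\<^sub>m el n i j (\<epsilon> * x $$ (i, j)))"
    then have ab: "a < n" "b < n" by auto
    have "\<epsilon> * (\<epsilon> * x $$ (i, j)) = x $$ (i, j)" using ee by (simp add: mult.assoc[symmetric])
    then show "x $$ (a, b) = (\<epsilon> \<cdot>\<^sub>m el n i j (\<epsilon> * x $$ (i, j))) $$ (a, b)"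
      using ab ij diag[of a] row[of a b] col[of b a] by (auto simp: el_index \<epsilon>_def)
  qed (use xc in auto)
  then show "\<exists>\<epsilon> c. \<bar>\<epsilon>\<bar> = 1 \<and> x = \<epsilon> \<cdot>\<^sub>m el n i j c" using e by blast
next
  assume "\<exists>\<epsilon> c. \<bar>\<epsilon>\<bar> = 1 \<and> x = \<epsilon> \<cdot>\<^sub>m el n i j c"
  then obtain \<epsilon> c where xe: "x = \<epsilon> \<cdot>\<^sub>m el n i j c" by blast
  have xc: "x \<in> carrier_mat n n" using x by simp
  show "cuni (SL_int n) n (gens n) i j x"
    unfolding cuni_def
  proof (intro ballI impI)
    fix k l assume "k \<in> {..<n}" "l \<in> {..<n}" "k \<noteq> l \<and> l \<noteq> i \<and> k \<noteq> j"
    then show "cm (SL_int n) x (gens n (k, l))"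
      using ij by (subst cm_gens[OF xc]) (auto simp: xe el_index)
  qed
qed

lemma smult_smult: "(a :: int) \<cdot>\<^sub>m (b \<cdot>\<^sub>m A) = (a * b) \<cdot>\<^sub>m A"
  by (rule eq_matI) auto

lemma commutator_el:
  assumes "i < n" "j < n" "k < n" "i \<noteq> j" "j \<noteq> k" "i \<noteq> k"
  shows "el n i j a * el n j k b = el n i k (a * b) * (el n j k b * el n i j a)"
proof (subst mat_eq_iff_entries[of _ n])
  have 1: "el n j k b * el n i j a \<in> carrier_mat n n" by (intro mult_carrier_mat) auto
  show "\<forall>p<n. \<forall>q<n. (el n i j a * el n j k b) $$ (p, q) = (el n i k (a * b) * (el n j k b * el n i j a)) $$ (p, q)"
    using assms 1 by (auto simp: mult_el el_mult el_index simp del: index_mult_mat(1))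
qed (auto intro!: mult_carrier_mat[of _ n n])

text \<open>Scalars cancel in a commutator; this removes the sign that \<open>cuni\<close> leaves
  open.\<close>

lemma com_scaled_el:
  assumes idx: "i < n" "j < n" "k < n" "i \<noteq> j" "j \<noteq> k" "i \<noteq> k"
    and x: "\<epsilon> \<cdot>\<^sub>m el n i j a \<in> carrier (SL_int n)" and y: "\<mu> \<cdot>\<^sub>m el n j k b \<in> carrier (SL_int n)"
  shows "com (SL_int n) (\<epsilon> \<cdot>\<^sub>m el n i j a) (\<mu> \<cdot>\<^sub>m el n j k b) = el n i k (a * b)"
proof -
  let ?x = "el n i j a" and ?y = "el n j k b" and ?w = "el n i k (a * b)"
  have carr: "?y * ?x \<in> carrier_mat n n" by (intro mult_carrier_mat[of _ n n]) auto
  have "(\<epsilon> \<cdot>\<^sub>m ?x) * (\<mu> \<cdot>\<^sub>m ?y) = ?w * ((\<mu> \<cdot>\<^sub>m ?y) * (\<epsilon> \<cdot>\<^sub>m ?x))"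
    using commutator_el[OF idx, of a b] carr
    by (simp add: mult_smult_assoc_mat[of _ n n _ n] mult_smult_distrib[of _ n n _ n]
        smult_smult mult.commute)
  then show ?thesis
    using group.com_eq_iff[OF group_SL x y, of ?w] idx by (auto simp: det_el)
qed

section \<open>Codes of integers and stabilisers of unit vectors\<close>

locale sl3 =
  fixes n :: nat
  assumes n3: "3 \<le> n"
begin

abbreviation "G \<equiv> SL_int n"
abbreviation "s \<equiv> gens n"
abbreviation "e \<equiv> el n 0 2"

lemma idx [simp]: "0 < n" "Suc 0 < n" "1 < n" "2 < n"
  using n3 by auto

lemma e_carrier [simp]: "e c \<in> carrier G" "det (e c) = 1"
  by (simp_all add: det_el)

lemma e_inject [simp]: "e c = e d \<longleftrightarrow> c = d"
  by (simp add: el_inject)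

lemma e_mult [simp]: "e a * e b = e (a + b)"
  by (simp add: el_add)

lemma e_inv [simp]: "inv\<^bsub>G\<^esub> (e a) = e (- a)"
  by (simp add: inv_el)

lemma s02: "s (0, 2) = e 1"
  by (simp add: gens_el)

lemma one_e: "1\<^sub>m n = e 0"
  by (simp add: el_zero)

lemma el_carrier_G: "i \<noteq> j \<Longrightarrow> 1 \<cdot>\<^sub>m el n i j c \<in> carrier G" "1 \<cdot>\<^sub>m el n i j c = el n i j c"
proof -
  have eq: "1 \<cdot>\<^sub>m el n i j c = el n i j c" by (rule eq_matI) auto
  then show "1 \<cdot>\<^sub>m el n i j c = el n i j c" .
  show "1 \<cdot>\<^sub>m el n i j c \<in> carrier G" if "i \<noteq> j" unfolding eq using that by (rule el_SL)
qed

lemma cuni_el: "i < n \<Longrightarrow> j < n \<Longrightarrow> i \<noteq> j \<Longrightarrow> cuni G n s i j (el n i j c)"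
  using cuni_SL_iff[of "el n i j c" n i j] n3 el_carrier_G(2)[of i j c, symmetric]
  by (metis abs_1 el_SL)

lemma mulr_iff: "mulr G n s u v w \<longleftrightarrow> (\<exists>a b. u = e a \<and> v = e b \<and> w = e (a * b))"
proof
  assume "mulr G n s u v w"
  then obtain x y where xy: "x \<in> carrier G" "y \<in> carrier G" "cuni G n s 0 1 x" "cuni G n s 1 2 y"
    "u = com G x (s (1, 2))" "v = com G (s (0, 1)) y" "w = com G x y" by (auto simp: mulr_def)
  obtain \<epsilon> a where x: "x = \<epsilon> \<cdot>\<^sub>m el n 0 1 a" using xy cuni_SL_iff[of x n 0 1] n3 by auto
  obtain \<mu> b where y: "y = \<mu> \<cdot>\<^sub>m el n 1 2 b" using xy cuni_SL_iff[of y n 1 2] n3 by auto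
  have "com G x (1 \<cdot>\<^sub>m el n 1 2 1) = e (a * 1)" "com G (1 \<cdot>\<^sub>m el n 0 1 1) y = e (1 * b)" "com G x y = e (a * b)"
    unfolding x y using xy(1,2) x y el_carrier_G(1)
    by (intro com_scaled_el; simp)+
  then show "\<exists>a b. u = e a \<and> v = e b \<and> w = e (a * b)"
    using xy by (intro exI[of _ a] exI[of _ b]) (auto simp: gens_el el_carrier_G(2))
next
  assume "\<exists>a b. u = e a \<and> v = e b \<and> w = e (a * b)"
  then obtain a b where ab: "u = e a" "v = e b" "w = e (a * b)" by blast
  have coms: "com G (1 \<cdot>\<^sub>m el n 0 1 a) (1 \<cdot>\<^sub>m el n 1 2 1) = e (a * 1)"
    "com G (1 \<cdot>\<^sub>m el n 0 1 1) (1 \<cdot>\<^sub>m el n 1 2 b) = e (1 * b)"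
    "com G (1 \<cdot>\<^sub>m el n 0 1 a) (1 \<cdot>\<^sub>m el n 1 2 b) = e (a * b)"
    using el_carrier_G(1) by (intro com_scaled_el; simp)+
  show "mulr G n s u v w"
    unfolding mulr_def
    by (rule bexI[of _ "el n 0 1 a"], rule bexI[of _ "el n 1 2 b"])
      (use coms ab cuni_el[of 0 1 a] cuni_el[of 1 2 b] in \<open>auto simp: gens_el el_carrier_G(2) det_el\<close>)
qed

lemma num_iff: "num G n s u \<longleftrightarrow> (\<exists>a. u = e a)"
proof
  assume "num G n s u"
  then obtain x where x: "x \<in> carrier G" "cuni G n s 0 1 x" "u = com G x (s (1, 2))" by (auto simp: num_def)
  have "mulr G n s u (com G (s (0, 1)) (s (1, 2))) (com G x (s (1, 2)))"
    unfolding mulr_def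
    by (rule bexI[of _ x], rule bexI[of _ "s (1, 2)"]) (use x cuni_el[of 1 2 1] in \<open>auto simp: gens_el det_el\<close>)
  then show "\<exists>a. u = e a" using mulr_iff by blast
next
  assume "\<exists>a. u = e a"
  then obtain a where "u = e a" by blast
  then have "mulr G n s u (e 1) (e (a * 1))" using mulr_iff by blast
  then show "num G n s u" by (auto simp: mulr_def num_def)
qed

lemma mulr_square: "mulr G n s u u w \<longleftrightarrow> (\<exists>a. u = e a \<and> w = e (a * a))"
  unfolding mulr_iff by auto

lemma sq4_iff: "sq4 G n s p \<longleftrightarrow> (\<exists>x. p = e x \<and> four_sq x)"
proof
  assume "sq4 G n s p"
  then obtain a b c d where "p = e (a * a) * e (b * b) * e (c * c) * e (d * d)"
    unfolding sq4_def mulr_square by (elim bexE conjE exE) simp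
  then have "p = e (a * a + b * b + c * c + d * d)" by simp
  then show "\<exists>x. p = e x \<and> four_sq x" unfolding four_sq_def by blast
next
  assume "\<exists>x. p = e x \<and> four_sq x"
  then obtain x where x: "p = e x" "four_sq x" by blast
  then obtain a b c d where p: "p = e (a * a + b * b + c * c + d * d)" unfolding four_sq_def by blast
  have m: "mulr G n s (e x) (e x) (e (x * x))" for x using mulr_square by blast
  show "sq4 G n s p" unfolding sq4_def
    by (rule bexI[of _ "e a"], rule bexI[of _ "e b"], rule bexI[of _ "e c"], rule bexI[of _ "e d"],
        rule bexI[of _ "e (a * a)"], rule bexI[of _ "e (b * b)"], rule bexI[of _ "e (c * c)"],
        rule bexI[of _ "e (d * d)"]) (use m p in \<open>simp_all add: det_el\<close>)
qed

lemma four_sq_nonneg: "four_sq x \<Longrightarrow> 0 \<le> x"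
  by (auto simp: four_sq_def)

lemma nn_iff: "nn G n s u \<longleftrightarrow> (\<exists>a\<ge>0. u = e a)"
proof
  assume "nn G n s u"
  then obtain p x where p: "four_sq p" "four_sq (p * x)" "p \<noteq> 0" "u = e x"
    unfolding nn_def sq4_iff mulr_iff by (auto simp: one_e)
  then have "0 < p" "0 \<le> p * x" using four_sq_nonneg by force+
  then have "0 \<le> x" by (simp add: zero_le_mult_iff)
  then show "\<exists>a\<ge>0. u = e a" using p by blast
next
  assume "\<exists>a\<ge>0. u = e a"
  then obtain a where a: "0 \<le> a" "u = e a" by blast
  obtain p q where pq: "four_sq p" "p \<noteq> 0" "four_sq q" "p * a = q" using nonneg_ratio_four_sq[OF a(1)] by blast
  show "nn G n s u" unfolding nn_def sq4_iff mulr_iff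
    by (rule bexI[of _ "e p"], rule bexI[of _ "e q"]) (use pq a(2) in \<open>auto simp: one_e det_el\<close>)
qed

lemma le_iff: "le G n s u v \<longleftrightarrow> (\<exists>a b. u = e a \<and> v = e b \<and> a \<le> b)"
  unfolding le_def num_iff nn_iff by auto

text \<open>A conjugate of an elementary matrix is the identity plus a matrix of rank one: a column
  of \<open>p\<close> times a row of its inverse.\<close>

lemma conj_el_entry:
  assumes p: "p \<in> carrier_mat n n" and y: "y \<in> carrier_mat n n" and py: "p * y = 1\<^sub>m n"
    and ij: "i < n" "k < n" and ab: "a < n" "b < n"
  shows "(p * el n i k 1 * y) $$ (a, b) = (if a = b then 1 else 0) + p $$ (a, i) * y $$ (k, b)"
proof -
  have "(p * el n i k 1 * y) $$ (a, b) = (\<Sum>c<n. (p * el n i k 1) $$ (a, c) * y $$ (c, b))"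
    using assms by (intro mult_entry) auto
  also have "\<dots> = (\<Sum>c<n. p $$ (a, c) * y $$ (c, b) + (if c = k then p $$ (a, i) * y $$ (k, b) else 0))"
    using assms by (intro sum.cong) (auto simp: mult_el algebra_simps simp del: index_mult_mat(1))
  also have "\<dots> = (\<Sum>c<n. p $$ (a, c) * y $$ (c, b)) + p $$ (a, i) * y $$ (k, b)"
    using ij by (simp add: sum.distrib)
  also have "(\<Sum>c<n. p $$ (a, c) * y $$ (c, b)) = (p * y) $$ (a, b)"
    using assms by (intro mult_entry[symmetric]) auto
  finally show ?thesis using py ab by simp
qed

text \<open>If column j of p has a nonzero entry at some l other than j, commutation of the
  conjugate of e_jl with e_jl annihilates row l of the inverse, which is impossible. Conversely, if
  column j of p is a multiple of the unit vector, so is that of the inverse, and the off-identity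
  parts annihilate each other.\<close>

lemma colst_iff:
  assumes p: "p \<in> carrier G" and j: "j < n"
  shows "colst G n s j p \<longleftrightarrow> (\<forall>l<n. l \<noteq> j \<longrightarrow> p $$ (l, j) = 0)"
proof -
  let ?y = "inv\<^bsub>G\<^esub> p"
  note y = inv_SL[OF p]
  have pc: "p \<in> carrier_mat n n" using p by simp
  define M where "M k = p * el n j k 1 * ?y" for k
  have M: "M k $$ (a, b) = (if a = b then 1 else 0) + p $$ (a, j) * ?y $$ (k, b)"
    if "k < n" "a < n" "b < n" for k a b
    unfolding M_def using conj_el_entry[OF pc y(1,2) j that] .
  have Mc: "M k \<in> carrier_mat n n" for k unfolding M_def using pc y(1) by (intro mult_carrier_mat[of _ n n]) auto
  have cm: "cm G (p \<otimes>\<^bsub>G\<^esub> s (j, k) \<otimes>\<^bsub>G\<^esub> ?y) (s (j, l)) \<longleftrightarrow>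
      (\<forall>a<n. \<forall>b<n. (if b = l then M k $$ (a, j) else 0) = (if a = j then M k $$ (l, b) else 0))"
    if "k < n" "l < n" "k \<noteq> j" "l \<noteq> j" for k l
    using cm_gens[OF Mc[of k] j that(2)] that by (auto simp: M_def gens_el)
  have ypk: "(?y * p) $$ (k, k) = 1" if "k < n" for k using y(3) that by simp
  show ?thesis
  proof
    assume cs: "colst G n s j p"
    show "\<forall>l<n. l \<noteq> j \<longrightarrow> p $$ (l, j) = 0"
    proof (intro allI impI, rule ccontr)
      fix l assume l: "l < n" "l \<noteq> j" "p $$ (l, j) \<noteq> 0"
      have eq: "(if b = l then M l $$ (a, j) else 0) = (if a = j then M l $$ (l, b) else 0)" if "a < n" "b < n" for a b
        using cs cm[of l l] l that j unfolding colst_def by blast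
      have y0: "?y $$ (l, b) = 0" if "b < n" "b \<noteq> l" for b
        using eq[OF j that(1)] M[of l l b] l that by auto
      have "?y $$ (l, l) = 0"
        using eq[OF j l(1)] M[of l j j] M[of l l l] l y0[OF j] j by auto
      then have "(?y * p) $$ (l, l) = 0"
        using mult_entry[OF y(1) pc l(1) l(1)] y0 by (intro trans[OF mult_entry[OF y(1) pc l(1) l(1)]] sum.neutral) (metis lessThan_iff mult_zero_left)
      then show False using ypk[OF l(1)] by simp
    qed
  next
    assume z: "\<forall>l<n. l \<noteq> j \<longrightarrow> p $$ (l, j) = 0"
    have e: "(?y * p) $$ (k, j) = ?y $$ (k, j) * p $$ (j, j)" if "k < n" for k
      using z j that by (intro col_mult[OF y(1) pc]) auto
    have "?y $$ (j, j) * p $$ (j, j) = 1" using e[OF j] y(3) j by simp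
    then have "p $$ (j, j) \<noteq> 0" by auto
    then have y0: "?y $$ (k, j) = 0" if "k < n" "k \<noteq> j" for k using e[OF that(1)] y(3) that j by simp
    show "colst G n s j p"
      unfolding colst_def
    proof (intro ballI impI)
      fix k l assume "k \<in> {..<n}" "l \<in> {..<n}" "k \<noteq> j \<and> l \<noteq> j"
      then have kl: "k < n" "l < n" "k \<noteq> j" "l \<noteq> j" by auto
      show "cm G (p \<otimes>\<^bsub>G\<^esub> s (j, k) \<otimes>\<^bsub>G\<^esub> ?y) (s (j, l))"
        unfolding cm[OF kl] using M[OF kl(1)] j kl y0[OF kl(1,3)] z by auto
    qed
  qed
qed

text \<open>Dual to \<open>colst_iff\<close>, with rows and columns and the two sides of the
  conjugation exchanged.\<close>

lemma rowst_iff: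
  assumes q: "q \<in> carrier G" and i: "i < n"
  shows "rowst G n s i q \<longleftrightarrow> (\<forall>l<n. l \<noteq> i \<longrightarrow> q $$ (i, l) = 0)"
proof -
  let ?y = "inv\<^bsub>G\<^esub> q"
  note y = inv_SL[OF q]
  have qc: "q \<in> carrier_mat n n" using q by simp
  define M where "M k = ?y * el n k i 1 * q" for k
  have M: "M k $$ (a, b) = (if a = b then 1 else 0) + ?y $$ (a, k) * q $$ (i, b)"
    if "k < n" "a < n" "b < n" for k a b
    unfolding M_def using conj_el_entry[OF y(1) qc y(3) that(1) i that(2,3)] .
  have Mc: "M k \<in> carrier_mat n n" for k unfolding M_def using qc y(1) by (intro mult_carrier_mat[of _ n n]) auto
  have cm: "cm G (?y \<otimes>\<^bsub>G\<^esub> s (k, i) \<otimes>\<^bsub>G\<^esub> q) (s (l, i)) \<longleftrightarrow>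
      (\<forall>a<n. \<forall>b<n. (if b = i then M k $$ (a, l) else 0) = (if a = l then M k $$ (i, b) else 0))"
    if "k < n" "l < n" "k \<noteq> i" "l \<noteq> i" for k l
    using cm_gens[OF Mc[of k] that(2) i] that by (auto simp: M_def gens_el)
  have qyk: "(q * ?y) $$ (k, k) = 1" if "k < n" for k using y(2) that by simp
  show ?thesis
  proof
    assume rs: "rowst G n s i q"
    show "\<forall>l<n. l \<noteq> i \<longrightarrow> q $$ (i, l) = 0"
    proof (intro allI impI, rule ccontr)
      fix l assume l: "l < n" "l \<noteq> i" "q $$ (i, l) \<noteq> 0"
      have eq: "(if b = i then M l $$ (a, l) else 0) = (if a = l then M l $$ (i, b) else 0)" if "a < n" "b < n" for a b
        using rs cm[of l l] l that i unfolding rowst_def by blast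
      have y0: "?y $$ (a, l) = 0" if "a < n" "a \<noteq> l" for a
        using eq[OF that(1) i] M[of l a l] l that by auto
      have "?y $$ (l, l) = 0"
        using eq[OF l(1) i] M[of l i i] M[of l l l] l y0[OF i] i by auto
      then have "(q * ?y) $$ (l, l) = 0"
        using y0 by (intro trans[OF mult_entry[OF qc y(1) l(1) l(1)]] sum.neutral) (metis lessThan_iff mult_zero_right)
      then show False using qyk[OF l(1)] by simp
    qed
  next
    assume z: "\<forall>l<n. l \<noteq> i \<longrightarrow> q $$ (i, l) = 0"
    have e: "(q * ?y) $$ (i, k) = q $$ (i, i) * ?y $$ (i, k)" if "k < n" for k
      using z i that by (intro row_mult[OF qc y(1)]) auto
    have "q $$ (i, i) * ?y $$ (i, i) = 1" using e[OF i] y(2) i by simp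
    then have "q $$ (i, i) \<noteq> 0" by auto
    then have y0: "?y $$ (i, k) = 0" if "k < n" "k \<noteq> i" for k using e[OF that(1)] y(2) that i by simp
    show "rowst G n s i q"
      unfolding rowst_def
    proof (intro ballI impI)
      fix k l assume "k \<in> {..<n}" "l \<in> {..<n}" "k \<noteq> i \<and> l \<noteq> i"
      then have kl: "k < n" "l < n" "k \<noteq> i" "l \<noteq> i" by auto
      show "cm G (?y \<otimes>\<^bsub>G\<^esub> s (k, i) \<otimes>\<^bsub>G\<^esub> q) (s (l, i))"
        unfolding cm[OF kl] using M[OF kl(1)] i kl y0[OF kl(1,3)] z by auto
    qed
  qed
qed

end

section \<open>Matrix entries in the special linear group\<close>

definition ival :: "(nat \<Rightarrow> nat \<Rightarrow> int) \<Rightarrow> nat \<Rightarrow> nat \<Rightarrow> nat \<Rightarrow> nat \<Rightarrow> int" where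
  "ival f i k j l = f i j + (if k = i then 0 else f k j) + (if l = j then 0 else f i l)
     + (if k = i \<or> l = j then 0 else f k l)"

text \<open>Two entries of the same row or column fix each other's sign through the absolute value of their sum;
  entries in general position are linked by the sum of the four corners of a rectangle.\<close>

lemma equal_up_to_sign:
  assumes abs: "\<And>i k j l. i < n \<Longrightarrow> k < n \<Longrightarrow> j < n \<Longrightarrow> l < n \<Longrightarrow> \<bar>ival f i k j l\<bar> = \<bar>ival h i k j l\<bar>"
  shows "\<exists>\<epsilon>. \<bar>\<epsilon>\<bar> = 1 \<and> (\<forall>i<n. \<forall>j<n. h i j = \<epsilon> * f i j)"
proof (cases "\<forall>i<n. \<forall>j<n. f i j = 0")
  case True
  then have "h i j = 0" if "i < n" "j < n" for i j using abs[of i i j j] that by (simp add: ival_def)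
  then show ?thesis using True by (intro exI[of _ 1]) simp
next
  case False
  then obtain i0 j0 where 0: "i0 < n" "j0 < n" "f i0 j0 \<noteq> 0" by blast
  have one: "\<bar>f i j\<bar> = \<bar>h i j\<bar>" if "i < n" "j < n" for i j
    using abs[of i i j j] that by (simp add: ival_def)
  \<comment> \<open>The nonzero pivot fixes the sign: \<open>g\<close> below is \<open>h\<close>
    rescaled so as to agree with \<open>f\<close> at the pivot.\<close>
  define \<epsilon> where "\<epsilon> = (if h i0 j0 = f i0 j0 then 1 else - 1 :: int)"
  define g where "g i j = \<epsilon> * h i j" for i j
  have ee: "\<epsilon> * \<epsilon> = 1" "\<bar>\<epsilon>\<bar> = 1" by (auto simp: \<epsilon>_def)
  have g0: "g i0 j0 = f i0 j0" using one[OF 0(1,2)] by (auto simp: g_def \<epsilon>_def abs_eq_iff)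
  have ivalg: "\<bar>ival g i k j l\<bar> = \<bar>ival h i k j l\<bar>" for i k j l
  proof -
    have "ival g i k j l = \<epsilon> * ival h i k j l" by (simp add: ival_def g_def algebra_simps)
    then show ?thesis using ee by (simp add: abs_mult)
  qed
  have absg: "\<bar>ival f i k j l\<bar> = \<bar>ival g i k j l\<bar>" if "i < n" "k < n" "j < n" "l < n" for i k j l
    using abs that ivalg by simp
  have oneg: "\<bar>f i j\<bar> = \<bar>g i j\<bar>" if "i < n" "j < n" for i j
    using absg[of i i j j] that by (simp add: ival_def)
  \<comment> \<open>If a is nonzero, |b| = |b'| and |a + b| = |a + b'|, then b = b'.\<close>
  have row: "g i l = f i l" if "g i j = f i j" "f i j \<noteq> 0" "i < n" "j < n" "l < n" for i j l
    using absg[of i i j l] oneg[of i l] that by (cases "l = j") (auto simp: ival_def abs_eq_iff)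
  have col: "g k j = f k j" if "g i j = f i j" "f i j \<noteq> 0" "i < n" "j < n" "k < n" for i j k
    using absg[of i k j j] oneg[of k j] that by (cases "k = i") (auto simp: ival_def abs_eq_iff)
  have "g k l = f k l" if kl: "k < n" "l < n" for k l
  proof (cases "k = i0 \<or> l = j0 \<or> f i0 l \<noteq> 0 \<or> f k j0 \<noteq> 0")
    case True
    have r: "g i0 l = f i0 l" using row[OF g0 0(3,1,2) kl(2)] .
    have c: "g k j0 = f k j0" using col[OF g0 0(3,1,2) kl(1)] .
    show ?thesis using True r c row[OF c _ kl(1) 0(2) kl(2)] col[OF r _ 0(1) kl(2,1)] by auto
  next
    case False
    have r: "g i0 l = 0" using row[OF g0 0(3,1,2) kl(2)] False by simp
    have c: "g k j0 = 0" using col[OF g0 0(3,1,2) kl(1)] False by simp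
    \<comment> \<open>Both mixed corners vanish, so the rectangle compares the pivot plus
      \<open>f k l\<close> with the pivot plus \<open>g k l\<close>.\<close>
    show ?thesis using absg[of i0 k j0 l] oneg[OF kl] 0 kl False r c g0 by (auto simp: ival_def abs_eq_iff)
  qed
  moreover have "h i j = \<epsilon> * g i j" for i j using ee by (simp add: g_def mult.assoc[symmetric])
  ultimately show ?thesis using ee by (intro exI[of _ \<epsilon>]) simp
qed

context sl3
begin

lemma G_mult: "x \<in> carrier G \<Longrightarrow> y \<in> carrier G \<Longrightarrow> x * y \<in> carrier G"
  using monoid.m_closed[OF group.is_monoid[OF group_SL]] by fastforce

lemma G_assoc: "x \<in> carrier G \<Longrightarrow> y \<in> carrier G \<Longrightarrow> z \<in> carrier G \<Longrightarrow> x * y * z = x * (y * z)"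
  by (simp add: assoc_mult_mat[of _ n n _ n _ n])

text \<open>This is diag(-1, -1, 1, ..., 1). It lies in both stabilisers and conjugates e_02(c) to
  e_02(-c), so the sign of a code can be changed within a double coset.\<close>

definition flip :: "int mat" where
  "flip = evs n (negw 0 1)"

lemma flip: "flip \<in> carrier G" "flip \<in> carrier_mat n n"
  unfolding flip_def using evs_closed[OF negw_letters[of 0 n 1]] by auto

lemma flip_entry: "i < n \<Longrightarrow> j < n \<Longrightarrow> flip $$ (i, j) = (if i = j then if i < 2 then - 1 else 1 else 0)"
  using evs_negw[of "1\<^sub>m n" n 0 1 i j] flip by (auto simp: flip_def)

lemma flip_left: "x \<in> carrier_mat n n \<Longrightarrow> i < n \<Longrightarrow> j < n \<Longrightarrow>
    (flip * x) $$ (i, j) = (if i < 2 then - x $$ (i, j) else x $$ (i, j))"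
  by (subst row_mult[OF flip(2), of _ _ _ i]) (auto simp: flip_entry)

lemma flip_right: "x \<in> carrier_mat n n \<Longrightarrow> i < n \<Longrightarrow> j < n \<Longrightarrow>
    (x * flip) $$ (i, j) = (if j < 2 then - x $$ (i, j) else x $$ (i, j))"
  by (subst col_mult[OF _ flip(2), of _ _ _ j]) (auto simp: flip_entry)

lemma flip_e: "e c = flip * e (- c) * flip"
  using flip by (intro eq_matI) (auto simp: flip_left flip_right el_index simp del: index_mult_mat(1))

text \<open>Operations that fix column 2 are to turn row 0 into one with a unit at 0 and the old
  entry \<open>t\<close> at 2; then \<open>t\<close> can be cleared. The unit arises as the gcd of
  the row, which is 1 since the matrix is invertible. To let \<open>t\<close> take part without
  changing column 2, it is first copied into column 1, for which n >= 3 leaves room.\<close>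

lemma double_coset:
  assumes g: "g \<in> carrier G"
  shows "\<exists>q p c. q \<in> carrier G \<and> p \<in> carrier G \<and> rowst G n s 0 q \<and> colst G n s 2 p \<and>
    g = q * e c * p \<and> \<bar>c\<bar> = \<bar>g $$ (0, 2)\<bar>"
proof -
  let ?J = "{..<n} - {2}"
  have J: "?J \<subseteq> {..<n}" "0 \<in> ?J" "1 \<in> ?J" by auto
  have gc: "g \<in> carrier_mat n n" using g by simp
  define t where "t = g $$ (0, 2)"
  obtain v where v: "set v \<subseteq> lettersJ ?J" "\<And>j. j \<in> ?J \<Longrightarrow> j \<noteq> 0 \<Longrightarrow> (g * evs n v) $$ (0, j) = 0"
    using row_reduce[OF gc _ J(1,2), of 0] by auto
  have vl: "set v \<subseteq> letters n" using v(1) lettersJ[OF J(1)] by auto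
  define g1 where "g1 = g * evs n v"
  have g1: "g1 \<in> carrier G" "g1 \<in> carrier_mat n n" using G_mult[OF g evs_closed[OF vl]] by (auto simp: g1_def)
  have g1t: "g1 $$ (0, 2) = t" using evs_outside[OF gc J(1) v(1), of 0 2] by (simp add: g1_def t_def)
  define g2 where "g2 = g1 * el n 2 1 1"
  have g2: "g2 \<in> carrier G" "g2 \<in> carrier_mat n n" using G_mult[OF g1(1), of "el n 2 1 1"] by (auto simp: g2_def det_el)
  have g2e: "g2 $$ (0, b) = g1 $$ (0, b) + (if b = 1 then t else 0)" if "b < n" for b
    using mult_el[OF g1(2), of 2 0 b 1 1] that g1t by (simp add: g2_def del: index_mult_mat(1))
  obtain w where w: "set w \<subseteq> lettersJ ?J" "\<And>j. j \<in> ?J \<Longrightarrow> j \<noteq> 0 \<Longrightarrow> (g2 * evs n w) $$ (0, j) = 0"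
    using row_reduce[OF g2(2) _ J(1,2), of 0] by auto
  have wl: "set w \<subseteq> letters n" using w(1) lettersJ[OF J(1)] by auto
  define g3 where "g3 = g2 * evs n w"
  have g3: "g3 \<in> carrier G" "g3 \<in> carrier_mat n n" using G_mult[OF g2(1) evs_closed[OF wl]] by (auto simp: g3_def)
  have g3t: "g3 $$ (0, 2) = t" using evs_outside[OF g2(2) J(1) w(1), of 0 2] g2e[of 2] g1t by (simp add: g3_def)
  define d where "d = g3 $$ (0, 0)"
  \<comment> \<open>Undoing the operations shows that \<open>d\<close> divides row 0 of
    \<open>g2\<close> outside column 2, and the entry of \<open>g2\<close> in column 1 is
    \<open>t\<close>.\<close>
  have "set (winv w) \<subseteq> lettersJ ?J" using w(1) by (force simp: winv_def lettersJ_def)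
  moreover have "d dvd g3 $$ (0, j)" if "j \<in> ?J" for j using w(2)[OF that] by (cases "j = 0") (auto simp: d_def g3_def)
  ultimately have "d dvd (g3 * evs n (winv w)) $$ (0, j)" if "j \<in> ?J" for j
    using evs_dvd_row[OF g3(2) J(1)] that by simp
  moreover have "g3 * evs n (winv w) = g2"
  proof -
    have "g3 * evs n (winv w) = g2 * (evs n w * inv\<^bsub>G\<^esub> (evs n w))"
      unfolding g3_def evs_winv[OF wl]
      using evs_closed[OF wl] group.inv_closed[OF group_SL evs_closed[OF wl]] by (intro G_assoc g2)
    then show ?thesis using inv_SL(2)[OF evs_closed[OF wl]] g2 by simp
  qed
  ultimately have dg2: "d dvd g2 $$ (0, j)" if "j \<in> ?J" for j using that by simp
  have "g1 $$ (0, 1) = 0" using v(2)[OF J(3)] by (simp add: g1_def)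
  then have d0: "d dvd g1 $$ (0, 0)" "d dvd t" using dg2[OF J(2)] dg2[OF J(3)] g2e[of 0] g2e[of 1] by auto
  have "d dvd g1 $$ (0, k)" if "k < n" for k
    using v(2)[of k] d0 g1t that by (cases "k = 0 \<or> k = 2") (auto simp: g1_def)
  \<comment> \<open>A common divisor of row 0 divides the entry 1 of the product with the
    inverse.\<close>
  then have "d dvd (\<Sum>k<n. g1 $$ (0, k) * (inv\<^bsub>G\<^esub> g1) $$ (k, 0))" by (intro dvd_sum) auto
  also have "\<dots> = (g1 * inv\<^bsub>G\<^esub> g1) $$ (0, 0)" using g1 inv_SL(1)[OF g1(1)] by (intro mult_entry[symmetric]) auto
  finally have "d dvd 1" using inv_SL(2)[OF g1(1)] by simp
  then have d1: "\<bar>d\<bar> = 1" by simp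
  then have dd: "d * d = 1" by (auto simp: abs_if split: if_splits)
  define q where "q = g3 * e (- d * t)"
  have q: "q \<in> carrier G" using G_mult[OF g3(1) e_carrier(1)] by (simp add: q_def)
  have "q $$ (0, b) = 0" if "b < n" "b \<noteq> 0" for b
  proof -
    have "q $$ (0, b) = g3 $$ (0, b) + (if b = 2 then d * (- d * t) else 0)"
      using mult_el[OF g3(2), of 0 0 b 2 "- d * t"] that by (simp add: q_def d_def del: index_mult_mat(1))
    moreover have "d * (- d * t) = - t" using dd by (simp add: mult.assoc[symmetric])
    ultimately show ?thesis using w(2)[of b] g3t that by (cases "b = 2") (auto simp: g3_def)
  qed
  then have qr: "rowst G n s 0 q" using rowst_iff[OF q] by simp
  \<comment> \<open>The column operations together. They do not change column 2, so column 2 of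
    \<open>P\<close>, and then of its inverse, is a multiple of the unit vector.\<close>
  define P where "P = evs n v * el n 2 1 1 * evs n w"
  have parts: "evs n v \<in> carrier G" "el n 2 1 1 \<in> carrier G" "evs n w \<in> carrier G"
    using evs_closed vl wl by (auto simp: det_el)
  have P: "P \<in> carrier G" unfolding P_def by (intro G_mult parts)
  have Pc: "P \<in> carrier_mat n n" using P by simp
  have cv: "evs n u $$ (l, 2) = 0" if "set u \<subseteq> lettersJ ?J" "l < n" "l \<noteq> 2" for u l
  proof -
    have "set u \<subseteq> letters n" using that(1) lettersJ[OF J(1)] by blast
    then show ?thesis using evs_outside[of "1\<^sub>m n" n ?J u l 2] that evs_carrier[of u n] by simp
  qed
  have "(evs n v * el n 2 1 1) $$ (l, 2) = 0" if "l < n" "l \<noteq> 2" for l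
    using mult_el[of "evs n v" n 2 l 2 1 1] parts(1) cv[OF v(1) that] that by (simp del: index_mult_mat(1))
  then have Pz: "P $$ (l, 2) = 0" if "l < n" "l \<noteq> 2" for l
    unfolding P_def using that cv[OF w(1)] parts G_mult[OF parts(1,2)]
    by (subst col_mult[of _ n _ _ _ 2]) auto
  let ?p = "inv\<^bsub>G\<^esub> P"
  have p: "?p \<in> carrier G" "?p \<in> carrier_mat n n"
    using group.inv_closed[OF group_SL P] by auto
  have pP: "(?p * P) $$ (l, 2) = ?p $$ (l, 2) * P $$ (2, 2)" if "l < n" for l
    using Pz that by (intro col_mult[OF p(2) Pc]) auto
  have "?p $$ (2, 2) * P $$ (2, 2) = 1" using pP[of 2] inv_SL(3)[OF P] by simp
  then have "P $$ (2, 2) \<noteq> 0" by auto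
  then have "?p $$ (l, 2) = 0" if "l < n" "l \<noteq> 2" for l using pP[of l] inv_SL(3)[OF P] that by simp
  then have pc: "colst G n s 2 ?p" using colst_iff[OF p(1)] by simp
  have "g3 = g * P" unfolding g3_def g2_def g1_def P_def
    by (simp add: G_assoc G_mult g parts del: SL_simps(3))
  moreover have "g * P * ?p = g" using G_assoc[OF g P p(1)] inv_SL(2)[OF P] gc by simp
  moreover have "q * e (d * t) = g3"
  proof -
    have "q * e (d * t) = g3 * (e (- d * t) * e (d * t))" unfolding q_def by (intro G_assoc g3 e_carrier)
    also have "e (- d * t) * e (d * t) = 1\<^sub>m n" unfolding e_mult by (simp add: one_e)
    finally show ?thesis using g3 by simp
  qed
  ultimately have "g = q * e (d * t) * ?p" by simp
  moreover have "\<bar>d * t\<bar> = \<bar>g $$ (0, 2)\<bar>" using d1 by (simp add: abs_mult t_def)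
  ultimately show ?thesis using q p(1) qr pc by blast
qed

text \<open>The stabilisers multiply the entry at (0, 2) by units from either side. Conversely
  \<open>double_coset\<close> provides one of the two signs and \<open>flip\<close> the
  other.\<close>

lemma ent_iff:
  assumes g: "g \<in> carrier G"
  shows "ent G n s g u \<longleftrightarrow> (\<exists>c. u = e c \<and> \<bar>g $$ (0, 2)\<bar> = \<bar>c\<bar>)"
proof
  assume "ent G n s g u"
  then obtain c q p where u: "u = e c" and qp: "q \<in> carrier G" "p \<in> carrier G"
    "rowst G n s 0 q" "colst G n s 2 p" "g = q * e c * p"
    by (auto simp: ent_def num_iff)
  have cm: "q \<in> carrier_mat n n" "p \<in> carrier_mat n n" using qp by auto
  have q0: "q $$ (0, l) = 0" if "l < n" "l \<noteq> 0" for l using qp(3) rowst_iff[OF qp(1)] that by simp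
  have p0: "p $$ (l, 2) = 0" if "l < n" "l \<noteq> 2" for l using qp(4) colst_iff[OF qp(2)] that by simp
  have "(q * inv\<^bsub>G\<^esub> q) $$ (0, 0) = q $$ (0, 0) * (inv\<^bsub>G\<^esub> q) $$ (0, 0)"
    using q0 inv_SL(1)[OF qp(1)] cm by (intro row_mult) auto
  then have "q $$ (0, 0) * (inv\<^bsub>G\<^esub> q) $$ (0, 0) = 1" using inv_SL(2)[OF qp(1)] by simp
  then have aq: "\<bar>q $$ (0, 0)\<bar> = 1" using abs_one_if_mult by blast
  have "(inv\<^bsub>G\<^esub> p * p) $$ (2, 2) = (inv\<^bsub>G\<^esub> p) $$ (2, 2) * p $$ (2, 2)"
    using p0 inv_SL(1)[OF qp(2)] cm by (intro col_mult) auto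
  then have "(inv\<^bsub>G\<^esub> p) $$ (2, 2) * p $$ (2, 2) = 1" using inv_SL(3)[OF qp(2)] by simp
  then have ap: "\<bar>p $$ (2, 2)\<bar> = 1" using abs_one_if_mult by blast
  have qe: "q * e c \<in> carrier_mat n n" using cm by (auto intro!: mult_carrier_mat[of _ n n])
  have "g $$ (0, 2) = (q * e c) $$ (0, 2) * p $$ (2, 2)"
    unfolding qp(5) using p0 by (intro col_mult[OF qe cm(2)]) auto
  also have "(q * e c) $$ (0, 2) = q $$ (0, 0) * c"
    using mult_el[OF cm(1), of 0 0 2 2 c] q0[of 2] by (simp del: index_mult_mat(1))
  finally show "\<exists>c. u = e c \<and> \<bar>g $$ (0, 2)\<bar> = \<bar>c\<bar>" using u aq ap by (auto simp: abs_mult)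
next
  assume "\<exists>c. u = e c \<and> \<bar>g $$ (0, 2)\<bar> = \<bar>c\<bar>"
  then obtain c' where u: "u = e c'" "\<bar>g $$ (0, 2)\<bar> = \<bar>c'\<bar>" by blast
  obtain q p c where qp: "q \<in> carrier G" "p \<in> carrier G" "rowst G n s 0 q" "colst G n s 2 p"
    "g = q * e c * p" "\<bar>c\<bar> = \<bar>g $$ (0, 2)\<bar>" using double_coset[OF g] by blast
  show "ent G n s g u"
  proof (cases "c' = c")
    case True
    then show ?thesis using qp u unfolding ent_def num_iff SL_simps(1) by blast
  next
    case False
    then have c': "c' = - c" using u(2) qp(6) by (auto simp: abs_eq_iff)
    have cm: "q \<in> carrier_mat n n" "p \<in> carrier_mat n n" using qp by auto
    have q': "q * flip \<in> carrier G" and p': "flip * p \<in> carrier G" using G_mult flip(1) qp by auto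
    have "rowst G n s 0 (q * flip)"
      unfolding rowst_iff[OF q' idx(1)] using qp(3) rowst_iff[OF qp(1)] flip_right[OF cm(1)] by simp
    moreover have "colst G n s 2 (flip * p)"
      unfolding colst_iff[OF p' idx(4)] using qp(4) colst_iff[OF qp(2)] flip_left[OF cm(2)] by simp
    moreover have "g = (q * flip) * e c' * (flip * p)"
      unfolding qp(5) c' by (subst flip_e) (simp add: G_assoc G_mult flip(1) qp(1,2) e_carrier del: SL_simps(3))
    ultimately show ?thesis using q' p' u(1) unfolding ent_def num_iff SL_simps(1) by blast
  qed
qed

section \<open>Coded matrices and bounds on their entries\<close>

lemma one_G: "1\<^sub>m n \<in> carrier G"
  by simp

lemma rw_SL: "i < n \<Longrightarrow> rw G s i \<in> carrier G"
  by (auto simp: rw_def gens_el inv_el intro!: G_mult one_G el_SL simp del: SL_simps(3))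

lemma rw_row:
  assumes i: "i < n" and b: "b < n"
  shows "rw G s i $$ (0, b) = (if b = i then 1 else 0)"
proof (cases "i = 0")
  case True
  then show ?thesis using b by (simp add: rw_def)
next
  case False
  let ?X = "el n 0 i 1 * el n i 0 (- 1)"
  have X: "?X \<in> carrier_mat n n" by (intro mult_carrier_mat[of _ n n]) auto
  have Xe: "?X $$ (0, b) = (if b = i then 1 else 0)" if "b < n" for b
    using False that i by (auto simp: mult_el el_index simp del: index_mult_mat(1))
  have "rw G s i = ?X * el n 0 i 1" using False i by (simp add: rw_def gens_el inv_el)
  then show ?thesis using Xe[of 0] Xe[OF b] False b i mult_el[OF X, of 0 0 b i 1] by simp
qed

lemma cw_SL: "i < n \<Longrightarrow> cw G s i \<in> carrier G"
  by (auto simp: cw_def gens_el inv_el intro!: G_mult one_G el_SL simp del: SL_simps(3))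

lemma cw_col:
  assumes j: "j < n" and a: "a < n"
  shows "cw G s j $$ (a, 2) = (if a = j then 1 else 0)"
proof (cases "j = 2")
  case True
  then show ?thesis using a by (simp add: cw_def)
next
  case False
  let ?X = "el n j 2 1 * el n 2 j (- 1)"
  have X: "?X \<in> carrier_mat n n" by (intro mult_carrier_mat[of _ n n]) auto
  have Xe: "?X $$ (a, 2) = (if a = 2 then 1 else 0) + (if a = j then 1 else 0)"
    "?X $$ (a, j) = (if a = 2 then - 1 else 0)" if "a < n" for a
    using False that j by (auto simp: mult_el el_index simp del: index_mult_mat(1))
  have "cw G s j = ?X * el n j 2 1" using False j by (simp add: cw_def gens_el inv_el)
  then show ?thesis using Xe[OF a] False a j mult_el[OF X, of j a 2 2 1] by simp
qed

lemma tst_SL: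
  assumes "g \<in> carrier G" "i < n" "k < n" "j < n" "l < n"
  shows "tst G s i k j l g \<in> carrier G"
  using assms unfolding tst_def SL_simps(1,2)
  by (intro G_mult rw_SL cw_SL) (auto simp: gens_el det_el)

lemma tst_entry:
  assumes g: "g \<in> carrier G" and idx': "i < n" "k < n" "j < n" "l < n"
  shows "tst G s i k j l g $$ (0, 2) = ival (\<lambda>a b. g $$ (a, b)) i k j l"
proof -
  have gc: "g \<in> carrier_mat n n" using g by simp
  have Rc: "rw G s i \<in> carrier_mat n n" using rw_SL[OF idx'(1)] by simp
  define S where "S = (if k = i then 1\<^sub>m n else s (i, k))"
  have Sc: "S \<in> carrier_mat n n" by (auto simp: S_def gens_el)
  have X: "(rw G s i * S) $$ (0, b) = (if b = i then 1 else 0) + (if k \<noteq> i \<and> b = k then 1 else 0)" if "b < n" for b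
    using that idx' Rc rw_row[OF idx'(1)]
    by (auto simp: S_def gens_el mult_el simp del: index_mult_mat(1))
  have XG: "rw G s i * S \<in> carrier_mat n n" using Rc Sc by (intro mult_carrier_mat[of _ n n])
  have Y: "(rw G s i * S * g) $$ (0, b) = g $$ (i, b) + (if k = i then 0 else g $$ (k, b))" if "b < n" for b
  proof -
    have "(rw G s i * S * g) $$ (0, b) = (\<Sum>a<n. (rw G s i * S) $$ (0, a) * g $$ (a, b))"
      using that by (intro mult_entry XG gc) auto
    also have "\<dots> = (\<Sum>a<n. (if a = i then g $$ (i, b) else 0) + (if a = k then (if k = i then 0 else g $$ (k, b)) else 0))"
      using X by (intro sum.cong) auto
    finally show ?thesis using idx' by (simp add: sum.distrib)
  qed
  have YG: "rw G s i * S * g \<in> carrier_mat n n" by (rule mult_carrier_mat[OF XG gc])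
  define T where "T = (if l = j then 1\<^sub>m n else s (l, j))"
  have Tc: "T \<in> carrier_mat n n" by (auto simp: T_def gens_el)
  let ?Y = "rw G s i * S * g"
  have Z: "(?Y * T) $$ (0, b) = ?Y $$ (0, b) + (if l \<noteq> j \<and> b = j then ?Y $$ (0, l) else 0)" if "b < n" for b
    using that idx' YG by (auto simp: T_def gens_el mult_el simp del: index_mult_mat(1))
  have ZG: "?Y * T \<in> carrier_mat n n" by (rule mult_carrier_mat[OF YG Tc])
  have "(?Y * T * cw G s j) $$ (0, 2) = (?Y * T) $$ (0, j) * cw G s j $$ (j, 2)"
    using cw_col[OF idx'(3)] cw_SL[OF idx'(3)] idx'(3) ZG by (intro col_mult) auto
  also have "\<dots> = ?Y $$ (0, j) + (if l \<noteq> j then ?Y $$ (0, l) else 0)"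
    using cw_col[OF idx'(3)] Z[OF idx'(3)] idx'(3) by simp
  also have "\<dots> = ival (\<lambda>a b. g $$ (a, b)) i k j l"
    unfolding Y[OF idx'(3)] Y[OF idx'(4)] by (auto simp: ival_def)
  finally show ?thesis by (simp only: tst_def S_def T_def SL_simps(1,2))
qed

lemma val_e:
  assumes "\<And>i j. i < n \<Longrightarrow> j < n \<Longrightarrow> A (i, j) = e (a i j)" "i < n" "k < n" "j < n" "l < n"
  shows "val G A i k j l = e (ival a i k j l)"
  using assms by (auto simp: val_def ival_def one_e)

lemma repr_iff:
  assumes g: "g \<in> carrier G" and A: "\<forall>p\<in>{..<n} \<times> {..<n}. A p \<in> carrier G"
  shows "repr G n s g A \<longleftrightarrow> (\<exists>\<epsilon>. \<bar>\<epsilon>\<bar> = 1 \<and> (\<forall>i<n. \<forall>j<n. A (i, j) = e (\<epsilon> * g $$ (i, j))))"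
proof
  assume r: "repr G n s g A"
  have ent: "\<exists>c. val G A i k j l = e c \<and> \<bar>ival (\<lambda>a b. g $$ (a, b)) i k j l\<bar> = \<bar>c\<bar>"
    if "i < n" "k < n" "j < n" "l < n" for i k j l
  proof -
    have "ent G n s (tst G s i k j l g) (val G A i k j l)" using r that unfolding repr_def by blast
    then show ?thesis using ent_iff[OF tst_SL[OF g that]] tst_entry[OF g that] by simp
  qed
  \<comment> \<open>Degenerate rectangles consist of a single entry, so every component of
    \<open>A\<close> is a code.\<close>
  have "\<exists>c. A (i, j) = e c" if "i < n" "j < n" for i j
  proof -
    have "A (i, j) \<in> carrier_mat n n" using A that by auto
    then have "val G A i i j j = A (i, j)" by (simp add: val_def)
    then show ?thesis using ent[of i i j j] that by auto
  qed
  then obtain a where a: "\<And>i j. i < n \<Longrightarrow> j < n \<Longrightarrow> A (i, j) = e (a i j)" by metis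
  have "\<bar>ival (\<lambda>a b. g $$ (a, b)) i k j l\<bar> = \<bar>ival a i k j l\<bar>" if "i < n" "k < n" "j < n" "l < n" for i k j l
    using ent[OF that] val_e[of A a, OF a that] by auto
  then obtain \<epsilon> where "\<bar>\<epsilon>\<bar> = 1" "\<forall>i<n. \<forall>j<n. a i j = \<epsilon> * g $$ (i, j)"
    using equal_up_to_sign[of n "\<lambda>a b. g $$ (a, b)" a] by blast
  then show "\<exists>\<epsilon>. \<bar>\<epsilon>\<bar> = 1 \<and> (\<forall>i<n. \<forall>j<n. A (i, j) = e (\<epsilon> * g $$ (i, j)))" using a by auto
next
  assume "\<exists>\<epsilon>. \<bar>\<epsilon>\<bar> = 1 \<and> (\<forall>i<n. \<forall>j<n. A (i, j) = e (\<epsilon> * g $$ (i, j)))"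
  then obtain \<epsilon> where \<epsilon>: "\<bar>\<epsilon>\<bar> = 1" "\<And>i j. i < n \<Longrightarrow> j < n \<Longrightarrow> A (i, j) = e (\<epsilon> * g $$ (i, j))" by blast
  have iv: "ival (\<lambda>a b. \<epsilon> * g $$ (a, b)) i k j l = \<epsilon> * ival (\<lambda>a b. g $$ (a, b)) i k j l" for i k j l
    by (simp add: ival_def algebra_simps)
  have "ent G n s (tst G s i k j l g) (val G A i k j l)" if "i < n" "k < n" "j < n" "l < n" for i k j l
    using ent_iff[OF tst_SL[OF g that]] tst_entry[OF g that]
      val_e[of A "\<lambda>a b. \<epsilon> * g $$ (a, b)", OF \<epsilon>(2) that] \<epsilon>(1) by (simp add: iv abs_mult)
  then show "repr G n s g A" by (simp add: repr_def)
qed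

lemma bd_iff:
  assumes g: "g \<in> carrier G"
  shows "bd G n s g d \<longleftrightarrow> (\<exists>b. d = e b \<and> (\<forall>i<n. \<forall>j<n. \<bar>g $$ (i, j)\<bar> \<le> b))"
proof
  assume "bd G n s g d"
  then obtain A where A: "\<forall>p\<in>{..<n} \<times> {..<n}. A p \<in> carrier G" "repr G n s g A"
    "\<forall>i\<in>{..<n}. \<forall>j\<in>{..<n}. le G n s (inv\<^bsub>G\<^esub> d) (A (i, j)) \<and> le G n s (A (i, j)) d"
    unfolding bd_def by blast
  obtain \<epsilon> where \<epsilon>: "\<bar>\<epsilon>\<bar> = 1" "\<forall>i<n. \<forall>j<n. A (i, j) = e (\<epsilon> * g $$ (i, j))"
    using repr_iff[OF g A(1)] A(2) by blast
  obtain b where b: "d = e b" using A(3) le_iff by (metis idx(1) lessThan_iff)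
  have "\<bar>g $$ (i, j)\<bar> \<le> b" if "i < n" "j < n" for i j
  proof -
    have "le G n s (e (- b)) (A (i, j))" "le G n s (A (i, j)) (e b)" using A(3) that by (auto simp: b)
    then have "- b \<le> \<epsilon> * g $$ (i, j)" "\<epsilon> * g $$ (i, j) \<le> b" using \<epsilon>(2) that by (auto simp: le_iff)
    then have "\<bar>\<epsilon> * g $$ (i, j)\<bar> \<le> b" by linarith
    then show ?thesis using \<epsilon>(1) by (simp add: abs_mult)
  qed
  then show "\<exists>b. d = e b \<and> (\<forall>i<n. \<forall>j<n. \<bar>g $$ (i, j)\<bar> \<le> b)" using b by blast
next
  assume "\<exists>b. d = e b \<and> (\<forall>i<n. \<forall>j<n. \<bar>g $$ (i, j)\<bar> \<le> b)"
  then obtain b where b: "d = e b" "\<And>i j. i < n \<Longrightarrow> j < n \<Longrightarrow> \<bar>g $$ (i, j)\<bar> \<le> b" by blast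
  define A where "A = (\<lambda>p. e (g $$ p))"
  have A: "\<forall>p\<in>{..<n} \<times> {..<n}. A p \<in> carrier G" by (auto simp: A_def det_el)
  have "repr G n s g A" using repr_iff[OF g A] by (simp add: A_def) (metis abs_1 mult_1)
  moreover have "le G n s (inv\<^bsub>G\<^esub> d) (A (i, j)) \<and> le G n s (A (i, j)) d" if "i < n" "j < n" for i j
    using b(2)[OF that] by (auto simp: le_iff A_def b(1))
  ultimately show "bd G n s g d" using A unfolding bd_def by blast
qed

section \<open>Verification of the axioms on order, products, growth and bounds\<close>

lemma ord_ax_SL: "ord_ax G n s"
  unfolding ord_ax_def
proof (intro conjI ballI impI)
  fix u v assume "num G n s u \<and> num G n s v"
  then obtain a b where "u = e a" "v = e b" unfolding num_iff by blast
  then show "\<exists>w\<in>carrier G. le G n s u w \<and> le G n s v w"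
    by (intro bexI[of _ "e (max a b)"]) (auto simp: le_iff det_el)
qed (auto simp: le_iff nn_iff num_iff s02 one_e add.commute)

lemma mul_ax_SL: "mul_ax G n s"
  unfolding mul_ax_def
proof (intro conjI ballI impI)
  fix u v assume "num G n s u \<and> num G n s v"
  then obtain a b where "u = e a" "v = e b" unfolding num_iff by blast
  then show "\<exists>w\<in>carrier G. num G n s w \<and> mulr G n s u v w"
    by (intro bexI[of _ "e (a * b)"]) (auto simp: num_iff mulr_iff det_el)
next
  fix c a b x y assume "nn G n s c \<and> le G n s a b \<and> mulr G n s c a x \<and> mulr G n s c b y"
  then show "le G n s x y" by (auto simp: nn_iff le_iff mulr_iff mult_left_mono)
next
  fix c d y assume "le G n s (s (0, 2) \<otimes>\<^bsub>G\<^esub> s (0, 2)) c \<and> le G n s (s (0, 2)) d \<and> mulr G n s c d y"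
  then obtain c' d' where cd: "2 \<le> c'" "1 \<le> d'" "d = e d'" "y = e (c' * d')"
    by (auto simp: le_iff mulr_iff s02)
  have "1 \<le> c' * d'" using mult_mono[of 1 c' 1 d'] cd by simp
  then show "le G n s (s (0, 2)) y" using cd by (simp add: le_iff s02)
  have "\<not> c' * d' \<le> d'" using mult_right_mono[of 2 c' d'] cd by simp
  then show "\<not> le G n s y d" using cd by (simp add: le_iff)
qed

lemma big_iff:
  "big G n s (e c) (e k) (e x) \<longleftrightarrow>
    (\<exists>N\<ge>c. 1 \<le> x \<and> (\<forall>i. 1 \<le> i \<and> i \<le> k \<longrightarrow> i dvd N \<and> 1 + i * N dvd x))"
proof -
  have *: "(\<exists>w\<in>carrier G. mulr G n s (e i) w (e N)) \<and>
      (\<exists>v\<in>carrier G. \<exists>w\<in>carrier G. mulr G n s (e i) (e N) v \<and> mulr G n s (s (0, 2) \<otimes>\<^bsub>G\<^esub> v) w (e x))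
    \<longleftrightarrow> i dvd N \<and> 1 + i * N dvd x" for i N
    unfolding mulr_iff s02 dvd_def by (auto simp: det_el)
  show ?thesis
    unfolding big_def
  proof
    assume "\<exists>N\<in>carrier G. le G n s (e c) N \<and> le G n s (s (0, 2)) (e x) \<and>
      (\<forall>i\<in>carrier G. le G n s (s (0, 2)) i \<and> le G n s i (e k) \<longrightarrow>
        (\<exists>w\<in>carrier G. mulr G n s i w N) \<and>
        (\<exists>v\<in>carrier G. \<exists>w\<in>carrier G. mulr G n s i N v \<and> mulr G n s (s (0, 2) \<otimes>\<^bsub>G\<^esub> v) w (e x)))"
    then obtain N where N: "c \<le> N" "1 \<le> x"
      "\<forall>i\<in>carrier G. le G n s (s (0, 2)) i \<and> le G n s i (e k) \<longrightarrow>
        (\<exists>w\<in>carrier G. mulr G n s i w (e N)) \<and>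
        (\<exists>v\<in>carrier G. \<exists>w\<in>carrier G. mulr G n s i (e N) v \<and> mulr G n s (s (0, 2) \<otimes>\<^bsub>G\<^esub> v) w (e x))"
      by (auto simp: le_iff s02)
    have "i dvd N \<and> 1 + i * N dvd x" if "1 \<le> i" "i \<le> k" for i
    proof -
      have "le G n s (s (0, 2)) (e i) \<and> le G n s (e i) (e k)" using that by (simp add: le_iff s02)
      then show ?thesis using N(3) e_carrier(1)[of i] * by blast
    qed
    then show "\<exists>N\<ge>c. 1 \<le> x \<and> (\<forall>i. 1 \<le> i \<and> i \<le> k \<longrightarrow> i dvd N \<and> 1 + i * N dvd x)" using N by blast
  next
    assume "\<exists>N\<ge>c. 1 \<le> x \<and> (\<forall>i. 1 \<le> i \<and> i \<le> k \<longrightarrow> i dvd N \<and> 1 + i * N dvd x)"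
    then obtain N where N: "c \<le> N" "1 \<le> x" "\<And>i. 1 \<le> i \<Longrightarrow> i \<le> k \<Longrightarrow> i dvd N \<and> 1 + i * N dvd x" by blast
    show "\<exists>N\<in>carrier G. le G n s (e c) N \<and> le G n s (s (0, 2)) (e x) \<and>
      (\<forall>i\<in>carrier G. le G n s (s (0, 2)) i \<and> le G n s i (e k) \<longrightarrow>
        (\<exists>w\<in>carrier G. mulr G n s i w N) \<and>
        (\<exists>v\<in>carrier G. \<exists>w\<in>carrier G. mulr G n s i N v \<and> mulr G n s (s (0, 2) \<otimes>\<^bsub>G\<^esub> v) w (e x)))"
    proof (intro bexI[of _ "e N"] conjI[of "le G n s (e c) (e N)"] conjI[of "le G n s (s (0, 2)) (e x)"] ballI impI)
      show "le G n s (e c) (e N)" "le G n s (s (0, 2)) (e x)" using N by (simp_all add: le_iff s02)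
      fix i assume "le G n s (s (0, 2)) i \<and> le G n s i (e k)"
      then obtain i' where "i = e i'" "1 \<le> i'" "i' \<le> k" by (auto simp: le_iff s02)
      then show "(\<exists>w\<in>carrier G. mulr G n s i w (e N)) \<and>
        (\<exists>v\<in>carrier G. \<exists>w\<in>carrier G. mulr G n s i (e N) v \<and> mulr G n s (s (0, 2) \<otimes>\<^bsub>G\<^esub> v) w (e x))"
        using N(3) * by blast
    qed (rule e_carrier)
  qed
qed

lemma big_exists:
  assumes "1 \<le> c"
  shows "\<exists>x. big G n s (e c) (e c) (e x)"
proof -
  \<comment> \<open>\<open>f\<close> is the factorial of \<open>c\<close>, so \<open>c * f\<close>
    is at least \<open>c\<close> and divisible by all \<open>i \<le> c\<close>.\<close>
  define f :: int where "f = (\<Prod>i\<in>{1..c}. i)"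
  have f1: "1 \<le> f" unfolding f_def by (rule prod_ge_1) simp
  define N where "N = c * f"
  have N: "c \<le> N" using mult_left_mono[OF f1, of c] assms by (simp add: N_def)
  have dN: "i dvd N" if "1 \<le> i" "i \<le> c" for i
    using that unfolding N_def f_def by (intro dvd_mult dvd_prodI) auto
  define x where "x = (\<Prod>i\<in>{1..c}. 1 + i * N)"
  have "1 \<le> x" unfolding x_def using N assms by (intro prod_ge_1) (simp add: mult_nonneg_nonneg)
  moreover have "1 + i * N dvd x" if "1 \<le> i" "i \<le> c" for i
    using that unfolding x_def by (intro dvd_prodI) auto
  ultimately show ?thesis using N dN unfolding big_iff by blast
qed

text \<open>Dividing \<open>x\<close> by the factor 1 + k N, which is at least c, leaves a number
  that is still divisible by the other factors, as they are coprime to it.\<close>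

lemma big_step:
  assumes c: "1 \<le> c" and k: "1 \<le> k" and b: "big G n s (e c) (e k) (e x)"
  shows "\<exists>x'. big G n s (e c) (e (k - 1)) (e x') \<and> c * x' \<le> x"
proof -
  obtain N where N: "c \<le> N" "1 \<le> x" "\<And>i. 1 \<le> i \<Longrightarrow> i \<le> k \<Longrightarrow> i dvd N \<and> 1 + i * N dvd x"
    using b unfolding big_iff by blast
  obtain x' where x': "x = (1 + k * N) * x'" using N(3)[of k] k by (auto simp: dvd_def)
  have kN: "N \<le> k * N" using mult_right_mono[OF k, of N] N(1) c by simp
  then have pos: "0 < 1 + k * N" using N(1) c by linarith
  have "0 < (1 + k * N) * x'" using N(2) x' by simp
  then have x1: "1 \<le> x'" using pos by (simp add: zero_less_mult_iff)
  have "1 + i * N dvd x'" if i: "1 \<le> i" "i \<le> k - 1" for i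
  proof -
    have "coprime (1 + i * N) (1 + k * N)"
    proof (rule coprimeI)
      fix d assume d: "d dvd 1 + i * N" "d dvd 1 + k * N"
      \<comment> \<open>A common divisor divides k - i, hence N, and then 1.\<close>
      have "k * (1 + i * N) - i * (1 + k * N) = k - i" by (simp add: algebra_simps)
      then have "d dvd k - i" using d by (metis dvd_diff dvd_mult)
      moreover have "k - i dvd N" using N(3)[of "k - i"] i by auto
      ultimately have "d dvd i * N" by (metis dvd_mult dvd_trans)
      then show "d dvd 1" using d(1) dvd_add_left_iff by blast
    qed
    moreover have "1 + i * N dvd (1 + k * N) * x'" using N(3)[of i] i x' by auto
    ultimately show ?thesis by (simp add: coprime_dvd_mult_right_iff)
  qed
  then have "big G n s (e c) (e (k - 1)) (e x')" unfolding big_iff using N x1 by (intro exI[of _ N]) auto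
  moreover have "c * x' \<le> (1 + k * N) * x'" using kN N(1) x1 by (intro mult_right_mono) auto
  ultimately show ?thesis using x' by auto
qed

lemma big_ax_SL: "big_ax G n s"
  unfolding big_ax_def
proof (intro conjI ballI impI)
  fix c assume "le G n s (s (0, 2)) c"
  then obtain c' where c: "c = e c'" "1 \<le> c'" by (auto simp: le_iff s02)
  then obtain x where "big G n s c c (e x)" using big_exists by blast
  then show "\<exists>x\<in>carrier G. big G n s c c x" using e_carrier(1) by blast
next
  fix c k x assume x: "x \<in> carrier G" and "le G n s (s (0, 2)) c \<and> le G n s (s (0, 2)) k \<and> big G n s c k x"
  then obtain c' k' where ck: "c = e c'" "k = e k'" "1 \<le> c'" "1 \<le> k'" "big G n s c k x"
    by (auto simp: le_iff s02)
  moreover obtain x0 where x0: "x = e x0" using ck(5) unfolding big_def le_iff by blast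
  ultimately obtain x' where x': "big G n s (e c') (e (k' - 1)) (e x')" "c' * x' \<le> x0" using big_step by blast
  have "k \<otimes>\<^bsub>G\<^esub> inv\<^bsub>G\<^esub> (s (0, 2)) = e (k' - 1)" using ck(2) by (simp add: s02)
  moreover have "mulr G n s c (e x') (e (c' * x'))" "le G n s (e (c' * x')) x"
    using ck(1) x0 x'(2) by (auto simp: mulr_iff le_iff)
  ultimately show "\<exists>x'\<in>carrier G. \<exists>y\<in>carrier G. big G n s c (k \<otimes>\<^bsub>G\<^esub> inv\<^bsub>G\<^esub> (s (0, 2))) x' \<and>
      mulr G n s c x' y \<and> le G n s y x"
    using x'(1) ck(1) e_carrier(1) by metis
next
  fix c k x assume "big G n s c k x"
  then show "le G n s (s (0, 2)) x" unfolding big_def by blast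
qed

lemma e_pow: "e c [^]\<^bsub>G\<^esub> (m::nat) = e (int m * c)"
proof (induction m)
  case 0
  then show ?case by (simp add: one_e)
next
  case (Suc m)
  then show ?case by (simp add: algebra_simps)
qed

lemma bd_ax_SL: "bd_ax G n s"
  unfolding bd_ax_def
proof (intro conjI ballI impI)
  show "bd G n s \<one>\<^bsub>G\<^esub> (s (0, 2))" unfolding bd_iff[OF monoid.one_closed[OF group.is_monoid[OF group_SL]]]
    by (auto simp: s02)
next
  fix g assume g: "g \<in> carrier G"
  define b where "b = (\<Sum>i<n. \<Sum>j<n. \<bar>g $$ (i, j)\<bar>)"
  have "\<bar>g $$ (i, j)\<bar> \<le> b" if "i < n" "j < n" for i j
  proof -
    have "\<bar>g $$ (i, j)\<bar> \<le> (\<Sum>j<n. \<bar>g $$ (i, j)\<bar>)" using that by (intro member_le_sum[of j]) auto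
    also have "\<dots> \<le> b" unfolding b_def
      using that by (intro member_le_sum[of i _ "\<lambda>i. \<Sum>j<n. \<bar>g $$ (i, j)\<bar>"]) (auto intro: sum_nonneg)
    finally show ?thesis .
  qed
  then show "\<exists>d\<in>carrier G. num G n s d \<and> bd G n s g d"
    by (intro bexI[of _ "e b"]) (auto simp: bd_iff[OF g] num_iff det_el)
next
  fix g d d' assume g: "g \<in> carrier G" "bd G n s g d \<and> le G n s d d'"
  then show "bd G n s g d'" unfolding bd_iff[OF g(1)] le_iff by force
next
  fix g g' c d x y
  assume g: "g \<in> carrier G" "g' \<in> carrier G"
    and h: "bd G n s g d \<and> bd G n s g' c \<and> le G n s (s (0, 2) [^]\<^bsub>G\<^esub> n) c \<and> mulr G n s c d x \<and> mulr G n s c x y"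
  obtain D where D: "d = e D" "\<And>i j. i < n \<Longrightarrow> j < n \<Longrightarrow> \<bar>g $$ (i, j)\<bar> \<le> D" using h bd_iff[OF g(1)] by blast
  obtain C where C: "c = e C" "\<And>i j. i < n \<Longrightarrow> j < n \<Longrightarrow> \<bar>g' $$ (i, j)\<bar> \<le> C" using h bd_iff[OF g(2)] by blast
  have nC: "int n \<le> C" using h by (auto simp: le_iff s02 e_pow C(1))
  have y: "y = e (C * (C * D))" using h by (auto simp: mulr_iff C(1) D(1))
  have D0: "0 \<le> D" "0 \<le> C" using D(2)[of 0 0] C(2)[of 0 0] by auto
  have "\<bar>(g * g') $$ (i, j)\<bar> \<le> C * (C * D)" if "i < n" "j < n" for i j
  proof -
    have "\<bar>(g * g') $$ (i, j)\<bar> = \<bar>\<Sum>k<n. g $$ (i, k) * g' $$ (k, j)\<bar>" using g that by (subst mult_entry[of _ n]) auto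
    also have "\<dots> \<le> (\<Sum>k<n. \<bar>g $$ (i, k) * g' $$ (k, j)\<bar>)" by (rule sum_abs)
    also have "\<dots> \<le> (\<Sum>k<n. D * C)" using D(2) C(2) that D0 by (intro sum_mono) (simp add: abs_mult mult_mono)
    also have "\<dots> = int n * (C * D)" by simp
    also have "\<dots> \<le> C * (C * D)" using nC D0 by (intro mult_right_mono) auto
    finally show ?thesis .
  qed
  then show "bd G n s (g \<otimes>\<^bsub>G\<^esub> g') y" using bd_iff[OF G_mult[OF g]] y by auto
next
  fix u d assume u: "u \<in> carrier G" "num G n s u \<and> bd G n s u d"
  then obtain a b where ab: "u = e a" "d = e b" "\<And>i j. i < n \<Longrightarrow> j < n \<Longrightarrow> \<bar>u $$ (i, j)\<bar> \<le> b"
    unfolding bd_iff[OF u(1)] num_iff by blast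
  then show "le G n s u d" using ab(3)[of 0 2] by (auto simp: le_iff el_index)
qed

end

section \<open>The congruence subgroup of level three\<close>

context group
begin

lemma sqs_closed: "(\<And>i. i < k \<Longrightarrow> x i \<in> carrier G) \<Longrightarrow> sqs G x k \<in> carrier G"
  by (induction k) auto

lemma sqs_cong: "(\<And>i. i < k \<Longrightarrow> x i = y i) \<Longrightarrow> sqs G x k = sqs G y k"
  by (induction k) auto

lemma sqs_append:
  assumes "\<And>i. x i \<in> carrier G" "\<And>i. y i \<in> carrier G"
  shows "sqs G (\<lambda>i. if i < k then x i else y (i - k)) (k + l) = sqs G x k \<otimes> sqs G y l"
proof (induction l)
  case 0
  have "sqs G (\<lambda>i. if i < k then x i else y (i - k)) k = sqs G x k" by (rule sqs_cong) simp
  then show ?case using assms by (simp add: sqs_closed)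
next
  case (Suc l)
  then show ?case using assms by (simp add: sqs_closed m_assoc)
qed

lemma generate_squares:
  assumes N: "subgroup N G" and m: "m \<in> generate G ((\<lambda>x. x \<otimes> x) ` N)"
  shows "\<exists>k x. (\<forall>i. x i \<in> N) \<and> m = sqs G x k"
  using m
proof (induction rule: generate.induct)
  case one
  show ?case by (rule exI[of _ 0], rule exI[of _ "\<lambda>_. \<one>"]) (simp add: subgroup.one_closed[OF N])
next
  case (incl h)
  then obtain y where "y \<in> N" "h = y \<otimes> y" by auto
  then show ?case using subgroup.mem_carrier[OF N]
    by (intro exI[of _ 1] exI[of _ "\<lambda>_. y"]) simp
next
  case (inv h)
  then obtain y where "y \<in> N" "h = y \<otimes> y" by auto
  then show ?case using subgroup.mem_carrier[OF N] subgroup.m_inv_closed[OF N]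
    by (intro exI[of _ 1] exI[of _ "\<lambda>_. inv y"]) (simp add: inv_mult_group)
next
  case (eng h1 h2)
  then obtain k x l y where "\<And>i. x i \<in> N" "h1 = sqs G x k" "\<And>i. y i \<in> N" "h2 = sqs G y l" by blast
  then show ?case using subgroup.mem_carrier[OF N]
    by (intro exI[of _ "k + l"] exI[of _ "\<lambda>i. if i < k then x i else y (i - k)"]) (simp add: sqs_append)
qed

text \<open>Serves to bring products of squares to a common length.\<close>

lemma sqs_pad:
  assumes "\<And>i. x i \<in> carrier G"
  shows "sqs G (\<lambda>i. if i < k then x i else \<one>) (k + l) = sqs G x k"
proof -
  have "sqs G (\<lambda>_. \<one>) l = \<one>" by (induction l) auto
  then show ?thesis using sqs_append[of x "\<lambda>_. \<one>" k l] assms by (simp add: sqs_closed)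
qed

end

context sl3
begin

lemma proportional:
  assumes "g \<in> carrier G" "h \<in> carrier G" "\<bar>\<epsilon>\<bar> = 1" "\<bar>\<epsilon>'\<bar> = 1"
    "\<And>i j. i < n \<Longrightarrow> j < n \<Longrightarrow> \<epsilon> * g $$ (i, j) = \<epsilon>' * h $$ (i, j)"
  shows "g = (\<epsilon> * \<epsilon>') \<cdot>\<^sub>m h"
proof (rule eq_matI)
  have hc: "h \<in> carrier_mat n n" using assms(2) by simp
  have ee: "\<epsilon> * \<epsilon> = 1" using assms(3) by (auto simp: abs_if split: if_splits)
  fix i j assume "i < dim_row ((\<epsilon> * \<epsilon>') \<cdot>\<^sub>m h)" "j < dim_col ((\<epsilon> * \<epsilon>') \<cdot>\<^sub>m h)"
  then have ij: "i < n" "j < n" using assms(2) by auto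
  have "\<epsilon> * (\<epsilon> * g $$ (i, j)) = \<epsilon> * (\<epsilon>' * h $$ (i, j))" using assms(5)[OF ij] by simp
  then show "g $$ (i, j) = ((\<epsilon> * \<epsilon>') \<cdot>\<^sub>m h) $$ (i, j)"
    using ij hc ee by (simp add: mult.assoc[symmetric])
qed (use assms in auto)

lemma cen_scalar:
  assumes "g \<in> carrier G" "g = \<mu> \<cdot>\<^sub>m 1\<^sub>m n"
  shows "cen G g"
  unfolding cen_def cm_def
proof
  fix x assume "x \<in> carrier G"
  then have x: "x \<in> carrier_mat n n" by simp
  show "g \<otimes>\<^bsub>G\<^esub> x = x \<otimes>\<^bsub>G\<^esub> g"
    unfolding assms(2) using x by (simp add: mult_smult_assoc_mat[of _ n n _ n] mult_smult_distrib[of _ n n _ n])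
qed

lemma cenD:
  assumes g: "g \<in> carrier G" "cen G g"
  shows "\<exists>\<mu>. \<bar>\<mu>\<bar> = 1 \<and> g = \<mu> \<cdot>\<^sub>m 1\<^sub>m n"
proof -
  have gc: "g \<in> carrier_mat n n" using g by simp
  have ent: "(if b = l then g $$ (a, k) else 0) = (if a = k then g $$ (l, b) else 0)"
    if "k < n" "l < n" "k \<noteq> l" "a < n" "b < n" for k l a b
    using g(2) gens_closed that cm_gens[OF gc that(1-3)] unfolding cen_def by blast
  have off: "g $$ (a, k) = 0" if "a < n" "k < n" "a \<noteq> k" for a k
  proof -
    obtain l where "l < n" "l \<noteq> k" using idx(1,3) by (metis zero_neq_one)
    then show ?thesis using ent[of k l a l] that by simp
  qed
  define \<mu> where "\<mu> = g $$ (0, 0)"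
  have diag: "g $$ (l, l) = \<mu>" if "l < n" for l
    using ent[of 0 l 0 l] that by (cases "l = 0") (auto simp: \<mu>_def)
  have "(g * inv\<^bsub>G\<^esub> g) $$ (0, 0) = \<mu> * (inv\<^bsub>G\<^esub> g) $$ (0, 0)"
    unfolding \<mu>_def using off inv_SL(1)[OF g(1)] gc by (intro row_mult) auto
  then have "\<mu> * (inv\<^bsub>G\<^esub> g) $$ (0, 0) = 1" using inv_SL(2)[OF g(1)] by simp
  then have "\<bar>\<mu>\<bar> = 1" using abs_one_if_mult by blast
  moreover have "g = \<mu> \<cdot>\<^sub>m 1\<^sub>m n" using gc off diag by (intro eq_matI) auto
  ultimately show ?thesis by blast
qed

lemma lower_triangular_SL:
  assumes g: "g \<in> carrier G" and low: "\<And>i j. i < n \<Longrightarrow> j < n \<Longrightarrow> i < j \<Longrightarrow> g $$ (i, j) = 0" and i: "i < n"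
  shows "\<bar>g $$ (i, i)\<bar> = 1"
proof -
  have "(\<Prod>i<n. g $$ (i, i)) = 1" using det_diagonal_signs[of g n] low g by simp
  then show ?thesis using abs_prod_one[of "\<lambda>i. g $$ (i, i)"] i by blast
qed

lemma abs_one_cases: "\<bar>a\<bar> = (1::int) \<Longrightarrow> a = 1 \<or> a = - 1"
  by linarith

lemma repr_ax_SL:
  assumes D: "\<And>g. g \<in> carrier G \<Longrightarrow> \<forall>i<n. \<forall>j<n. i \<noteq> j \<longrightarrow> g $$ (i, j) = 0 \<Longrightarrow> \<exists>v\<in>D. g = evs n v"
  shows "repr_ax G n D s"
proof -
  have A1: "repr G n s \<one>\<^bsub>G\<^esub> (idm G s)"
  proof -
    have "\<forall>p\<in>{..<n} \<times> {..<n}. idm G s p \<in> carrier G" by (auto simp: idm_def s02 det_el)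
    then show ?thesis using repr_iff[of "1\<^sub>m n" "idm G s"]
      by (auto simp: idm_def s02 one_e[symmetric] intro!: exI[of _ 1])
  qed
  have A7: "\<exists>A. (\<forall>p\<in>{..<n} \<times> {..<n}. A p \<in> carrier G) \<and> repr G n s g A" if g: "g \<in> carrier G" for g
  proof (intro exI conjI)
    show A: "\<forall>p\<in>{..<n} \<times> {..<n}. e (g $$ p) \<in> carrier G" by (simp add: det_el)
    show "repr G n s g (\<lambda>p. e (g $$ p))" unfolding repr_iff[OF g A] by (metis abs_1 mult_1)
  qed
  {
    fix A g
    assume A: "\<forall>p\<in>{..<n} \<times> {..<n}. A p \<in> carrier G" and g: "g \<in> carrier G" and r: "repr G n s g A"
    obtain \<epsilon> where \<epsilon>: "\<bar>\<epsilon>\<bar> = 1" "\<And>i j. i < n \<Longrightarrow> j < n \<Longrightarrow> A (i, j) = e (\<epsilon> * g $$ (i, j))"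
      using r repr_iff[OF g A] by blast
    have gc: "g \<in> carrier_mat n n" using g by simp
    have zero: "g $$ (i, j) = 0" if "A (i, j) = \<one>\<^bsub>G\<^esub>" "i < n" "j < n" for i j
      using that \<epsilon> by (auto simp: one_e)
    have A2: "repr G n s (g \<otimes>\<^bsub>G\<^esub> ltr G s l) (colop G A l)" if l: "l \<in> letters n" for l
    proof -
      obtain k m b where lk: "l = (k, m, b)" by (cases l)
      have km: "k < n" "m < n" "k \<noteq> m" using l by (auto simp: lk letters_def)
      have gl: "g \<otimes>\<^bsub>G\<^esub> ltr G s l = g * el n k m (if b then 1 else - 1)"
        using ltr_gens l by (simp add: lk)
      have glG: "g * el n k m c \<in> carrier G" for c using G_mult[OF g el_SL[OF km(3)]] .
      have col: "colop G A l (i, j) = e (\<epsilon> * (g * el n k m (if b then 1 else - 1)) $$ (i, j))" if "i < n" "j < n" for i j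
        using that km \<epsilon>(2) mult_el[OF gc km(1) that, of m]
        by (auto simp: colop_def lk algebra_simps)
      then have "\<forall>p\<in>{..<n} \<times> {..<n}. colop G A l p \<in> carrier G" by (auto simp: det_el)
      then show ?thesis unfolding gl using repr_iff[OF glG] col \<epsilon>(1) by blast
    qed
    have A3: "cen G (g \<otimes>\<^bsub>G\<^esub> inv\<^bsub>G\<^esub> h)" if h: "h \<in> carrier G" "repr G n s h A" for h
    proof -
      obtain \<epsilon>' where \<epsilon>': "\<bar>\<epsilon>'\<bar> = 1" "\<And>i j. i < n \<Longrightarrow> j < n \<Longrightarrow> A (i, j) = e (\<epsilon>' * h $$ (i, j))"
        using h(2) repr_iff[OF h(1) A] by blast
      have "g = (\<epsilon> * \<epsilon>') \<cdot>\<^sub>m h"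
        using \<epsilon>(2) \<epsilon>'(2) by (intro proportional g h \<epsilon>(1) \<epsilon>'(1)) (metis e_inject)
      then have "g * inv\<^bsub>G\<^esub> h = (\<epsilon> * \<epsilon>') \<cdot>\<^sub>m 1\<^sub>m n"
        using inv_SL[OF h(1)] h(1) by (simp add: mult_smult_assoc_mat[of _ n n _ n])
      moreover have "g * inv\<^bsub>G\<^esub> h \<in> carrier G" using g h(1) group.inv_closed[OF group_SL] by (intro G_mult) blast+
      ultimately show ?thesis using cen_scalar by simp
    qed
    have A4: "A (i, i) = s (0, 2) \<or> A (i, i) = inv\<^bsub>G\<^esub> (s (0, 2))"
      if "\<forall>i\<in>{..<n}. \<forall>j\<in>{..<n}. i < j \<longrightarrow> A (i, j) = \<one>\<^bsub>G\<^esub>" "i < n" for i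
    proof -
      have "\<bar>g $$ (i, i)\<bar> = 1" using that zero by (intro lower_triangular_SL g) auto
      then have "\<bar>\<epsilon> * g $$ (i, i)\<bar> = 1" using \<epsilon>(1) by (simp add: abs_mult)
      then show ?thesis using abs_one_cases \<epsilon>(2)[OF that(2,2)] by (auto simp: s02)
    qed
    have A5: "\<exists>v\<in>D. g = evs n v" if "\<forall>i\<in>{..<n}. \<forall>j\<in>{..<n}. i \<noteq> j \<longrightarrow> A (i, j) = \<one>\<^bsub>G\<^esub>"
      using that zero by (intro D[OF g]) auto
    have A6: "(\<forall>p\<in>{..<n} \<times> {..<n}. B p = A p) \<or> (\<forall>p\<in>{..<n} \<times> {..<n}. B p = inv\<^bsub>G\<^esub> (A p))"
      if B: "\<forall>p\<in>{..<n} \<times> {..<n}. B p \<in> carrier G" "repr G n s g B" for B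
    proof -
      obtain \<epsilon>' where \<epsilon>': "\<bar>\<epsilon>'\<bar> = 1" "\<And>i j. i < n \<Longrightarrow> j < n \<Longrightarrow> B (i, j) = e (\<epsilon>' * g $$ (i, j))"
        using B(2) repr_iff[OF g B(1)] by blast
      show ?thesis
      proof (cases "\<epsilon>' = \<epsilon>")
        case True
        then show ?thesis using \<epsilon>(2) \<epsilon>'(2) by auto
      next
        case False
        then have "\<epsilon>' = - \<epsilon>" using \<epsilon>(1) \<epsilon>'(1) by linarith
        then show ?thesis using \<epsilon>(2) \<epsilon>'(2) by auto
      qed
    qed
    have "(\<forall>l\<in>letters n. repr G n s (g \<otimes>\<^bsub>G\<^esub> ltr G s l) (colop G A l)) \<and>
        (\<forall>h\<in>carrier G. repr G n s h A \<longrightarrow> cen G (g \<otimes>\<^bsub>G\<^esub> inv\<^bsub>G\<^esub> h)) \<and>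
        ((\<forall>i\<in>{..<n}. \<forall>j\<in>{..<n}. i < j \<longrightarrow> A (i, j) = \<one>\<^bsub>G\<^esub>) \<longrightarrow>
           (\<forall>i\<in>{..<n}. A (i, i) = s (0, 2) \<or> A (i, i) = inv\<^bsub>G\<^esub> (s (0, 2)))) \<and>
        ((\<forall>i\<in>{..<n}. \<forall>j\<in>{..<n}. i \<noteq> j \<longrightarrow> A (i, j) = \<one>\<^bsub>G\<^esub>) \<longrightarrow> (\<exists>v\<in>D. g = evs n v)) \<and>
        (\<forall>B. (\<forall>p\<in>{..<n} \<times> {..<n}. B p \<in> carrier G) \<longrightarrow> (repr G n s g B \<longrightarrow>
           (\<forall>p\<in>{..<n} \<times> {..<n}. B p = A p) \<or> (\<forall>p\<in>{..<n} \<times> {..<n}. B p = inv\<^bsub>G\<^esub> (A p))))"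
    proof (intro conjI allI impI)
      assume "\<forall>i\<in>{..<n}. \<forall>j\<in>{..<n}. i < j \<longrightarrow> A (i, j) = \<one>\<^bsub>G\<^esub>"
      then show "\<forall>i\<in>{..<n}. A (i, i) = s (0, 2) \<or> A (i, i) = inv\<^bsub>G\<^esub> (s (0, 2))" using A4 by blast
    next
      assume "\<forall>i\<in>{..<n}. \<forall>j\<in>{..<n}. i \<noteq> j \<longrightarrow> A (i, j) = \<one>\<^bsub>G\<^esub>"
      then show "\<exists>v\<in>D. g = evs n v" by (rule A5)
    next
      fix B assume "\<forall>p\<in>{..<n} \<times> {..<n}. B p \<in> carrier G" "repr G n s g B"
      then show "(\<forall>p\<in>{..<n} \<times> {..<n}. B p = A p) \<or> (\<forall>p\<in>{..<n} \<times> {..<n}. B p = inv\<^bsub>G\<^esub> (A p))" by (rule A6)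
    qed (use A2 A3 in blast)+
  }
  note block = this
  show ?thesis
    unfolding repr_ax_def
    by (rule conjI[OF A1], rule conjI, rule allI, rule impI, rule ballI, rule impI, rule block, assumption+,
        rule ballI, rule A7)
qed

section \<open>Matrices that are diagonal, or the identity, modulo 3\<close>

lemma offdiag_mod3:
  fixes x y :: "int mat"
  assumes x: "x \<in> carrier_mat n n" and y: "y \<in> carrier_mat n n" and ij: "i < n" "j < n"
    and off: "\<And>k. k < n \<Longrightarrow> k \<noteq> i \<Longrightarrow> 3 dvd x $$ (i, k)"
  shows "3 dvd (x * y) $$ (i, j) - x $$ (i, i) * y $$ (i, j)"
proof -
  have "(x * y) $$ (i, j) = (\<Sum>k<n. x $$ (i, k) * y $$ (k, j))" by (rule mult_entry[OF x y ij])
  also have "\<dots> = x $$ (i, i) * y $$ (i, j) + (\<Sum>k\<in>{..<n} - {i}. x $$ (i, k) * y $$ (k, j))"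
    using ij by (intro sum.remove) auto
  finally have "(x * y) $$ (i, j) - x $$ (i, i) * y $$ (i, j) = (\<Sum>k\<in>{..<n} - {i}. x $$ (i, k) * y $$ (k, j))" by simp
  also have "3 dvd \<dots>" using off by (intro dvd_sum) auto
  finally show ?thesis .
qed

definition diag3 :: "int mat \<Rightarrow> bool" where
  "diag3 x \<longleftrightarrow> (\<forall>i<n. \<forall>j<n. i \<noteq> j \<longrightarrow> 3 dvd x $$ (i, j))"

text \<open>Divisibility by 3 ignores signs, so it suffices to know each entry up to sign.\<close>

lemma n0_iff: "x \<in> carrier G \<Longrightarrow> n0 G n s x \<longleftrightarrow> diag3 x"
proof
  assume x: "x \<in> carrier G" and n0: "n0 G n s x"
  show "diag3 x" unfolding diag3_def
  proof (intro allI impI)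
    fix i j assume ij: "i < n" "j < n" "i \<noteq> j"
    then obtain u where u: "num G n s u" "ent G n s (tst G s i i j j x) (u \<otimes>\<^bsub>G\<^esub> u \<otimes>\<^bsub>G\<^esub> u)"
      using n0 unfolding n0_def by blast
    obtain c where c: "u = e c" using u(1) num_iff by blast
    have "\<bar>x $$ (i, j)\<bar> = \<bar>c + c + c\<bar>"
      using u(2) ij unfolding c ent_iff[OF tst_SL[OF x ij(1,1,2,2)]] tst_entry[OF x ij(1,1,2,2)]
      by (auto simp: ival_def)
    then have "3 dvd \<bar>x $$ (i, j)\<bar>" by presburger
    then show "3 dvd x $$ (i, j)" by simp
  qed
next
  assume x: "x \<in> carrier G" and d: "diag3 x"
  show "n0 G n s x" unfolding n0_def
  proof (intro ballI impI)
    fix i j assume "i \<in> {..<n}" "j \<in> {..<n}" "i \<noteq> j"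
    then have ij: "i < n" "j < n" "i \<noteq> j" by auto
    then obtain c where c: "x $$ (i, j) = 3 * c" using d unfolding diag3_def dvd_def by blast
    have "ent G n s (tst G s i i j j x) (e c \<otimes>\<^bsub>G\<^esub> e c \<otimes>\<^bsub>G\<^esub> e c)"
      unfolding ent_iff[OF tst_SL[OF x ij(1,1,2,2)]] tst_entry[OF x ij(1,1,2,2)]
      using c by (auto simp: ival_def)
    then show "\<exists>u\<in>carrier G. num G n s u \<and> ent G n s (tst G s i i j j x) (u \<otimes>\<^bsub>G\<^esub> u \<otimes>\<^bsub>G\<^esub> u)"
      using num_iff e_carrier(1) by blast
  qed
qed

lemma diag3_mult:
  assumes "x \<in> carrier_mat n n" "y \<in> carrier_mat n n" "diag3 x" "diag3 y"
  shows "diag3 (x * y)"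
  unfolding diag3_def
proof (intro allI impI)
  fix i j assume ij: "i < n" "j < n" "i \<noteq> j"
  have "3 dvd (x * y) $$ (i, j) - x $$ (i, i) * y $$ (i, j)"
    using assms ij by (intro offdiag_mod3) (auto simp: diag3_def)
  moreover have "3 dvd x $$ (i, i) * y $$ (i, j)" using assms(4) ij by (auto simp: diag3_def)
  ultimately show "3 dvd (x * y) $$ (i, j)" by (metis diff_add_cancel dvd_add)
qed

lemma diag3_unit:
  assumes x: "x \<in> carrier G" "diag3 x" and i: "i < n"
  shows "3 dvd x $$ (i, i) * (inv\<^bsub>G\<^esub> x) $$ (i, i) - 1" "\<not> 3 dvd x $$ (i, i)"
proof -
  have "3 dvd (x * inv\<^bsub>G\<^esub> x) $$ (i, i) - x $$ (i, i) * (inv\<^bsub>G\<^esub> x) $$ (i, i)"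
    using x i inv_SL(1)[OF x(1)] by (intro offdiag_mod3) (auto simp: diag3_def)
  then have "3 dvd 1 - x $$ (i, i) * (inv\<^bsub>G\<^esub> x) $$ (i, i)" using inv_SL(2)[OF x(1)] i by simp
  then show d: "3 dvd x $$ (i, i) * (inv\<^bsub>G\<^esub> x) $$ (i, i) - 1" by (simp add: dvd_diff_commute)
  show "\<not> 3 dvd x $$ (i, i)"
  proof
    assume "3 dvd x $$ (i, i)"
    then have "3 dvd x $$ (i, i) * (inv\<^bsub>G\<^esub> x) $$ (i, i)" by simp
    then have "3 dvd (1 :: int)" using d by (metis dvd_diff diff_diff_eq2 add_diff_cancel_left')
    then show False by simp
  qed
qed

lemma diag3_inv:
  assumes x: "x \<in> carrier G" "diag3 x"
  shows "diag3 (inv\<^bsub>G\<^esub> x)"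
  unfolding diag3_def
proof (intro allI impI)
  fix i j assume ij: "i < n" "j < n" "i \<noteq> j"
  have "3 dvd (x * inv\<^bsub>G\<^esub> x) $$ (i, j) - x $$ (i, i) * (inv\<^bsub>G\<^esub> x) $$ (i, j)"
    using x ij inv_SL(1)[OF x(1)] by (intro offdiag_mod3) (auto simp: diag3_def)
  then have "3 dvd x $$ (i, i) * (inv\<^bsub>G\<^esub> x) $$ (i, j)" using inv_SL(2)[OF x(1)] ij by simp
  moreover have "prime (3 :: int)" by (simp add: prime_int_numeral_eq)
  ultimately show "3 dvd (inv\<^bsub>G\<^esub> x) $$ (i, j)"
    using diag3_unit(2)[OF x ij(1)] prime_dvd_mult_iff by blast
qed

definition one3 :: "int mat \<Rightarrow> bool" where
  "one3 x \<longleftrightarrow> (\<forall>i<n. \<forall>j<n. 3 dvd x $$ (i, j) - (if i = j then 1 else 0))"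

text \<open>The modulus 3 is chosen for this: its units 1 and -1 both have square 1.\<close>

lemma one3_square:
  assumes x: "x \<in> carrier G" "diag3 x"
  shows "one3 (x * x)"
  unfolding one3_def
proof (intro allI impI)
  fix i j assume ij: "i < n" "j < n"
  have d: "3 dvd (x * x) $$ (i, j) - x $$ (i, i) * x $$ (i, j)"
    using x ij by (intro offdiag_mod3) (auto simp: diag3_def)
  have "3 dvd x $$ (i, i) * x $$ (i, j) - (if i = j then 1 else 0)"
  proof (cases "i = j")
    case True
    have "\<not> 3 dvd x $$ (i, i)" using diag3_unit(2)[OF x ij(1)] .
    then have "3 dvd x $$ (i, i) - 1 \<or> 3 dvd x $$ (i, i) + 1" by presburger
    then have "3 dvd (x $$ (i, i) - 1) * (x $$ (i, i) + 1)" by auto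
    then have "3 dvd x $$ (i, i) * x $$ (i, i) - 1" by (simp add: algebra_simps)
    then show ?thesis using True by simp
  next
    case False
    then show ?thesis using x(2) ij by (simp add: diag3_def)
  qed
  then have "3 dvd ((x * x) $$ (i, j) - x $$ (i, i) * x $$ (i, j)) + (x $$ (i, i) * x $$ (i, j) - (if i = j then 1 else 0))"
    by (rule dvd_add[OF d])
  then show "3 dvd (x * x) $$ (i, j) - (if i = j then 1 else 0)" by simp
qed

lemma one3_mult:
  assumes x: "x \<in> carrier_mat n n" "one3 x" and y: "y \<in> carrier_mat n n" "one3 y"
  shows "one3 (x * y)"
  unfolding one3_def
proof (intro allI impI)
  fix i j assume ij: "i < n" "j < n"
  have off: "3 dvd x $$ (i, k)" if "k < n" "k \<noteq> i" for k
  proof -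
    have "3 dvd x $$ (i, k) - (if i = k then 1 else 0)" using x(2) ij that unfolding one3_def by blast
    then show ?thesis using that by simp
  qed
  have 1: "3 dvd (x * y) $$ (i, j) - x $$ (i, i) * y $$ (i, j)" using x y ij off by (intro offdiag_mod3) auto
  have "3 dvd x $$ (i, i) - (if i = i then 1 else 0)" using x(2) ij unfolding one3_def by blast
  then have "3 dvd (x $$ (i, i) - 1) * y $$ (i, j)" by simp
  moreover have "3 dvd y $$ (i, j) - (if i = j then 1 else 0)" using y(2) ij unfolding one3_def by blast
  ultimately have "3 dvd ((x * y) $$ (i, j) - x $$ (i, i) * y $$ (i, j)) + (x $$ (i, i) - 1) * y $$ (i, j)
     + (y $$ (i, j) - (if i = j then 1 else 0))" using 1 by (intro dvd_add)
  then show "3 dvd (x * y) $$ (i, j) - (if i = j then 1 else 0)" by (simp add: algebra_simps)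
qed

text \<open>Matrices congruent modulo 3 lie in the same coset, so \<open>J\<close> can be the number
  of residue patterns that occur.\<close>

lemma good_SL: "\<exists>J. good G n J s"
proof -
  define \<rho> where "\<rho> x = restrict (\<lambda>p. x $$ p mod 3) ({..<n} \<times> {..<n})" for x :: "int mat"
  have "\<rho> ` carrier G \<subseteq> ({..<n} \<times> {..<n}) \<rightarrow>\<^sub>E {0..<3}"
    by (intro image_subsetI) (simp add: \<rho>_def restrict_PiE_iff)
  then have fin: "finite (\<rho> ` carrier G)" using finite_PiE[of "{..<n} \<times> {..<n}" "\<lambda>_. {0..<3::int}"] finite_subset by blast
  obtain J f where f: "\<rho> ` carrier G = f ` {i. i < (J :: nat)}"
    using finite_imp_nat_seg_image_inj_on[OF fin] by blast
  define r where "r i = inv_into (carrier G) \<rho> (f i)" for i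
  have r: "r i \<in> carrier G" "\<rho> (r i) = f i" if "i < J" for i
  proof -
    have "f i \<in> \<rho> ` carrier G" using f that by blast
    then show "r i \<in> carrier G" "\<rho> (r i) = f i" unfolding r_def by (rule inv_into_into, rule f_inv_into_f)
  qed
  have cover: "\<exists>i<J. diag3 (g * inv\<^bsub>G\<^esub> (r i))" if g: "g \<in> carrier G" for g
  proof -
    obtain i where i: "i < J" "\<rho> g = \<rho> (r i)"
    proof -
      have "\<rho> g \<in> f ` {i. i < J}" using f g by blast
      then show thesis using that r(2) by force
    qed
    let ?y = "inv\<^bsub>G\<^esub> (r i)"
    have y: "?y \<in> carrier_mat n n" "r i * ?y = 1\<^sub>m n" using inv_SL[OF r(1)[OF i(1)]] by auto
    have c: "g \<in> carrier_mat n n" "r i \<in> carrier_mat n n" using g r(1)[OF i(1)] by auto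
    have cong: "3 dvd g $$ (a, b) - r i $$ (a, b)" if "a < n" "b < n" for a b
    proof -
      have "g $$ (a, b) mod 3 = r i $$ (a, b) mod 3" using fun_cong[OF i(2), of "(a, b)"] that by (simp add: \<rho>_def)
      then show ?thesis by (simp add: mod_eq_dvd_iff)
    qed
    have "3 dvd (g * ?y) $$ (a, b)" if ab: "a < n" "b < n" "a \<noteq> b" for a b
    proof -
      have "(g * ?y) $$ (a, b) - (r i * ?y) $$ (a, b) = (\<Sum>k<n. (g $$ (a, k) - r i $$ (a, k)) * ?y $$ (k, b))"
        unfolding mult_entry[OF c(1) y(1) ab(1,2)] mult_entry[OF c(2) y(1) ab(1,2)]
        by (simp add: sum_subtractf algebra_simps)
      also have "3 dvd \<dots>" using cong ab by (intro dvd_sum) auto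
      finally show ?thesis using y(2) ab by simp
    qed
    then show ?thesis using i(1) by (auto simp: diag3_def)
  qed
  have invG: "inv\<^bsub>G\<^esub> x \<in> carrier G" if "x \<in> carrier G" for x using group.inv_closed[OF group_SL that] .
  have "good G n J s"
    unfolding good_def
  proof (intro conjI ballI impI exI[of _ r])
    have "diag3 (1\<^sub>m n)" by (simp add: diag3_def)
    then show "n0 G n s \<one>\<^bsub>G\<^esub>" using n0_iff[OF one_G] by simp
  next
    fix x assume "x \<in> carrier G" "n0 G n s x"
    then show "n0 G n s (inv\<^bsub>G\<^esub> x)" using diag3_inv n0_iff invG by blast
  next
    fix x y assume "x \<in> carrier G" "y \<in> carrier G" "n0 G n s x \<and> n0 G n s y"
    then show "n0 G n s (x \<otimes>\<^bsub>G\<^esub> y)" using diag3_mult[of x y] n0_iff G_mult[of x y] by simp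
  next
    fix i assume "i \<in> {..<J}"
    then show "r i \<in> carrier G" using r by blast
  next
    fix g assume g: "g \<in> carrier G"
    obtain i where i: "i < J" "diag3 (g * inv\<^bsub>G\<^esub> (r i))" using cover[OF g] by blast
    have "g * inv\<^bsub>G\<^esub> (r i) \<in> carrier G" using G_mult[OF g invG[OF r(1)[OF i(1)]]] .
    then have "n0 G n s (g \<otimes>\<^bsub>G\<^esub> inv\<^bsub>G\<^esub> (r i))" using n0_iff i(2) by simp
    then show "\<exists>i\<in>{..<J}. n0 G n s (g \<otimes>\<^bsub>G\<^esub> inv\<^bsub>G\<^esub> (r i))" using i(1) by blast
  qed
  then show ?thesis by blast
qed

text \<open>The elementary matrices are a good parameter, so core elements are diagonal modulo 3 and
  products of their squares are congruent to 1. A central matrix is 1 or -1, and -1 is not congruent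
  to 1 modulo 3.\<close>

lemma sign_ax_SL:
  assumes J: "good G n J s"
  shows "sign_ax G n J k"
  unfolding sign_ax_def
proof (intro allI impI)
  fix x assume x: "\<forall>i\<in>{..<k}. x i \<in> carrier G" and h: "(\<forall>i\<in>{..<k}. core G n J (x i)) \<and> cen G (sqs G x k)"
  have "diag3 (x i)" if "i < k" for i
  proof -
    have "core G n J (x i)" using h that by blast
    then have "n0 G n s (x i)" using J gens_closed unfolding core_def by blast
    then show ?thesis using n0_iff x that by blast
  qed
  then have "one3 (sqs G x j) \<and> sqs G x j \<in> carrier G" if "j \<le> k" for j
    using that
  proof (induction j)
    case 0
    show ?case using one_G by (simp add: one3_def)
  next
    case (Suc j)
    then have "one3 (sqs G x j)" "sqs G x j \<in> carrier G" "x j \<in> carrier G" "diag3 (x j)" using x by auto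
    then show ?case using one3_mult[of "sqs G x j" "x j * x j"] one3_square[of "x j"] G_mult by simp
  qed
  then have o: "one3 (sqs G x k)" "sqs G x k \<in> carrier G" by auto
  obtain \<mu> where \<mu>: "\<bar>\<mu>\<bar> = 1" "sqs G x k = \<mu> \<cdot>\<^sub>m 1\<^sub>m n" using cenD[OF o(2)] h by blast
  have "3 dvd sqs G x k $$ (0, 0) - (if (0::nat) = 0 then 1 else 0)" using o(1) idx(1) unfolding one3_def by blast
  then have "3 dvd \<mu> - 1" using \<mu>(2) by simp
  then have "\<mu> = 1" using abs_one_cases[OF \<mu>(1)] by auto
  then show "sqs G x k = \<one>\<^bsub>G\<^esub>" using \<mu>(2) one_smult_mat by simp
qed

end

section \<open>The special linear group is a model\<close>

context group
begin

lemma subgroup_n0: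
  assumes "good G n J s"
  shows "subgroup {x \<in> carrier G. n0 G n s x} G"
proof (rule subgroupI)
  show "{x \<in> carrier G. n0 G n s x} \<noteq> {}" using assms one_closed unfolding good_def by blast
next
  fix x assume "x \<in> {x \<in> carrier G. n0 G n s x}"
  then show "inv x \<in> {x \<in> carrier G. n0 G n s x}" using assms inv_closed unfolding good_def by blast
next
  fix x y assume "x \<in> {x \<in> carrier G. n0 G n s x}" "y \<in> {x \<in> carrier G. n0 G n s x}"
  then show "x \<otimes> y \<in> {x \<in> carrier G. n0 G n s x}" using assms m_closed unfolding good_def by blast
qed blast

lemma core_iff: "core G n J x \<longleftrightarrow>
    (\<forall>s. (\<forall>p\<in>{..<n} \<times> {..<n}. s p \<in> carrier G) \<and> good G n J s \<longrightarrow> n0 G n s x)"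
  unfolding core_def by (simp only: imp_conjL)

lemma subgroup_core: "subgroup {x \<in> carrier G. core G n J x} G"
proof (rule subgroupI)
  have "core G n J \<one>" unfolding core_def good_def by blast
  then show "{x \<in> carrier G. core G n J x} \<noteq> {}" using one_closed by blast
next
  fix x assume "x \<in> {x \<in> carrier G. core G n J x}"
  then show "inv x \<in> {x \<in> carrier G. core G n J x}"
    using inv_closed[of x] unfolding core_def good_def by blast
next
  fix x y assume "x \<in> {x \<in> carrier G. core G n J x}" "y \<in> {x \<in> carrier G. core G n J x}"
  then show "x \<otimes> y \<in> {x \<in> carrier G. core G n J x}"
    using m_closed[of x y] unfolding core_def good_def by blast
qed blast

text \<open>The words in \<open>Y\<close> represent the cosets of the subgroup generated by the squares of core elements.\<close>

lemma cert_ax_ex: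
  assumes s: "\<And>p. p \<in> {..<n} \<times> {..<n} \<Longrightarrow> s p \<in> carrier G"
    and words: "\<And>g. g \<in> carrier G \<Longrightarrow> \<exists>w. set w \<subseteq> letters n \<and> g = ev G s w"
  obtains Y \<delta> L where "finite Y" "[] \<in> Y" "\<And>w. w \<in> Y \<Longrightarrow> set w \<subseteq> letters n"
    "\<And>w l. w \<in> Y \<Longrightarrow> l \<in> letters n \<Longrightarrow> \<delta> w l \<in> Y" "cert_ax G n J L Y \<delta> s"
    "\<And>w. set w \<subseteq> letters n \<Longrightarrow> ev G s w = \<one> \<Longrightarrow> foldl \<delta> [] w = []"
proof -
  define N where "N = {x \<in> carrier G. core G n J x}"
  have N: "subgroup N G" unfolding N_def by (rule subgroup_core)
  have Nc: "N \<subseteq> carrier G" by (auto simp: N_def)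
  define M where "M = generate G ((\<lambda>x. x \<otimes> x) ` N)"
  have M: "subgroup M G" unfolding M_def by (rule generate_is_subgroup) (use Nc in auto)
  define \<T> where "\<T> = (\<lambda>s'. {x \<in> carrier G. n0 G n s' x}) ` {s'. (\<forall>p\<in>{..<n} \<times> {..<n}. s' p \<in> carrier G) \<and> good G n J s'}"
  have N_eq: "N = {x \<in> carrier G. \<forall>T\<in>\<T>. x \<in> T}"
    unfolding N_def \<T>_def by (intro Collect_cong conj_cong refl) (simp add: core_iff)
  let ?S = "s ` ({..<n} \<times> {..<n})"
  have S: "finite ?S" "?S \<subseteq> carrier G" using s by auto
  have "generate G ?S = carrier G"
  proof (intro equalityI subsetI)
    fix g assume "g \<in> carrier G"
    then obtain w where w: "set w \<subseteq> letters n" "g = ev G s w" using words by meson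
    show "g \<in> generate G ?S" unfolding w(2) by (rule ev_in_generate[OF s w(1)])
  qed (rule generate_in_carrier[OF S(2)])
  note S = S this
  obtain R where R: "finite R" "R \<subseteq> carrier G" "\<And>g. g \<in> carrier G \<Longrightarrow> \<exists>r\<in>R. g \<otimes> inv r \<in> M"
  proof -
    have T1: "subgroup T G" if T: "T \<in> \<T>" for T
      using T unfolding \<T>_def by (elim imageE CollectE conjE) (simp only: subgroup_n0)
    have T2: "\<exists>r. (\<forall>i<J. r i \<in> carrier G) \<and> (\<forall>g\<in>carrier G. \<exists>i<J. g \<otimes> inv (r i) \<in> T)" if T: "T \<in> \<T>" for T
    proof -
      obtain s' where s': "good G n J s'" "T = {x \<in> carrier G. n0 G n s' x}" using T unfolding \<T>_def by (elim imageE CollectE conjE)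
      obtain r where r: "\<forall>i\<in>{..<J}. r i \<in> carrier G"
        "\<forall>g\<in>carrier G. \<exists>i\<in>{..<J}. n0 G n s' (g \<otimes> inv (r i))" using s'(1) unfolding good_def by blast
      have "\<exists>i<J. g \<otimes> inv (r i) \<in> T" if g: "g \<in> carrier G" for g
      proof -
        obtain i where i: "i < J" "n0 G n s' (g \<otimes> inv (r i))" using r(2) g by blast
        then have "g \<otimes> inv (r i) \<in> carrier G" using g r(1) by simp
        then show ?thesis using s'(2) i by blast
      qed
      then show ?thesis using r(1) by blast
    qed
    show thesis
      by (rule squares_of_core_finite_index[where \<T> = \<T> and J = J, OF S T1 T2, folded N_eq, folded M_def])
        (assumption | rule that)+
  qed
  \<comment> \<open>Right cosets of \<open>M\<close>, which are respected by appending a letter on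
    the right.\<close>
  define cl where "cl g = {h \<in> carrier G. h \<otimes> inv g \<in> M}" for g
  \<comment> \<open>The coset of \<open>\<one>\<close> gets the empty word, so a word with value
    \<open>\<one>\<close> ends exactly in the initial state.\<close>
  define F where "F c = (if \<one> \<in> c then [] else SOME w. set w \<subseteq> letters n \<and> ev G s w \<in> c)" for c
  define rep where "rep g = F (cl g)" for g
  have Mm: "a \<otimes> b \<in> M" if "a \<in> M" "b \<in> M" for a b using subgroup.m_closed[OF M that] .
  have Mi: "inv a \<in> M" if "a \<in> M" for a using subgroup.m_inv_closed[OF M that] .
  have cl_self: "g \<in> cl g" if "g \<in> carrier G" for g
    using that subgroup.one_closed[OF M] r_inv[OF that] by (simp add: cl_def)
  have inv_sym: "b \<otimes> inv a \<in> M" if "a \<otimes> inv b \<in> M" "a \<in> carrier G" "b \<in> carrier G" for a b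
    using Mi[OF that(1)] that(2,3) by (simp add: inv_mult_group)
  have tr: "a \<otimes> inv c \<in> M" if "a \<otimes> inv b \<in> M" "b \<otimes> inv c \<in> M"
    "a \<in> carrier G" "b \<in> carrier G" "c \<in> carrier G" for a b c
    using Mm[OF that(1,2)] that(3-5) by (simp add: m_assoc)
  have cl_eq: "cl g = cl h" if "g \<otimes> inv h \<in> M" "g \<in> carrier G" "h \<in> carrier G" for g h
    using tr inv_sym that unfolding cl_def by blast
  have rep: "set (rep g) \<subseteq> letters n" "ev G s (rep g) \<in> cl g" if g: "g \<in> carrier G" for g
  proof -
    obtain w where w: "set w \<subseteq> letters n" "g = ev G s w" using words[OF g] by (elim exE conjE) (rule that)
    have "set (rep g) \<subseteq> letters n \<and> ev G s (rep g) \<in> cl g"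
    proof (cases "\<one> \<in> cl g")
      case True
      then show ?thesis by (simp add: rep_def F_def)
    next
      case False
      have "\<exists>w. set w \<subseteq> letters n \<and> ev G s w \<in> cl g" using w cl_self[OF g] by blast
      then show ?thesis using someI_ex[of "\<lambda>w. set w \<subseteq> letters n \<and> ev G s w \<in> cl g"] False by (simp add: rep_def F_def)
    qed
    then show "set (rep g) \<subseteq> letters n" "ev G s (rep g) \<in> cl g" by auto
  qed
  define Y where "Y = rep ` carrier G"
  have "cl ` carrier G \<subseteq> cl ` R"
  proof (rule image_subsetI)
    fix g assume g: "g \<in> carrier G"
    obtain r where r: "r \<in> R" "g \<otimes> inv r \<in> M" using R(3)[OF g] by (rule bexE)
    have "cl g = cl r" by (rule cl_eq[OF r(2) g subsetD[OF R(2) r(1)]])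
    then show "cl g \<in> cl ` R" using r(1) by (rule image_eqI)
  qed
  then have "finite (cl ` carrier G)" using R(1) finite_subset by blast
  moreover have "Y = F ` cl ` carrier G" by (auto simp: Y_def rep_def)
  ultimately have Yfin: "finite Y" by simp
  have Yl: "set y \<subseteq> letters n" if "y \<in> Y" for y using that rep(1) by (auto simp: Y_def)
  have one_rep: "rep \<one> = []" using cl_self[OF one_closed] by (simp add: rep_def F_def)
  then have nilY: "[] \<in> Y" using imageI[OF one_closed, of rep] unfolding Y_def by (simp only:)
  have evG: "ev G s w \<in> carrier G" if "set w \<subseteq> letters n" for w using ev_closed[OF s that] .
  have lG: "ltr G s l \<in> carrier G" if "l \<in> letters n" for l by (rule ltr_closed[OF s that])
  define \<delta> where "\<delta> y l = rep (ev G s y \<otimes> ltr G s l)" for y l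
  have prodG: "ev G s y \<otimes> ltr G s l \<in> carrier G" if "set y \<subseteq> letters n" "l \<in> letters n" for y l
    using evG[OF that(1)] lG[OF that(2)] by (rule m_closed)
  have \<delta>Y: "\<delta> y l \<in> Y" if "y \<in> Y" "l \<in> letters n" for y l
    unfolding \<delta>_def Y_def by (rule imageI[OF prodG[OF Yl[OF that(1)] that(2)]])
  have \<delta>M: "(ev G s y \<otimes> ltr G s l) \<otimes> inv (ev G s (\<delta> y l)) \<in> M" if "y \<in> Y" "l \<in> letters n" for y l
  proof -
    note p = prodG[OF Yl[OF that(1)] that(2)]
    note r = CollectD[OF rep(2)[OF p, unfolded cl_def]]
    show ?thesis unfolding \<delta>_def cl_def by (rule inv_sym[OF conjunct2[OF r] conjunct1[OF r] p])
  qed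
  have "\<exists>k x. (\<forall>i. x i \<in> N) \<and> (ev G s y \<otimes> ltr G s l) \<otimes> inv (ev G s (\<delta> y l)) = sqs G x k"
    if "y \<in> Y" "l \<in> letters n" for y l
    by (rule generate_squares[OF N, folded M_def, OF \<delta>M[OF that]])
  then obtain k x where kx: "\<And>y l i. y \<in> Y \<Longrightarrow> l \<in> letters n \<Longrightarrow> x y l i \<in> N"
    "\<And>y l. y \<in> Y \<Longrightarrow> l \<in> letters n \<Longrightarrow> (ev G s y \<otimes> ltr G s l) \<otimes> inv (ev G s (\<delta> y l)) = sqs G (x y l) (k y l)"
    by metis
  \<comment> \<open>The largest number of squares over all transitions; shorter products are padded
    with \<open>\<one>\<close>.\<close>
  define L where "L = Max (insert 0 ((\<lambda>(y, l). k y l) ` (Y \<times> letters n)))"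
  have kL: "k y l \<le> L" if "y \<in> Y" "l \<in> letters n" for y l
    unfolding L_def using Yfin that by (intro Max_ge) auto
  have cert: "cert_ax G n J L Y \<delta> s"
    unfolding cert_ax_def
  proof (intro ballI)
    fix y l assume y: "y \<in> Y" and l: "l \<in> letters n"
    let ?z = "\<lambda>i. if i < k y l then x y l i else \<one>"
    have xc: "x y l i \<in> carrier G" for i by (rule subsetD[OF Nc kx(1)[OF y l]])
    have z: "?z i \<in> N" for i using kx(1)[OF y l] subgroup.one_closed[OF N] by (simp)
    have "sqs G ?z (k y l + (L - k y l)) = sqs G (x y l) (k y l)" by (rule sqs_pad) (rule xc)
    then have sq: "sqs G ?z L = (ev G s y \<otimes> ltr G s l) \<otimes> inv (ev G s (\<delta> y l))"
      using kL[OF y l] kx(2)[OF y l] by simp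
    have dG: "ev G s (\<delta> y l) \<in> carrier G" using evG[OF Yl[OF \<delta>Y[OF y l]]] .
    have "ev G s y \<otimes> ltr G s l = sqs G ?z L \<otimes> ev G s (\<delta> y l)"
      unfolding sq using prodG[OF Yl[OF y] l] dG by (simp add: m_assoc)
    note eq = this
    have zc: "?z i \<in> carrier G \<and> core G n J (?z i)" for i
      by (rule CollectD[OF z[unfolded N_def]])
    show "\<exists>x. (\<forall>i\<in>{..<L}. x i \<in> carrier G) \<and> (\<forall>i\<in>{..<L}. core G n J (x i)) \<and>
        ev G s y \<otimes> ltr G s l = sqs G x L \<otimes> ev G s (\<delta> y l)"
      by (intro exI[of _ ?z] conjI ballI) (rule conjunct1[OF zc], rule conjunct2[OF zc], rule eq)
  qed
  \<comment> \<open>Telescoping: (w y^-1) (y l z^-1) = w l z^-1, where y is the state before the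
    letter l and z the state after it.\<close>
  have run: "foldl \<delta> [] w \<in> Y \<and> ev G s w \<otimes> inv (ev G s (foldl \<delta> [] w)) \<in> M" if "set w \<subseteq> letters n" for w
    using that
  proof (induction w rule: rev_induct)
    case Nil
    show ?case using nilY subgroup.one_closed[OF M] by (simp)
  next
    case (snoc l w)
    let ?y = "foldl \<delta> [] w"
    have l: "l \<in> letters n" and w: "set w \<subseteq> letters n" using snoc.prems by auto
    have y: "?y \<in> Y" "ev G s w \<otimes> inv (ev G s ?y) \<in> M"
      using snoc.IH[OF w] by (rule conjunct1, rule conjunct2)
    have c: "ev G s w \<in> carrier G" "ev G s ?y \<in> carrier G" "ltr G s l \<in> carrier G" "ev G s (\<delta> ?y l) \<in> carrier G"
      by (rule evG[OF w], rule evG[OF Yl[OF y(1)]], rule lG[OF l], rule evG[OF Yl[OF \<delta>Y[OF y(1) l]]])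
    have "(ev G s w \<otimes> inv (ev G s ?y)) \<otimes> ((ev G s ?y \<otimes> ltr G s l) \<otimes> inv (ev G s (\<delta> ?y l))) \<in> M"
      using Mm[OF y(2) \<delta>M[OF y(1) l]] .
    then have "(ev G s w \<otimes> ltr G s l) \<otimes> inv (ev G s (\<delta> ?y l)) \<in> M"
      using c by (simp add: m_assoc)
    then show ?case using \<delta>Y[OF y(1) l] by (simp add: ev_snoc)
  qed
  have fin: "foldl \<delta> [] w = []" if w: "set w \<subseteq> letters n" "ev G s w = \<one>" for w
  proof -
    let ?y = "foldl \<delta> [] w"
    have y: "?y \<in> Y" "inv (ev G s ?y) \<in> M"
    proof -
      note r = run[OF w(1)]
      show "?y \<in> Y" by (rule conjunct1[OF r])
      then have "ev G s ?y \<in> carrier G" by (intro evG Yl)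
      then have "inv (ev G s ?y) \<in> carrier G" by (rule inv_closed)
      then have "\<one> \<otimes> inv (ev G s ?y) = inv (ev G s ?y)" by (rule l_one)
      moreover have "\<one> \<otimes> inv (ev G s ?y) \<in> M" using conjunct2[OF r] w(2) by simp
      ultimately show "inv (ev G s ?y) \<in> M" by simp
    qed
    have yG: "ev G s ?y \<in> carrier G" using evG[OF Yl[OF y(1)]] .
    obtain g where g: "g \<in> carrier G" "?y = rep g" using y(1) unfolding Y_def by (rule imageE) (rule that)
    have 1: "ev G s ?y \<otimes> inv g \<in> M" using rep(2)[OF g(1)] g(2) by (simp add: cl_def)
    have "inv (ev G s ?y) \<otimes> (ev G s ?y \<otimes> inv g) \<in> M" by (rule Mm[OF y(2) 1])
    then have "inv g \<in> M" using yG g(1) by (simp)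
    then have "\<one> \<in> cl g" using g(1) by (simp add: cl_def)
    then show ?thesis using g(2) by (simp add: rep_def F_def)
  qed
  show thesis by (rule that[OF Yfin nilY Yl \<delta>Y cert fin])
qed

end

context sl3
begin

text \<open>-1 has determinant 1 only for even \<open>n\<close>, hence the conditional form of the
  last clause. \<open>D\<close> is finite because a diagonal matrix in the group is determined by
  its signs.\<close>

theorem SL_model:
  "\<exists>J L Y \<delta> D Z. finite Y \<and> [] \<in> Y \<and> (\<forall>w\<in>Y. set w \<subseteq> letters n) \<and> (\<forall>w\<in>Y. \<forall>l\<in>letters n. \<delta> w l \<in> Y) \<and>
     finite D \<and> (\<forall>w\<in>D. set w \<subseteq> letters n) \<and> finite Z \<and> (\<forall>w\<in>Z. set w \<subseteq> letters n) \<and>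
     model G n J L Y \<delta> D Z s \<and> (\<forall>k. sign_ax G n J k) \<and>
     (\<forall>w. set w \<subseteq> letters n \<longrightarrow> evs n w = 1\<^sub>m n \<longrightarrow> foldl \<delta> [] w = []) \<and>
     (- 1\<^sub>m n \<in> carrier G \<longrightarrow> (\<exists>w\<in>Z. evs n w = - 1\<^sub>m n))"
proof -
  obtain J where J: "good G n J s" using good_SL by blast
  have words: "\<exists>w. set w \<subseteq> letters n \<and> g = evs n w" if "g \<in> carrier G" for g
    using SL_word[OF that] by metis
  obtain Y \<delta> L where Y: "finite Y" "[] \<in> Y" "\<And>w. w \<in> Y \<Longrightarrow> set w \<subseteq> letters n"
    "\<And>w l. w \<in> Y \<Longrightarrow> l \<in> letters n \<Longrightarrow> \<delta> w l \<in> Y" "cert_ax G n J L Y \<delta> s"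
    "\<And>w. set w \<subseteq> letters n \<Longrightarrow> evs n w = 1\<^sub>m n \<Longrightarrow> foldl \<delta> [] w = []"
    by (rule group.cert_ax_ex[OF group_SL, of n s n J]) (rule gens_closed words that; (assumption | simp)?)+
  define U where "U = {g \<in> carrier G. \<forall>i<n. \<forall>j<n. i \<noteq> j \<longrightarrow> g $$ (i, j) = 0}"
  define f where "f g = restrict (\<lambda>i. g $$ (i, i)) {..<n}" for g :: "int mat"
  have "f ` U \<subseteq> {..<n} \<rightarrow>\<^sub>E {1, - 1}"
  proof (rule image_subsetI)
    fix g assume g: "g \<in> U"
    have "\<bar>g $$ (i, i)\<bar> = 1" if "i < n" for i
      using g that by (intro lower_triangular_SL) (auto simp: U_def)
    then show "f g \<in> {..<n} \<rightarrow>\<^sub>E {1, - 1}" using abs_one_cases by (simp add: f_def restrict_PiE_iff)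
  qed
  then have "finite (f ` U)" using finite_PiE[of "{..<n}" "\<lambda>_. {1, - 1 :: int}"] finite_subset by blast
  moreover have "inj_on f U"
  proof (rule inj_onI)
    fix g h assume gh: "g \<in> U" "h \<in> U" "f g = f h"
    have "g $$ (i, i) = h $$ (i, i)" if "i < n" for i using fun_cong[OF gh(3), of i] that by (simp add: f_def)
    then have "g $$ (i, j) = h $$ (i, j)" if "i < n" "j < n" for i j
      using gh(1,2) that by (cases "i = j") (simp_all add: U_def)
    then show "g = h" using gh(1,2) by (intro eq_matI) (auto simp: U_def)
  qed
  ultimately have Ufin: "finite U" using finite_imageD by blast
  define word where "word g = (SOME w. set w \<subseteq> letters n \<and> evs n w = g)" for g
  have word: "set (word g) \<subseteq> letters n \<and> evs n (word g) = g" if g: "g \<in> carrier G" for g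
  proof -
    have "\<exists>w. set w \<subseteq> letters n \<and> evs n w = g" using words[OF g] by metis
    then show ?thesis unfolding word_def by (rule someI_ex)
  qed
  define D where "D = word ` U"
  have D: "finite D" "\<And>w. w \<in> D \<Longrightarrow> set w \<subseteq> letters n" using Ufin word by (auto simp: D_def U_def)
  have Dw: "\<exists>v\<in>D. g = evs n v" if "g \<in> carrier G" "\<forall>i<n. \<forall>j<n. i \<noteq> j \<longrightarrow> g $$ (i, j) = 0" for g
    using word[OF that(1)] that unfolding D_def U_def by (intro bexI[of _ "word g"]) auto
  define Z where "Z = (if - 1\<^sub>m n \<in> carrier G then {word (- 1\<^sub>m n)} else {})"
  have Z: "finite Z" "\<And>w. w \<in> Z \<Longrightarrow> set w \<subseteq> letters n" using word[of "- 1\<^sub>m n"] by (auto simp: Z_def split: if_splits)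
  have neg: "(- 1\<^sub>m n :: int mat) \<noteq> 1\<^sub>m n"
  proof
    assume eq: "(- 1\<^sub>m n :: int mat) = 1\<^sub>m n"
    have "(- 1\<^sub>m n :: int mat) $$ (0, 0) = - 1" using idx(1) by simp
    then show False unfolding eq using idx(1) by simp
  qed
  have Z1: "evs n w \<noteq> \<one>\<^bsub>G\<^esub>" if "w \<in> Z" for w
    using that word[of "- 1\<^sub>m n"] neg by (auto simp: Z_def split: if_splits)
  have m: "model G n J L Y \<delta> D Z s"
    unfolding model_def
    using ord_ax_SL mul_ax_SL big_ax_SL bd_ax_SL repr_ax_SL[of D] Dw Y(5) Z1 by blast
  have z: "\<exists>w\<in>Z. evs n w = - 1\<^sub>m n" if "- 1\<^sub>m n \<in> carrier G"
    using word[OF that] that by (simp add: Z_def)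
  show ?thesis
    by (rule exI[of _ J], rule exI[of _ L], rule exI[of _ Y], rule exI[of _ \<delta>], rule exI[of _ D],
        rule exI[of _ Z], intro conjI ballI allI impI)
      (assumption | rule Y D Z m z sign_ax_SL[OF J])+
qed

end

section \<open>Models over finitely generated groups\<close>

locale sl_model = group G for G (structure) +
  fixes n J L :: nat and Y :: "letter list set" and \<delta> :: "letter list \<Rightarrow> letter \<Rightarrow> letter list"
    and D Z :: "letter list set" and s :: "'a tup"
  assumes n3: "3 \<le> n"
    and s_closed: "\<And>p. p \<in> {..<n} \<times> {..<n} \<Longrightarrow> s p \<in> carrier G"
    and model: "model G n J L Y \<delta> D Z s"
begin

abbreviation "Num \<equiv> num G n s"
abbreviation "Nn \<equiv> nn G n s"
abbreviation "Le \<equiv> le G n s"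
abbreviation "Mul \<equiv> mulr G n s"
abbreviation "Big \<equiv> big G n s"
abbreviation "Bd \<equiv> bd G n s"
abbreviation "Repr \<equiv> repr G n s"
abbreviation "u \<equiv> s (0, 2)"

text \<open>The standard codes, namely the powers of the code of 1.\<close>

definition e :: "int \<Rightarrow> 'a" where
  "e k = u [^] k"

lemma s_in: "i < n \<Longrightarrow> j < n \<Longrightarrow> s (i, j) \<in> carrier G"
  using s_closed by simp

lemma u_closed [simp]: "u \<in> carrier G"
  using n3 by (simp add: s_in)

lemma Num_closed: "Num x \<Longrightarrow> x \<in> carrier G"
proof -
  assume "Num x"
  then obtain y where "y \<in> carrier G" "x = com G y (s (1, 2))" unfolding num_def by blast
  then show ?thesis using n3 by (simp add: com_def s_in)
qed

lemma Le_Num: "Le x y \<Longrightarrow> Num x" "Le x y \<Longrightarrow> Num y"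
  by (simp_all add: le_def)

lemma
  shows Num_u: "Num u" and Nn_one: "Nn \<one>" and Nn_u: "Nn u" and not_Nn_inv_u: "\<not> Nn (inv u)"
  using model unfolding model_def ord_ax_def by blast+

lemma
  assumes "Num x" "Num y"
  shows Num_mult: "Num (x \<otimes> y)" and Num_comm: "x \<otimes> y = y \<otimes> x"
    and Nn_mult: "Nn x \<Longrightarrow> Nn y \<Longrightarrow> Nn (x \<otimes> y)"
    and Num_directed: "\<exists>z. Le x z \<and> Le y z"
    and Mul_ex: "\<exists>z. Num z \<and> Mul x y z"
  using model assms Num_closed unfolding model_def ord_ax_def mul_ax_def by metis+

lemma
  assumes "Num x"
  shows Num_inv: "Num (inv x)" and Nn_total: "Nn x \<or> Nn (inv x)"
    and Nn_pred: "Nn x \<Longrightarrow> x = \<one> \<or> Nn (x \<otimes> inv u)"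
  using model assms Num_closed unfolding model_def ord_ax_def by metis+

lemma Le_trans:
  assumes "Le x y" "Le y z"
  shows "Le x z"
proof -
  have "x \<in> carrier G" "y \<in> carrier G" "z \<in> carrier G" using assms Le_Num Num_closed by blast+
  then show ?thesis using model assms unfolding model_def ord_ax_def by blast
qed

lemma Num_one: "Num \<one>"
  using Num_mult[OF Num_u Num_inv[OF Num_u]] by simp

lemma Le_refl: "Num x \<Longrightarrow> Le x x"
  using Nn_one by (simp add: le_def Num_closed)

lemma e_closed [simp]: "e k \<in> carrier G"
  by (simp add: e_def)

lemma e_0 [simp]: "e 0 = \<one>" and e_1 [simp]: "e 1 = u"
  by (simp_all add: e_def)

lemma e_add: "e (k + l) = e k \<otimes> e l"
  by (simp add: e_def int_pow_mult)

lemma e_minus: "e (- k) = inv (e k)"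
  by (simp add: e_def int_pow_neg)

lemma e_diff: "e (k - l) = e k \<otimes> inv (e l)"
  using e_add[of k "- l"] by (simp add: e_minus)

lemma e_int: "e (int m) = u [^] m"
  by (simp add: e_def int_pow_int)

lemma Nn_e_int: "Num (e (int m)) \<and> Nn (e (int m))"
proof (induction m)
  case 0
  then show ?case by (simp add: Num_one Nn_one)
next
  case (Suc m)
  then show ?case
    using Num_mult[of "e (int m)" u] Nn_mult[of "e (int m)" u] Num_u Nn_u e_add[of "int m" 1]
    by (simp add: add.commute)
qed

lemma Num_e: "Num (e k)"
proof (cases k rule: int_cases2)
  case (nonneg m)
  then show ?thesis using Nn_e_int by simp
next
  case (nonpos m)
  then show ?thesis using Nn_e_int[of m] by (simp add: e_minus Num_inv)
qed

text \<open>Otherwise \<open>inv u\<close> would be a nonnegative power of \<open>u\<close>,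
  contrary to the order axioms.\<close>

lemma e_neq_one:
  assumes "0 < k"
  shows "e k \<noteq> \<one>"
proof
  assume "e k = \<one>"
  moreover obtain m where m: "k = int m + 1" using assms by (metis zero_less_imp_eq_int add.commute Suc_pred of_nat_Suc)
  ultimately have "e (int m) = inv u"
    using e_add[of "int m" 1] inv_equality[of "e (int m)" u] by simp
  then show False using Nn_e_int[of m] not_Nn_inv_u by simp
qed

lemma e_inj: "e k = e l \<longleftrightarrow> k = l"
proof -
  have "\<not> (e k = e l)" if "l < k" for k l
    using e_neq_one[of "k - l"] that by (auto simp: e_diff)
  then show ?thesis by (metis linorder_neqE)
qed

section \<open>Exclusion of nonstandard codes\<close>

lemma Num_bounded:
  assumes "finite T" "\<And>t. t \<in> T \<Longrightarrow> Num t"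
  shows "\<exists>c. Num c \<and> (\<forall>t\<in>T. Le t c)"
  using assms
proof (induction T)
  case empty
  then show ?case using Num_u by blast
next
  case (insert t T)
  then obtain c where c: "Num c" "\<forall>t\<in>T. Le t c" by auto
  obtain z where z: "Le c z" "Le t z" using Num_directed[OF c(1), of t] insert.prems by auto
  then show ?case using c Le_trans[of _ c z] Le_Num(2)[OF z(1)] by auto
qed

lemma Nn_sub: "Num x \<Longrightarrow> Num y \<Longrightarrow> Le x y \<longleftrightarrow> Nn (y \<otimes> inv x)"
  by (simp add: le_def Num_comm[OF Num_inv])

text \<open>Predecessors of a nonnegative code stay nonnegative until 0 is met, and a nonstandard
  code never meets it.\<close>

lemma nonstandard_step:
  assumes "Num x" "Nn x" "\<And>m. x \<noteq> e (int m)"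
  shows "Nn (x \<otimes> inv (e (int m)))"
proof (induction m)
  case 0
  then show ?case using assms Num_closed by simp
next
  case (Suc m)
  let ?y = "x \<otimes> inv (e (int m))"
  have x: "x \<in> carrier G" using assms Num_closed by blast
  have "?y \<noteq> \<one>"
  proof
    assume "?y = \<one>"
    then have "x = e (int m)" using x by (metis e_closed inv_closed inv_equality inv_inv)
    then show False using assms(3) by blast
  qed
  moreover have "Num ?y" by (intro Num_mult Num_inv Num_e assms)
  ultimately have "Nn (?y \<otimes> inv u)" using Nn_pred Suc by blast
  moreover have "e (int (Suc m)) = u \<otimes> e (int m)" using e_add[of 1 "int m"] by simp
  ultimately show ?case using x by (simp add: m_assoc inv_mult_group)
qed

text \<open>Here \<open>p i\<close> plays the part of the i-th power of \<open>c\<close>. An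
  exponent above all standard numbers remains so after subtracting 1, so the descent of
  \<open>big_ax\<close> can be repeated \<open>i\<close> times.\<close>

lemma big_growth:
  assumes c: "Num c" "Le u c" and p: "\<And>i. Mul c (p i) (p (Suc i))" "\<And>i. Le u (p i)" "p 0 = u"
  shows "Num k \<Longrightarrow> (\<And>j. Nn (k \<otimes> inv (e (int j)))) \<Longrightarrow> x \<in> carrier G \<Longrightarrow> Big c k x \<Longrightarrow> Le (p i) x"
proof (induction i arbitrary: k x)
  case 0
  have "c \<in> carrier G" "k \<in> carrier G" using 0 c Num_closed by blast+
  then show ?case using model 0 p(3) unfolding model_def big_ax_def by metis
next
  case (Suc i)
  have cl: "c \<in> carrier G" "k \<in> carrier G" using Suc.prems c Num_closed by blast+
  have "Nn (k \<otimes> inv u)" using Suc.prems(2)[of 1] by simp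
  then have "Le u k" using Nn_sub[OF Num_u Suc.prems(1)] by simp
  then obtain x' y where x: "x' \<in> carrier G" "y \<in> carrier G" "Big c (k \<otimes> inv u) x'" "Mul c x' y" "Le y x"
    using model cl Suc.prems(3,4) c(2) unfolding model_def big_ax_def by metis
  have "Le (p i) x'"
  proof (rule Suc.IH[OF _ _ x(1,3)])
    show "Num (k \<otimes> inv u)" by (intro Num_mult Num_inv Num_u Suc.prems)
    show "Nn (k \<otimes> inv u \<otimes> inv (e (int j)))" for j
    proof -
      have "e (int (Suc j)) = e (int j) \<otimes> u" using e_add[of "int j" 1] by (simp add: add.commute)
      then show ?thesis using Suc.prems(2)[of "Suc j"] cl by (simp add: m_assoc inv_mult_group)
    qed
  qed
  moreover have "Nn c"
  proof -
    have "Nn (c \<otimes> inv u)" using c Nn_sub[OF Num_u c(1)] by simp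
    then have "Nn ((c \<otimes> inv u) \<otimes> u)" by (rule Nn_mult[rotated 2, OF _ Nn_u]) (intro Num_mult Num_inv Num_u c)+
    then show ?thesis using cl by (simp add: m_assoc)
  qed
  moreover have "p i \<in> carrier G" "p (Suc i) \<in> carrier G" using p(2) Le_Num Num_closed by blast+
  ultimately have "Le (p (Suc i)) y"
    using model cl x p(1) unfolding model_def mul_ax_def by blast
  then show ?case using Le_trans x(5) by blast
qed

text \<open>No formula can exclude nonstandard codes; this is where finite generation of the
  competing group enters.\<close>

lemma standard_nonneg:
  assumes fg: "finitely_generated G" and x: "Num x" "Nn x"
  shows "\<exists>m. x = e (int m)"
proof (rule ccontr)
  assume "\<not> ?thesis"
  then have x': "Nn (x \<otimes> inv (e (int m)))" for m by (intro nonstandard_step x) blast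
  obtain S where S: "finite S" "S \<subseteq> carrier G" "generate G S = carrier G"
    using fg unfolding finitely_generated_def by blast
  define S' where "S' = S \<union> (\<lambda>x. inv x) ` S"
  have S': "finite S'" "S' \<subseteq> carrier G" using S by (auto simp: S'_def)
  have "\<forall>g\<in>carrier G. \<exists>d. Num d \<and> Bd g d" using model unfolding model_def bd_ax_def by blast
  then obtain d where d: "\<And>g. g \<in> carrier G \<Longrightarrow> Num (d g) \<and> Bd g (d g)" by metis
  \<comment> \<open>A single \<open>c\<close> serves several purposes: being above \<open>x\<close>
    it is nonstandard, being above \<open>n\<close> it suits the bound on products, being above 2 it
    gives strict growth, and it bounds the entries of all generators and their inverses.\<close>
  have "\<exists>c. Num c \<and> (\<forall>t\<in>{x, e (int n), u \<otimes> u} \<union> d ` S'. Le t c)"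
  proof (rule Num_bounded)
    show "finite ({x, e (int n), u \<otimes> u} \<union> d ` S')" using S' by simp
    show "Num t" if "t \<in> {x, e (int n), u \<otimes> u} \<union> d ` S'" for t
      using that x Num_e Num_mult[OF Num_u Num_u] d S' by blast
  qed
  then obtain c where c: "Num c" "Le x c" "Le (e (int n)) c" "Le (u \<otimes> u) c" and cd: "\<And>g. g \<in> S' \<Longrightarrow> Le (d g) c"
    by auto
  have ccl: "c \<in> carrier G" using c Num_closed by blast
  have bdS: "Bd g c" if g: "g \<in> S'" for g
  proof -
    have "g \<in> carrier G" "d g \<in> carrier G" using g S' d Num_closed by blast+
    then show ?thesis using model d cd[OF g] ccl unfolding model_def bd_ax_def by blast
  qed
  have "Le u (u \<otimes> u)"
    using Num_mult[OF Num_u Num_u] Num_u Nn_u by (simp add: le_def flip: m_assoc)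
  then have uc: "Le u c" using Le_trans c(4) by blast
  \<comment> \<open>Products of codes are only known to exist, so the powers of \<open>c\<close> are
    chosen one after another.\<close>
  have "\<exists>p. \<forall>i. (Num (p i) \<and> (i = 0 \<longrightarrow> p i = u)) \<and> Mul c (p i) (p (Suc i))"
    by (rule dependent_nat_choice) (use Num_u Mul_ex[OF c(1)] in auto)
  then obtain p where p: "\<And>i. Num (p i)" "p 0 = u" "\<And>i. Mul c (p i) (p (Suc i))" by blast
  have pcl: "p i \<in> carrier G" for i using p(1) Num_closed by blast
  have mul3: "Le u b \<and> \<not> Le b a" if "Le u a" "Mul c a b" "a \<in> carrier G" "b \<in> carrier G" for a b
    using model c(4) that ccl unfolding model_def mul_ax_def by blast
  have up: "Le u (p i)" for i
  proof (induction i)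
    case 0
    then show ?case using p(2) Le_refl Num_u by simp
  next
    case (Suc i)
    then show ?case using mul3 p pcl by blast
  qed
  have bdm: "\<exists>j. Bd (t \<otimes> g) (p j)" if t: "t \<in> carrier G" "Bd t (p i)" and g: "g \<in> S'" for t i g
  proof -
    have "g \<in> carrier G" using g S' by blast
    then have "Bd (t \<otimes> g) (p (Suc (Suc i)))"
      using model t bdS[OF g] p(3)[of i] p(3)[of "Suc i"] pcl ccl c(3)
      unfolding model_def bd_ax_def e_int by blast
    then show ?thesis by blast
  qed
  have all: "\<exists>i. Bd h (p i)" if h: "h \<in> carrier G" for h
  proof -
    let ?T = "{h \<in> carrier G. \<exists>i. Bd h (p i)}"
    have "Bd \<one> (p 0)" using model p(2) unfolding model_def bd_ax_def by simp
    then have one: "\<one> \<in> ?T" by blast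
    have "\<one> \<otimes> h \<in> ?T"
    proof (rule generate_right_closed[of h S ?T])
      show "t \<otimes> g \<in> ?T" "t \<otimes> inv g \<in> ?T" if "t \<in> ?T" "g \<in> S" for t g
        using that S bdm[of t _ g] bdm[of t _ "inv g"] by (auto simp: S'_def)
    qed (use h S one in auto)
    then show ?thesis using h by simp
  qed
  have bound: "\<exists>i. Le y (p i)" if "Num y" for y
  proof -
    have y: "y \<in> carrier G" using that Num_closed by blast
    obtain i where "Bd y (p i)" using all[OF y] by blast
    then have "Le y (p i)" using model that y pcl unfolding model_def bd_ax_def by blast
    then show ?thesis by blast
  qed
  obtain z where z: "z \<in> carrier G" "Big c c z" using model uc ccl unfolding model_def big_ax_def by blast
  have "Nn (c \<otimes> inv (e (int j)))" for j
  proof -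
    have "Nn (c \<otimes> inv x)" using c Nn_sub[OF x(1) c(1)] by simp
    then have "Nn ((c \<otimes> inv x) \<otimes> (x \<otimes> inv (e (int j))))"
      by (rule Nn_mult[rotated 2, OF _ x']) (intro Num_mult Num_inv Num_e x c)+
    then show ?thesis using ccl x Num_closed by (simp add: m_assoc)
  qed
  then have pz: "Le (p i) z" for i
    by (rule big_growth[where p = p, OF c(1) uc p(3) up p(2) c(1) _ z])
  obtain i where "Le z (p i)" using bound Le_Num(2)[OF pz] by blast
  \<comment> \<open>\<open>z\<close> lies below one power of \<open>c\<close> and above the next
    one, against strict growth.\<close>
  then have "Le (p (Suc i)) (p i)" using Le_trans pz by blast
  then show False using mul3[OF up p(3) pcl pcl] by blast
qed

lemma standard:
  assumes "finitely_generated G" "Num x"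
  shows "\<exists>k. x = e k"
  using Nn_total[OF assms(2)]
proof
  assume "Nn (inv x)"
  then obtain m where "inv x = e (int m)" using standard_nonneg[OF assms(1) Num_inv[OF assms(2)]] by blast
  then have "x = e (- int m)" using assms(2) Num_closed by (metis e_minus inv_inv)
  then show ?thesis by blast
qed (use standard_nonneg[OF assms] in blast)

end

lemma repr_cong:
  assumes "\<And>p. p \<in> {..<n} \<times> {..<n} \<Longrightarrow> A p = B p"
  shows "repr K n s g A \<longleftrightarrow> repr K n s g B"
proof -
  have "val K A i k j l = val K B i k j l" if "i < n" "k < n" "j < n" "l < n" for i k j l
    using assms that by (simp add: val_def)
  then show ?thesis by (simp add: repr_def)
qed

context sl_model
begin

section \<open>Integer matrices as codes of elements of a model\<close>

definition em :: "int mat \<Rightarrow> 'a tup" where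
  "em C = (\<lambda>p. e (C $$ p))"

lemma em_closed [simp]: "em C p \<in> carrier G"
  by (simp add: em_def)

lemma Repr_cong: "Repr g A \<Longrightarrow> (\<And>p. p \<in> {..<n} \<times> {..<n} \<Longrightarrow> A p = B p) \<Longrightarrow> Repr g B"
  using repr_cong[of n A B G s g] by simp

lemma
  assumes "\<And>p. p \<in> {..<n} \<times> {..<n} \<Longrightarrow> A p \<in> carrier G" "g \<in> carrier G" "Repr g A"
  shows Repr_colop: "l \<in> letters n \<Longrightarrow> Repr (g \<otimes> ltr G s l) (colop G A l)"
    and Repr_cen: "h \<in> carrier G \<Longrightarrow> Repr h A \<Longrightarrow> cen G (g \<otimes> inv h)"
    and Repr_lower: "(\<And>i j. i < n \<Longrightarrow> j < n \<Longrightarrow> i < j \<Longrightarrow> A (i, j) = \<one>) \<Longrightarrow> i < n \<Longrightarrow>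
      A (i, i) = u \<or> A (i, i) = inv u"
    and Repr_diag: "(\<And>i j. i < n \<Longrightarrow> j < n \<Longrightarrow> i \<noteq> j \<Longrightarrow> A (i, j) = \<one>) \<Longrightarrow> \<exists>v\<in>D. g = ev G s v"
    and Repr_unique: "(\<And>p. p \<in> {..<n} \<times> {..<n} \<Longrightarrow> B p \<in> carrier G) \<Longrightarrow> Repr g B \<Longrightarrow>
      (\<forall>p\<in>{..<n} \<times> {..<n}. B p = A p) \<or> (\<forall>p\<in>{..<n} \<times> {..<n}. B p = inv (A p))"
proof -
  have "\<forall>A. (\<forall>p\<in>{..<n} \<times> {..<n}. A p \<in> carrier G) \<longrightarrow> (\<forall>g\<in>carrier G. Repr g A \<longrightarrow>
        (\<forall>l\<in>letters n. Repr (g \<otimes> ltr G s l) (colop G A l)) \<and>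
        (\<forall>h\<in>carrier G. Repr h A \<longrightarrow> cen G (g \<otimes> inv h)) \<and>
        ((\<forall>i\<in>{..<n}. \<forall>j\<in>{..<n}. i < j \<longrightarrow> A (i, j) = \<one>) \<longrightarrow>
           (\<forall>i\<in>{..<n}. A (i, i) = u \<or> A (i, i) = inv u)) \<and>
        ((\<forall>i\<in>{..<n}. \<forall>j\<in>{..<n}. i \<noteq> j \<longrightarrow> A (i, j) = \<one>) \<longrightarrow> (\<exists>v\<in>D. g = ev G s v)) \<and>
        (\<forall>B. (\<forall>p\<in>{..<n} \<times> {..<n}. B p \<in> carrier G) \<longrightarrow> (Repr g B \<longrightarrow>
           (\<forall>p\<in>{..<n} \<times> {..<n}. B p = A p) \<or> (\<forall>p\<in>{..<n} \<times> {..<n}. B p = inv (A p)))))"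
    using model unfolding model_def repr_ax_def by (elim conjE) assumption
  note ax = this[rule_format, OF assms(1) assms(2,3), THEN conjunct1]
    this[rule_format, OF assms(1) assms(2,3), THEN conjunct2]
  show "l \<in> letters n \<Longrightarrow> Repr (g \<otimes> ltr G s l) (colop G A l)" using ax(1) by blast
  show "h \<in> carrier G \<Longrightarrow> Repr h A \<Longrightarrow> cen G (g \<otimes> inv h)" using ax(2)[THEN conjunct1] by blast
  note ax2 = ax(2)[THEN conjunct2]
  show "(\<And>i j. i < n \<Longrightarrow> j < n \<Longrightarrow> i < j \<Longrightarrow> A (i, j) = \<one>) \<Longrightarrow> i < n \<Longrightarrow>
      A (i, i) = u \<or> A (i, i) = inv u" using ax2[THEN conjunct1] by simp
  show "(\<And>i j. i < n \<Longrightarrow> j < n \<Longrightarrow> i \<noteq> j \<Longrightarrow> A (i, j) = \<one>) \<Longrightarrow> \<exists>v\<in>D. g = ev G s v"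
    using ax2[THEN conjunct2, THEN conjunct1] by simp
  show "(\<And>p. p \<in> {..<n} \<times> {..<n} \<Longrightarrow> B p \<in> carrier G) \<Longrightarrow> Repr g B \<Longrightarrow>
      (\<forall>p\<in>{..<n} \<times> {..<n}. B p = A p) \<or> (\<forall>p\<in>{..<n} \<times> {..<n}. B p = inv (A p))"
    using ax2[THEN conjunct2, THEN conjunct2] by blast
qed

lemma Repr_ex:
  assumes "g \<in> carrier G"
  obtains A where "\<And>p. p \<in> {..<n} \<times> {..<n} \<Longrightarrow> A p \<in> carrier G" "Repr g A"
proof -
  have "\<forall>g\<in>carrier G. \<exists>A. (\<forall>p\<in>{..<n} \<times> {..<n}. A p \<in> carrier G) \<and> Repr g A"
    using model unfolding model_def repr_ax_def by (elim conjE) assumption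
  from bspec[OF this assms] obtain A where "\<forall>p\<in>{..<n} \<times> {..<n}. A p \<in> carrier G" "Repr g A"
    by (elim exE conjE)
  then show thesis by (intro that) (rule bspec)
qed

lemma Repr_one: "Repr \<one> (em (1\<^sub>m n))"
proof -
  have "Repr \<one> (idm G s)" using model unfolding model_def repr_ax_def by (elim conjE) assumption
  moreover have "idm G s p = em (1\<^sub>m n) p" if "p \<in> {..<n} \<times> {..<n}" for p
    using that by (auto simp: idm_def em_def)
  ultimately show ?thesis by (rule Repr_cong)
qed

lemma ev_carrier: "set w \<subseteq> letters n \<Longrightarrow> ev G s w \<in> carrier G"
  by (rule ev_closed[OF s_closed])

text \<open>Operations on the integer matrix and multiplication in the model run in parallel, so the
  column reduction of matrices can steer elements of the model.\<close>

lemma Repr_word: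
  assumes C: "C \<in> carrier_mat n n" and g: "g \<in> carrier G" "Repr g (em C)" and "set w \<subseteq> letters n"
  shows "Repr (g \<otimes> ev G s w) (em (C * evs n w))"
  using assms(4)
proof (induction w rule: rev_induct)
  case Nil
  then show ?case using C g by simp
next
  case (snoc x w)
  obtain k l b where x: "x = (k, l, b)" by (cases x)
  have w: "set w \<subseteq> letters n" and xl: "x \<in> letters n" using snoc.prems by auto
  have gw: "g \<otimes> ev G s w \<in> carrier G" using g ev_carrier[OF w] by simp
  have "Repr (g \<otimes> ev G s w \<otimes> ltr G s x) (colop G (em (C * evs n w)) x)"
    by (rule Repr_colop[OF _ gw snoc.IH[OF w] xl]) simp
  moreover have "colop G (em (C * evs n w)) x p = em (C * evs n (w @ [x])) p" if pn: "p \<in> {..<n} \<times> {..<n}" for p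
  proof -
    obtain i j where p: "p = (i, j)" "i < n" "j < n" using pn by auto
    show ?thesis
      using evs_snoc_entry[OF C w, of k l b i j] xl p x
      by (simp add: colop_def em_def e_add e_minus e_diff)
  qed
  ultimately have "Repr (g \<otimes> ev G s w \<otimes> ltr G s x) (em (C * evs n (w @ [x])))" by (rule Repr_cong)
  then show ?case
    using g(1) ev_carrier[OF w] ltr_closed[OF s_closed xl] by (simp add: ev_snoc m_assoc)
qed

lemma Repr_ev:
  assumes "set w \<subseteq> letters n"
  shows "Repr (ev G s w) (em (evs n w))"
  using Repr_word[OF _ _ Repr_one assms] ev_carrier[OF assms] evs_carrier[OF assms] by simp

lemma Repr_Num:
  assumes "\<And>p. p \<in> {..<n} \<times> {..<n} \<Longrightarrow> A p \<in> carrier G" "Repr g A" "i < n" "j < n"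
  shows "Num (A (i, j))"
proof -
  have "ent G n s (tst G s i i j j g) (val G A i i j j)" using assms by (simp add: repr_def)
  moreover have "val G A i i j j = A (i, j)" using assms by (simp add: val_def)
  ultimately show ?thesis by (simp add: ent_def)
qed

text \<open>As codes are standard, \<open>g\<close> is coded by an integer matrix \<open>C\<close>.
  Nothing is assumed about its determinant; after reduction to triangular form the units on the
  diagonal come from \<open>Repr_lower\<close>, and the diagonal form is then a word in
  \<open>D\<close>.\<close>

lemma word_of:
  assumes fg: "finitely_generated G" and D: "\<And>w. w \<in> D \<Longrightarrow> set w \<subseteq> letters n" and g: "g \<in> carrier G"
  obtains w where "set w \<subseteq> letters n" "g = ev G s w"
proof -
  obtain A where A: "\<And>p. p \<in> {..<n} \<times> {..<n} \<Longrightarrow> A p \<in> carrier G" "Repr g A" using Repr_ex[OF g] by blast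
  have "\<exists>k. A (i, j) = e k" if "i < n" "j < n" for i j
    using standard[OF fg Repr_Num[OF A that]] .
  then have "\<forall>p\<in>{..<n} \<times> {..<n}. \<exists>k. A p = e k" by auto
  from bchoice[OF this] obtain f where f: "A p = e (f p)" if "p \<in> {..<n} \<times> {..<n}" for p by blast
  define C where "C = mat n n f"
  have C: "C \<in> carrier_mat n n" by (simp add: C_def)
  have "A p = em C p" if "p \<in> {..<n} \<times> {..<n}" for p using that f by (auto simp: C_def em_def)
  then have RC: "Repr g (em C)" by (rule Repr_cong[OF A(2)])
  have one: "em M (i, j) = \<one>" if "M $$ (i, j) = 0" for M :: "int mat" and i j
    using that by (simp add: em_def)
  have u1: "\<bar>k\<bar> = 1" if "e k = u \<or> e k = inv u" for k
    using that e_inj[of k 1] e_inj[of k "- 1"] by (auto simp: e_minus)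
  obtain v where v: "set v \<subseteq> letters n" "\<forall>i<n. \<forall>j<n. i < j \<longrightarrow> (C * evs n v) $$ (i, j) = 0"
    using lower_triangularize[OF C order_refl] by blast
  have Cv: "C * evs n v \<in> carrier_mat n n" using C evs_carrier[OF v(1)] by simp
  have gv: "g \<otimes> ev G s v \<in> carrier G" using g ev_carrier[OF v(1)] by simp
  have Rv: "Repr (g \<otimes> ev G s v) (em (C * evs n v))" by (rule Repr_word[OF C g RC v(1)])
  have diag: "\<bar>(C * evs n v) $$ (i, i)\<bar> = 1" if "i < n" for i
  proof -
    have "em (C * evs n v) (i, i) = u \<or> em (C * evs n v) (i, i) = inv u"
      using v(2) that by (intro Repr_lower[OF _ gv Rv] one) auto
    then show ?thesis using u1 by (simp add: em_def)
  qed
  obtain w where w: "set w \<subseteq> letters n"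
    "\<forall>i<n. \<forall>j<n. i < j \<or> i < n \<and> i \<noteq> j \<longrightarrow> (C * evs n v * evs n w) $$ (i, j) = 0"
    using diagonalize[OF Cv _ diag order_refl] v(2) by blast
  have Rw: "Repr (g \<otimes> ev G s v \<otimes> ev G s w) (em (C * evs n v * evs n w))"
    by (rule Repr_word[OF Cv gv Rv w(1)])
  have gw: "g \<otimes> ev G s v \<otimes> ev G s w \<in> carrier G" using gv ev_carrier[OF w(1)] by simp
  have "\<exists>x\<in>D. g \<otimes> ev G s v \<otimes> ev G s w = ev G s x"
    using w(2) by (intro Repr_diag[OF _ gw Rw] one) auto
  then obtain x where x: "x \<in> D" "g \<otimes> ev G s v \<otimes> ev G s w = ev G s x" by blast
  note l = D[OF x(1)] v(1) w(1)
  have l': "set (winv v) \<subseteq> letters n" "set (winv w) \<subseteq> letters n" using l letters_winv by blast+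
  have "g = (g \<otimes> ev G s v \<otimes> ev G s w) \<otimes> inv (ev G s w) \<otimes> inv (ev G s v)"
    using g ev_carrier[OF l(2)] ev_carrier[OF l(3)] by (simp add: m_assoc)
  also have "\<dots> = ev G s (x @ winv w @ winv v)"
    unfolding x(2) using l l' by (simp add: ev_append[OF s_closed] ev_winv[OF s_closed] m_assoc ev_carrier)
  finally have "g = ev G s (x @ winv w @ winv v)" .
  then show thesis by (rule that[rotated]) (use l l' in simp)
qed

text \<open>The automaton reads the word; the squares accumulate on the left while the current state
  stays on the right.\<close>

lemma ev_squares:
  assumes Y: "[] \<in> Y" "\<And>w. w \<in> Y \<Longrightarrow> set w \<subseteq> letters n"
      "\<And>w l. w \<in> Y \<Longrightarrow> l \<in> letters n \<Longrightarrow> \<delta> w l \<in> Y"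
    and w: "set w \<subseteq> letters n"
  shows "foldl \<delta> [] w \<in> Y \<and> (\<exists>k x. (\<forall>i. x i \<in> carrier G) \<and> (\<forall>i<k. core G n J (x i)) \<and>
    ev G s w = sqs G x k \<otimes> ev G s (foldl \<delta> [] w))"
  using w
proof (induction w rule: rev_induct)
  case Nil
  show ?case using Y(1) by (auto intro!: exI[of _ "0::nat"] exI[of _ "\<lambda>_. \<one>"])
next
  case (snoc l w)
  have w: "set w \<subseteq> letters n" and l: "l \<in> letters n" using snoc.prems by auto
  let ?y = "foldl \<delta> [] w"
  obtain k x where x: "?y \<in> Y" "\<And>i. x i \<in> carrier G" "\<And>i. i < k \<Longrightarrow> core G n J (x i)"
    "ev G s w = sqs G x k \<otimes> ev G s ?y" using snoc.IH[OF w] by blast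
  have "cert_ax G n J L Y \<delta> s" using model by (simp add: model_def)
  then obtain z where z: "\<forall>i\<in>{..<L}. z i \<in> carrier G" "\<forall>i\<in>{..<L}. core G n J (z i)"
    "ev G s ?y \<otimes> ltr G s l = sqs G z L \<otimes> ev G s (\<delta> ?y l)" using x(1) l unfolding cert_ax_def by blast
  \<comment> \<open>The certificate constrains \<open>z\<close> only below \<open>L\<close>;
    elsewhere \<open>\<one>\<close> keeps the values in the carrier.\<close>
  define z' where "z' i = (if i < L then z i else \<one>)" for i
  have z': "z' i \<in> carrier G" "i < L \<Longrightarrow> core G n J (z' i)" for i using z by (auto simp: z'_def)
  have "sqs G z L = sqs G z' L" by (rule sqs_cong) (simp add: z'_def)
  note z3 = z(3)[unfolded this]
  let ?x = "\<lambda>i. if i < k then x i else z' (i - k)"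
  have dY: "\<delta> ?y l \<in> Y" by (rule Y(3)[OF x(1) l])
  note cl = sqs_closed[of k x, OF x(2)] sqs_closed[of L z', OF z'(1)] ev_carrier[OF Y(2)[OF x(1)]]
    ev_carrier[OF Y(2)[OF dY]] ltr_closed[OF s_closed l]
  have "ev G s (w @ [l]) = sqs G x k \<otimes> (ev G s ?y \<otimes> ltr G s l)" using cl by (simp add: ev_snoc x(4) m_assoc)
  also have "\<dots> = sqs G ?x (k + L) \<otimes> ev G s (\<delta> ?y l)"
    using cl sqs_append[of x z' k L] x(2) z'(1) by (simp add: z3 m_assoc)
  finally have "ev G s (w @ [l]) = sqs G ?x (k + L) \<otimes> ev G s (foldl \<delta> [] (w @ [l]))" by simp
  moreover have "\<forall>i. ?x i \<in> carrier G" "\<forall>i<k + L. core G n J (?x i)" using x(2,3) z' by auto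
  ultimately show ?case using dY by (intro conjI exI[of _ "k + L"] exI[of _ ?x]) simp_all
qed

text \<open>The value of the word and \<open>\<one>\<close> are both coded by the identity matrix,
  so the value is central. The final state is empty, so it is also a product of squares of core
  elements, and \<open>sign_ax\<close> applies.\<close>

lemma evs_one_imp:
  assumes Y: "[] \<in> Y" "\<And>w. w \<in> Y \<Longrightarrow> set w \<subseteq> letters n"
      "\<And>w l. w \<in> Y \<Longrightarrow> l \<in> letters n \<Longrightarrow> \<delta> w l \<in> Y"
    and sign: "\<And>k. sign_ax G n J k"
    and w: "set w \<subseteq> letters n" "evs n w = 1\<^sub>m n" "foldl \<delta> [] w = []"
  shows "ev G s w = \<one>"
proof -
  have ec: "ev G s w \<in> carrier G" by (rule ev_carrier[OF w(1)])
  have "Repr (ev G s w) (em (1\<^sub>m n))" using Repr_ev[OF w(1)] w(2) by simp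
  then have "cen G (ev G s w \<otimes> inv \<one>)" by (rule Repr_cen[OF em_closed ec _ one_closed Repr_one])
  then have cen: "cen G (ev G s w)" using ec by simp
  obtain k x where x: "\<And>i. x i \<in> carrier G" "\<forall>i<k. core G n J (x i)"
    "ev G s w = sqs G x k \<otimes> ev G s (foldl \<delta> [] w)" using ev_squares[OF Y w(1)] by blast
  have "ev G s w = sqs G x k" using x(3) w(3) sqs_closed[of k x, OF x(1)] by simp
  then show ?thesis using sign[of k] cen x(1,2) unfolding sign_ax_def by auto
qed

text \<open>\<open>Repr_unique\<close> leaves the sign open; the case of -1 is excluded later by
  means of \<open>Z\<close>.\<close>

lemma ev_one_imp:
  assumes w: "set w \<subseteq> letters n" "ev G s w = \<one>"
  shows "evs n w = 1\<^sub>m n \<or> evs n w = - 1\<^sub>m n"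
proof -
  have R: "Repr \<one> (em (evs n w))" using Repr_ev[OF w(1)] w(2) by simp
  have c: "evs n w \<in> carrier_mat n n" by (rule evs_carrier[OF w(1)])
  from Repr_unique[OF em_closed one_closed Repr_one em_closed R] show ?thesis
  proof
    assume "\<forall>p\<in>{..<n} \<times> {..<n}. em (evs n w) p = em (1\<^sub>m n) p"
    then have "evs n w = 1\<^sub>m n" using c by (intro eq_matI) (auto simp: em_def e_inj)
    then show ?thesis ..
  next
    assume "\<forall>p\<in>{..<n} \<times> {..<n}. em (evs n w) p = inv (em (1\<^sub>m n) p)"
    then have "evs n w = - 1\<^sub>m n" using c by (intro eq_matI) (auto simp: em_def e_inj simp flip: e_minus)
    then show ?thesis ..
  qed
qed

end

section \<open>Rigidity\<close>

lemma evs_one_iff_eq: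
  assumes "set v \<subseteq> letters n" "set w \<subseteq> letters n"
  shows "evs n (v @ winv w) = 1\<^sub>m n \<longleftrightarrow> evs n v = evs n w"
proof -
  interpret SL: group "SL_int n" by (rule group_SL)
  have "evs n (v @ winv w) = evs n v \<otimes>\<^bsub>SL_int n\<^esub> inv\<^bsub>SL_int n\<^esub> evs n w"
    using assms letters_winv[of w n] by (simp add: evs_append evs_winv)
  also have "\<dots> = 1\<^sub>m n \<longleftrightarrow> evs n v = evs n w"
    using SL.inv_solve_right'[of "\<one>\<^bsub>SL_int n\<^esub>" "evs n v" "evs n w"] SL.l_one[of "evs n w"]
      evs_closed[OF assms(1)] evs_closed[OF assms(2)] by (auto simp del: SL_simps simp: SL_simps(2)[symmetric])
  finally show ?thesis .
qed

lemma model_iso: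
  fixes H :: "('b, 'k) monoid_scheme"
  assumes n: "3 \<le> n" and H: "group H" "finitely_generated H"
    and s: "\<And>p. p \<in> {..<n} \<times> {..<n} \<Longrightarrow> s p \<in> carrier H" and m: "model H n J L Y \<delta> D Z s"
    and sign: "\<And>k. sign_ax H n J k"
    and Y: "[] \<in> Y" "\<And>w. w \<in> Y \<Longrightarrow> set w \<subseteq> letters n" "\<And>w l. w \<in> Y \<Longrightarrow> l \<in> letters n \<Longrightarrow> \<delta> w l \<in> Y"
    and D: "\<And>w. w \<in> D \<Longrightarrow> set w \<subseteq> letters n"
    and \<delta>: "\<And>w. set w \<subseteq> letters n \<Longrightarrow> evs n w = 1\<^sub>m n \<Longrightarrow> foldl \<delta> [] w = []"
    and Z: "\<And>w. w \<in> Z \<Longrightarrow> set w \<subseteq> letters n" "- 1\<^sub>m n \<in> carrier (SL_int n) \<Longrightarrow> \<exists>w\<in>Z. evs n w = - 1\<^sub>m n"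
  shows "H \<cong> SL_int n"
proof -
  interpret sl_model H n J L Y \<delta> D Z s
    by (rule sl_model.intro[OF H(1)], unfold_locales) (use n s m in auto)
  interpret SL: group "SL_int n" by (rule group_SL)
  have one1: "ev H s w = \<one>\<^bsub>H\<^esub>" if "set w \<subseteq> letters n" "evs n w = 1\<^sub>m n" for w
    by (rule evs_one_imp[OF Y sign that \<delta>[OF that]])
  have app: "ev H s (v @ winv w) = ev H s v \<otimes>\<^bsub>H\<^esub> inv\<^bsub>H\<^esub> ev H s w" if "set v \<subseteq> letters n" "set w \<subseteq> letters n" for v w
    using that letters_winv[of w n] by (simp add: ev_append[OF s_closed] ev_winv[OF s_closed])
  have one2: "evs n w = 1\<^sub>m n" if w: "set w \<subseteq> letters n" "ev H s w = \<one>\<^bsub>H\<^esub>" for w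
  proof (rule ccontr)
    assume "evs n w \<noteq> 1\<^sub>m n"
    then have neg: "evs n w = - 1\<^sub>m n" using ev_one_imp[OF w] by blast
    \<comment> \<open>A word in \<open>Z\<close> for -1 would have the same value in
      \<open>H\<close> as \<open>w\<close>, namely \<open>\<one>\<close>, which \<open>model\<close>
      forbids.\<close>
    then obtain z where z: "z \<in> Z" "evs n z = - 1\<^sub>m n" using Z(2) evs_closed[OF w(1)] by auto
    have zl: "set z \<subseteq> letters n" by (rule Z(1)[OF z(1)])
    have "evs n (w @ winv z) = 1\<^sub>m n" using evs_one_iff_eq[OF w(1) zl] neg z(2) by simp
    then have "ev H s (w @ winv z) = \<one>\<^bsub>H\<^esub>" by (rule one1[rotated]) (use w zl letters_winv[of z n] in simp)
    then have "ev H s z = \<one>\<^bsub>H\<^esub>" using app[OF w(1) zl] w(2) ev_carrier[OF zl] by (simp add: inv_eq_1_iff)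
    moreover have "ev H s z \<noteq> \<one>\<^bsub>H\<^esub>" using m z(1) by (simp add: model_def)
    ultimately show False by simp
  qed
  have eq: "ev H s v = ev H s w \<longleftrightarrow> evs n v = evs n w" if vw: "set v \<subseteq> letters n" "set w \<subseteq> letters n" for v w
  proof -
    have l: "set (v @ winv w) \<subseteq> letters n" using vw letters_winv[of w n] by simp
    have "ev H s v = ev H s w \<longleftrightarrow> ev H s (v @ winv w) = \<one>\<^bsub>H\<^esub>"
      using app[OF vw] ev_carrier[OF vw(1)] ev_carrier[OF vw(2)] inv_solve_right'[of "\<one>\<^bsub>H\<^esub>"] by auto
    also have "\<dots> \<longleftrightarrow> evs n (v @ winv w) = 1\<^sub>m n" using one1[OF l] one2[OF l] by blast
    finally show ?thesis using evs_one_iff_eq[OF vw] by simp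
  qed
  \<comment> \<open>By \<open>eq\<close> the matrix does not depend on the word chosen for
    \<open>g\<close>.\<close>
  define \<phi> where "\<phi> g = evs n (SOME w. set w \<subseteq> letters n \<and> g = ev H s w)" for g
  have \<phi>: "\<phi> (ev H s w) = evs n w" if w: "set w \<subseteq> letters n" for w
  proof -
    have "\<exists>v. set v \<subseteq> letters n \<and> ev H s w = ev H s v" using w by blast
    then have "set (SOME v. set v \<subseteq> letters n \<and> ev H s w = ev H s v) \<subseteq> letters n \<and>
      ev H s w = ev H s (SOME v. set v \<subseteq> letters n \<and> ev H s w = ev H s v)" by (rule someI_ex)
    then show ?thesis unfolding \<phi>_def using eq[THEN iffD1, OF w] by (elim conjE) simp
  qed
  have word: "\<exists>w. set w \<subseteq> letters n \<and> g = ev H s w" if "g \<in> carrier H" for g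
    by (rule word_of[OF H(2) D that]) blast+
  have "\<phi> \<in> iso H (SL_int n)"
  proof (rule isoI)
    show "\<phi> \<in> hom H (SL_int n)"
    proof (rule homI)
      fix x assume "x \<in> carrier H"
      then obtain v where v: "set v \<subseteq> letters n" "x = ev H s v" using word by blast
      then show "\<phi> x \<in> carrier (SL_int n)" using \<phi> evs_closed[OF v(1)] by simp
      fix y assume "y \<in> carrier H"
      then obtain w where w: "set w \<subseteq> letters n" "y = ev H s w" using word by blast
      have "x \<otimes>\<^bsub>H\<^esub> y = ev H s (v @ w)" using v w by (simp add: ev_append[OF s_closed])
      then show "\<phi> (x \<otimes>\<^bsub>H\<^esub> y) = \<phi> x \<otimes>\<^bsub>SL_int n\<^esub> \<phi> y" using v w \<phi> by (simp add: evs_append)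
    qed
    show "bij_betw \<phi> (carrier H) (carrier (SL_int n))"
    proof (rule bij_betw_imageI)
      show "inj_on \<phi> (carrier H)"
      proof (rule inj_onI)
        fix x y assume "x \<in> carrier H" "y \<in> carrier H" "\<phi> x = \<phi> y"
        moreover obtain v where "set v \<subseteq> letters n" "x = ev H s v" using word[OF calculation(1)] by blast
        moreover obtain w where "set w \<subseteq> letters n" "y = ev H s w" using word[OF calculation(2)] by blast
        ultimately show "x = y" using \<phi> eq by simp
      qed
      show "\<phi> ` carrier H = carrier (SL_int n)"
      proof (intro equalityI subsetI)
        fix A assume "A \<in> \<phi> ` carrier H"
        then obtain x where x: "x \<in> carrier H" "A = \<phi> x" by (rule imageE)
        obtain v where v: "set v \<subseteq> letters n" "x = ev H s v" using word[OF x(1)] by blast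
        show "A \<in> carrier (SL_int n)" unfolding x(2) v(2) \<phi>[OF v(1)] by (rule evs_closed[OF v(1)])
      next
        fix A assume "A \<in> carrier (SL_int n)"
        then obtain w where w: "set w \<subseteq> letters n" "A = evs n w" by (rule SL_word)
        show "A \<in> \<phi> ` carrier H"
          by (rule image_eqI[of _ _ "ev H s w"]) (use w \<phi> ev_carrier in auto)
      qed
    qed
  qed
  then show ?thesis by (rule is_isoI)
qed

theorem corollary3p4:
  fixes n :: nat
  assumes "n \<ge> 3"
  shows "first_order_rigid TYPE('b) (SL_int n)"
  unfolding first_order_rigid_def
proof (intro conjI allI impI)
  show "group (SL_int n)" by (rule group_SL)
  show "finitely_generated (SL_int n)" by (rule finitely_generated_SL)
  fix H :: "'b monoid"
  assume H: "group H" "finitely_generated H" "elementarily_equivalent H (SL_int n)"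
  interpret sl3 n by unfold_locales (rule assms)
  interpret definability "SL_int n" H n
    by (intro definability.intro two_groups.intro definability_axioms.intro group_SL H assms)
  obtain J L Y \<delta> D Z where m: "finite Y" "[] \<in> Y" "\<forall>w\<in>Y. set w \<subseteq> letters n" "\<forall>w\<in>Y. \<forall>l\<in>letters n. \<delta> w l \<in> Y"
    "finite D" "\<forall>w\<in>D. set w \<subseteq> letters n" "finite Z" "\<forall>w\<in>Z. set w \<subseteq> letters n"
    "model (SL_int n) n J L Y \<delta> D Z (gens n)" "\<forall>k. sign_ax (SL_int n) n J k"
    "\<forall>w. set w \<subseteq> letters n \<longrightarrow> evs n w = 1\<^sub>m n \<longrightarrow> foldl \<delta> [] w = []"
    "- 1\<^sub>m n \<in> carrier (SL_int n) \<longrightarrow> (\<exists>w\<in>Z. evs n w = - 1\<^sub>m n)"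
    using SL_model by (elim exE conjE) (rule that)
  \<comment> \<open>The elementary matrices are one witness of the formula; in \<open>H\<close>
    transfer yields some witness.\<close>
  have "\<exists>s. (\<forall>p\<in>{..<n} \<times> {..<n}. s p \<in> carrier (SL_int n)) \<and> model (SL_int n) n J L Y \<delta> D Z s"
    using gens_closed m(9) by blast
  then have "\<exists>s. (\<forall>p\<in>{..<n} \<times> {..<n}. s p \<in> carrier H) \<and> model H n J L Y \<delta> D Z s"
    by (subst transfer_model[OF H(3), symmetric]) (use m in auto)
  then obtain s where s: "\<forall>p\<in>{..<n} \<times> {..<n}. s p \<in> carrier H" "model H n J L Y \<delta> D Z s" by blast
  \<comment> \<open>These sentences mention no tuple, so they hold in \<open>H\<close> for every
    \<open>k\<close>, whichever \<open>s\<close> was obtained.\<close>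
  have sign: "sign_ax H n J k" for k using transfer_sign_ax[OF H(3)] m(10) by blast
  show "H \<cong> SL_int n"
    by (rule model_iso[OF assms H(1,2) _ s(2) sign]) (use bspec[OF s(1)] m in \<open>simp_all del: SL_simps\<close>)
qed

end
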